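(* For an integer $i\ge 3$ let $C_i$ denote the plane map whose underlying graph is a cycle of length $i$. For each $k\ge1$ there is a homomorphism $C_{2k+3}\to C_{2k+1}$, and there is a gap between $C_{2k+3}$ and $C_{2k+1}$: there is no core $N$ of signed genus $0$ with $C_{2k+3}<N<C_{2k+1}$, where $A<B$ means there is a homomorphism $A\to B$ but none $B\to A$.
   Context: Maps. A map $M$ is a tuple $(C,\alpha_0,\alpha_1,\alpha_2)$, where $C$ is a finite set (of crosses) and $\alpha_0,\alpha_1,\alpha_2$ are fixed-point-free involutions of $C$ with $\alpha_0\alpha_2=\alpha_2\alpha_0$, together with a finite number (possibly zero) of isolated vertices. Vertex permutation $\tau=\alpha_1\alpha_2$, face permutation $\phi=\alpha_1\alpha_0$. Vertices: orbits of $\langle\alpha_1,\alpha_2\rangle$ on $C$ plus isolated vertices; edges: orbits of $\langle\alpha_0,\alpha_2\rangle$; faces: orbits of $\langle\alpha_0,\alpha_1\rangle$ plus one face per isolated vertex; connected components: orbits of $\langle\alpha_0,\alpha_1,\alpha_2\rangle$ plus one per isolated vertex. The underlying graph has the vertices and edges with the induced incidence. A cross is incident with the vertex/face containing it; two crosses are coincident with a face if they lie in the same cycle of $\phi$; the degree of a face is the number of crosses in one of its $\phi$-cycles. $\mathbf v,\mathbf e,\mathbf f,\mathbf k$ count vertices, edges, faces, components. For connected $M$ with an edge, $\mathbf o(M)$ is the number of orbits of $\langle\alpha_0\alpha_2,\alpha_1\alpha_2\rangle$ on $C$; an edgeless connected map has $\mathbf o=2$; in general $\mathbf o$ is the minimum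 over components. $\boldsymbol\chi=\mathbf v-\mathbf e+\mathbf f$, $\mathbf{eg}=2\mathbf k-\boldsymbol\chi$, $\mathbf g=\mathbf{eg}/\mathbf o$, signed genus $\mathbf{sg}=(2\mathbf o-3)\mathbf g$; a map is plane if $\mathbf{eg}=0$. Isomorphism: same number of isolated vertices and a bijection of crosses commuting with each $\alpha_i$. Deletion and submaps: $M\backslash e$ removes the four crosses of edge $e$, restricts $\alpha_0,\alpha_2$, and chooses $\alpha_1$ so that the new vertex permutation cycles are those of $\tau$ with the crosses of $e$ removed (a vertex all of whose crosses lie in $e$ becomes isolated). Deleting a vertex deletes its incident edges then removes it. A submap is obtained by deleting some edges then some vertices; proper if different from $M$. Vertex gluing: for distinct crosses $a,b$ let $M^{(a\,b)}=(C,\alpha_0,(a\;b)\alpha_1(a\;b),\alpha_2)$. If $a,b$ are incident with distinct vertices and either are coincident with a common face or lie in different components, passing to $M^{(a\,b)}$ is a vertex gluing; deleting an isolated vertex when gluing it to another vertex is also a vertex gluing. Duplicate edges: two distinct edges incident with a common face of degree two; gluing them replaces $M$ by (a map isomorphic to) $M\backslash f$ for one of them $f$. Homomorphisms and cores: for $\mathbf{sg}(M)=\mathbf{sg}(M')$, a homomorphism $M\to M'$ exists if $M'$ has a submap isomorphic to a map obtained from $M$ by a finite sequence of vertex gluings and duplicate edge gluings. A map is a core if there is no homomorphism from it to a proper submap of itself. *)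

theory Defs
  imports Complex_Main "HOL-Combinatorics.Combinatorics"
begin

text \<open>
  The number of isolated vertices is a component of the record, since they carry no crosses.
  The \<open>alpha\<close>'s are total functions that are the identity outside \<open>crosses\<close>
  (this is part of \<open>permutes\<close>), so that equality of records is equality of maps.
\<close>

record 'a premap =
  crosses :: "'a set"
  alpha0 :: "'a \<Rightarrow> 'a"
  alpha1 :: "'a \<Rightarrow> 'a"
  alpha2 :: "'a \<Rightarrow> 'a"
  isolated :: nat

definition fpf_involution_on :: "'a set \<Rightarrow> ('a \<Rightarrow> 'a) \<Rightarrow> bool" where
  "fpf_involution_on C f \<longleftrightarrow> f permutes C \<and> (\<forall>c\<in>C. f (f c) = c \<and> f c \<noteq> c)"

definition is_map :: "'a premap \<Rightarrow> bool" where
  "is_map M \<longleftrightarrow> finite (crosses M) \<and>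
     fpf_involution_on (crosses M) (alpha0 M) \<and>
     fpf_involution_on (crosses M) (alpha1 M) \<and>
     fpf_involution_on (crosses M) (alpha2 M) \<and>
     alpha0 M \<circ> alpha2 M = alpha2 M \<circ> alpha0 M"

definition vperm :: "'a premap \<Rightarrow> 'a \<Rightarrow> 'a" where
  "vperm M = alpha1 M \<circ> alpha2 M"

definition fperm :: "'a premap \<Rightarrow> 'a \<Rightarrow> 'a" where
  "fperm M = alpha1 M \<circ> alpha0 M"

text \<open>For permutations \<open>F\<close>, this is the orbit of \<open>x\<close> under the group generated by \<open>F\<close>.\<close>

definition gorbit :: "('a \<Rightarrow> 'a) set \<Rightarrow> 'a \<Rightarrow> 'a set" where
  "gorbit F x = {y. equivclp (\<lambda>u v. \<exists>f\<in>F. v = f u) x y}"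

definition gorbits :: "('a \<Rightarrow> 'a) set \<Rightarrow> 'a set \<Rightarrow> 'a set set" where
  "gorbits F C = gorbit F ` C"

definition vertex_of :: "'a premap \<Rightarrow> 'a \<Rightarrow> 'a set" where
  "vertex_of M = gorbit {alpha1 M, alpha2 M}"

definition edge_of :: "'a premap \<Rightarrow> 'a \<Rightarrow> 'a set" where
  "edge_of M = gorbit {alpha0 M, alpha2 M}"

definition face_of :: "'a premap \<Rightarrow> 'a \<Rightarrow> 'a set" where
  "face_of M = gorbit {alpha0 M, alpha1 M}"

definition component_of :: "'a premap \<Rightarrow> 'a \<Rightarrow> 'a set" where
  "component_of M = gorbit {alpha0 M, alpha1 M, alpha2 M}"

text \<open>
  \<open>Inl\<close> tags the orbits on crosses; \<open>Inr i\<close> is the \<open>i\<close>-th isolated vertex, the face it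
  contributes, or the component it forms.
\<close>

definition vertices :: "'a premap \<Rightarrow> ('a set + nat) set" where
  "vertices M = vertex_of M ` crosses M <+> {..<isolated M}"

definition edges :: "'a premap \<Rightarrow> 'a set set" where
  "edges M = edge_of M ` crosses M"

definition faces :: "'a premap \<Rightarrow> ('a set + nat) set" where
  "faces M = face_of M ` crosses M <+> {..<isolated M}"

definition map_components :: "'a premap \<Rightarrow> ('a set + nat) set" where
  "map_components M = component_of M ` crosses M <+> {..<isolated M}"

text \<open>Number of orbits of the orientation-preserving subgroup on a single component.\<close>

definition comp_orient :: "'a premap \<Rightarrow> 'a set + nat \<Rightarrow> nat" where
  "comp_orient M K = (case K of
      Inl D \<Rightarrow> card (gorbits {alpha0 M \<circ> alpha2 M, alpha1 M \<circ> alpha2 M} D)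
    | Inr _ \<Rightarrow> 2)"

text \<open>
  For the empty map the minimum is over the empty set, hence unspecified; its Euler genus
  is \<open>0\<close>, so its genus and signed genus are \<open>0\<close> regardless.
\<close>

definition orient :: "'a premap \<Rightarrow> nat" where
  "orient M = Min (comp_orient M ` map_components M)"

definition euler_char :: "'a premap \<Rightarrow> int" where
  "euler_char M = int (card (vertices M)) - int (card (edges M)) + int (card (faces M))"

definition euler_genus :: "'a premap \<Rightarrow> int" where
  "euler_genus M = 2 * int (card (map_components M)) - euler_char M"

definition genus :: "'a premap \<Rightarrow> real" where
  "genus M = real_of_int (euler_genus M) / real (orient M)"

definition signed_genus :: "'a premap \<Rightarrow> real" where
  "signed_genus M = (2 * real (orient M) - 3) * genus M"

definition plane :: "'a premap \<Rightarrow> bool" where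
  "plane M \<longleftrightarrow> euler_genus M = 0"

definition map_iso :: "'a premap \<Rightarrow> 'b premap \<Rightarrow> bool" where
  "map_iso M M' \<longleftrightarrow> isolated M = isolated M' \<and>
     (\<exists>h. bij_betw h (crosses M) (crosses M') \<and>
        (\<forall>c\<in>crosses M. h (alpha0 M c) = alpha0 M' (h c) \<and>
                        h (alpha1 M c) = alpha1 M' (h c) \<and>
                        h (alpha2 M c) = alpha2 M' (h c)))"

text \<open>
  Deletion of a set of edges. \<open>skip t D\<close> is the permutation whose cycles are those of \<open>t\<close>
  with the elements of \<open>D\<close> removed. As the new vertex permutation is the new \<open>alpha1\<close>
  composed with the restriction of the involution \<open>alpha2\<close>, the new \<open>alpha1\<close> is recovered
  by composing with \<open>alpha2\<close> once more.
\<close>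

definition skip :: "('a \<Rightarrow> 'a) \<Rightarrow> 'a set \<Rightarrow> 'a \<Rightarrow> 'a" where
  "skip t D c = (t ^^ (LEAST n. 0 < n \<and> (t ^^ n) c \<notin> D)) c"

definition delete_edges :: "'a premap \<Rightarrow> 'a set set \<Rightarrow> 'a premap" where
  "delete_edges M E = (let D = \<Union>E; C = crosses M - D in
     \<lparr> crosses = C,
       alpha0 = (\<lambda>c. if c \<in> C then alpha0 M c else c),
       alpha1 = (\<lambda>c. if c \<in> C then skip (vperm M) D (alpha2 M c) else c),
       alpha2 = (\<lambda>c. if c \<in> C then alpha2 M c else c),
       isolated = isolated M + card {v \<in> vertex_of M ` crosses M. v \<subseteq> D} \<rparr>)"

definition remove_isolated :: "'a premap \<Rightarrow> 'a premap" where
  "remove_isolated M = M\<lparr>isolated := isolated M - 1\<rparr>"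

text \<open>
  After the incident edges of a vertex carrying crosses are deleted, that vertex is one of
  the isolated ones.
\<close>

inductive delete_vertex :: "'a premap \<Rightarrow> 'a premap \<Rightarrow> bool" where
  isolated_vertex: "0 < isolated M \<Longrightarrow> delete_vertex M (remove_isolated M)"
| cross_vertex: "v \<in> vertex_of M ` crosses M \<Longrightarrow>
    delete_vertex M (remove_isolated (delete_edges M {e \<in> edges M. e \<inter> v \<noteq> {}}))"

definition submap :: "'a premap \<Rightarrow> 'a premap \<Rightarrow> bool" where
  "submap S M \<longleftrightarrow> (\<exists>E \<subseteq> edges M. delete_vertex\<^sup>*\<^sup>* (delete_edges M E) S)"

definition proper_submap :: "'a premap \<Rightarrow> 'a premap \<Rightarrow> bool" where
  "proper_submap S M \<longleftrightarrow> submap S M \<and> S \<noteq> M"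

definition swap_at :: "'a premap \<Rightarrow> 'a \<Rightarrow> 'a \<Rightarrow> 'a premap" where
  "swap_at M a b = M\<lparr>alpha1 := transpose a b \<circ> alpha1 M \<circ> transpose a b\<rparr>"

inductive vertex_gluing :: "'a premap \<Rightarrow> 'a premap \<Rightarrow> bool" where
  glue_crosses: "\<lbrakk>a \<in> crosses M; b \<in> crosses M; a \<noteq> b; vertex_of M a \<noteq> vertex_of M b;
    b \<in> orbit (fperm M) a \<or> component_of M a \<noteq> component_of M b\<rbrakk> \<Longrightarrow>
    vertex_gluing M (swap_at M a b)"
| glue_isolated: "\<lbrakk>0 < isolated M; 2 \<le> card (vertices M)\<rbrakk> \<Longrightarrow>
    vertex_gluing M (remove_isolated M)"

text \<open>The degree of the face containing the cross \<open>c\<close>.\<close>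

definition face_degree :: "'a premap \<Rightarrow> 'a \<Rightarrow> nat" where
  "face_degree M c = card (orbit (fperm M) c)"

definition duplicate_edges :: "'a premap \<Rightarrow> 'a set \<Rightarrow> 'a set \<Rightarrow> bool" where
  "duplicate_edges M e f \<longleftrightarrow> e \<in> edges M \<and> f \<in> edges M \<and> e \<noteq> f \<and>
     (\<exists>c\<in>crosses M. face_degree M c = 2 \<and>
        e \<inter> face_of M c \<noteq> {} \<and> f \<inter> face_of M c \<noteq> {})"

inductive duplicate_gluing :: "'a premap \<Rightarrow> 'a premap \<Rightarrow> bool" where
  "duplicate_edges M e f \<Longrightarrow> duplicate_gluing M (delete_edges M {f})"

definition gluing :: "'a premap \<Rightarrow> 'a premap \<Rightarrow> bool" where
  "gluing M M' \<longleftrightarrow> vertex_gluing M M' \<or> duplicate_gluing M M'"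

definition hom_exists :: "'a premap \<Rightarrow> 'b premap \<Rightarrow> bool" where
  "hom_exists M M' \<longleftrightarrow> signed_genus M = signed_genus M' \<and>
     (\<exists>L S. gluing\<^sup>*\<^sup>* M L \<and> submap S M' \<and> map_iso L S)"

definition is_core :: "'a premap \<Rightarrow> bool" where
  "is_core M \<longleftrightarrow> is_map M \<and> \<not> (\<exists>S. proper_submap S M \<and> hom_exists M S)"

definition hom_less :: "'a premap \<Rightarrow> 'b premap \<Rightarrow> bool" where
  "hom_less A B \<longleftrightarrow> hom_exists A B \<and> \<not> hom_exists B A"

text \<open>
  A graph is given by its vertices, its edges and the incidence relation; being a cycle of
  length \<open>n\<close> is expressed correctly by the following for \<open>n \<ge> 3\<close>.
\<close>

definition cycle_graph :: "nat \<Rightarrow> 'v set \<Rightarrow> 'e set \<Rightarrow> ('v \<Rightarrow> 'e \<Rightarrow> bool) \<Rightarrow> bool" where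
  "cycle_graph n V E inc \<longleftrightarrow> (\<exists>v e. bij_betw v {..<n} V \<and> bij_betw e {..<n} E \<and>
     (\<forall>j<n. {x \<in> V. inc x (e j)} = {v j, v (Suc j mod n)}))"

definition incident :: "'a set + nat \<Rightarrow> 'a set \<Rightarrow> bool" where
  "incident x e \<longleftrightarrow> (\<exists>v. x = Inl v \<and> v \<inter> e \<noteq> {})"

definition plane_cycle :: "nat \<Rightarrow> 'a premap \<Rightarrow> bool" where
  "plane_cycle n M \<longleftrightarrow> is_map M \<and> plane M \<and> cycle_graph n (vertices M) (edges M) incident"

text \<open>
  A representative, showing that plane cycles exist: \<open>(j, s, t)\<close> is the cross of the edge
  from vertex \<open>j\<close> to vertex \<open>j + 1\<close> (modulo \<open>n\<close>), at the end \<open>j + 1\<close> iff \<open>s\<close>, on side \<open>t\<close>.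
\<close>

definition std_cycle :: "nat \<Rightarrow> (nat \<times> bool \<times> bool) premap" where
  "std_cycle n = \<lparr> crosses = {..<n} \<times> UNIV,
     alpha0 = (\<lambda>(j, s, t). if j < n then (j, \<not> s, t) else (j, s, t)),
     alpha1 = (\<lambda>(j, s, t). if j < n
                 then (if s then (Suc j mod n, False, t) else ((j + n - 1) mod n, True, t))
                 else (j, s, t)),
     alpha2 = (\<lambda>(j, s, t). if j < n then (j, s, \<not> t) else (j, s, t)),
     isolated = 0 \<rparr>"

lemma gorbit_eq_fibre:
  assumes "x \<in> C" and "\<And>f u. f \<in> F \<Longrightarrow> f u \<in> C \<longleftrightarrow> u \<in> C"
    and "\<And>f u. f \<in> F \<Longrightarrow> u \<in> C \<Longrightarrow> p (f u) = p u"
    and "\<And>u v. u \<in> C \<Longrightarrow> v \<in> C \<Longrightarrow> p u = p v \<Longrightarrow> equivclp (\<lambda>u v. \<exists>f\<in>F. v = f u) u v"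
  shows "gorbit F x = {y \<in> C. p y = p x}"
proof -
  have "y \<in> C \<and> p y = p x" if "equivclp (\<lambda>u v. \<exists>f\<in>F. v = f u) x y" for y
    using that
  proof (induction rule: equivclp_induct)
    case base
    then show ?case using assms(1) by simp
  next
    case (step y z)
    from step.hyps(2) obtain f where f: "f \<in> F" "z = f y \<or> y = f z" by blast
    show ?case using f(2)
    proof
      assume "z = f y"
      then show ?case using step.IH assms(2)[OF f(1), of y] assms(3)[OF f(1), of y] by simp
    next
      assume "y = f z"
      then show ?case using step.IH assms(2)[OF f(1), of z] assms(3)[OF f(1), of z] by simp
    qed
  qed
  moreover have "equivclp (\<lambda>u v. \<exists>f\<in>F. v = f u) x y" if "y \<in> C" "p y = p x" for y
    using assms(4)[OF assms(1) that(1)] that(2) by simp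
  ultimately show ?thesis unfolding gorbit_def by blast
qed

lemma equivclp_gen: "f \<in> F \<Longrightarrow> equivclp (\<lambda>u v. \<exists>f\<in>F. v = f u) u (f u)"
  by (rule r_into_equivclp) blast

lemma pred_mod: "j < n \<Longrightarrow> Suc ((j + n - 1) mod n) mod n = j" for n :: nat
  by (cases j) (auto simp: mod_Suc)

lemma Suc_pred_mod: "j < n \<Longrightarrow> (Suc j mod n + n - 1) mod n = j" for n :: nat
  by (cases "Suc j = n") auto

lemma fpf_involution_onI:
  assumes "\<And>x. f (f x) = x" and "\<And>x. x \<notin> C \<Longrightarrow> f x = x" and "\<And>x. x \<in> C \<Longrightarrow> f x \<noteq> x"
  shows "fpf_involution_on C f"
  unfolding fpf_involution_on_def permutes_def using assms by metis

lemma std_cycle_is_map: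
  assumes "n \<ge> 3"
  shows "is_map (std_cycle n)"
proof -
  have "alpha1 (std_cycle n) (alpha1 (std_cycle n) x) = x" for x
    using assms pred_mod[of "fst x" n] Suc_pred_mod[of "fst x" n]
    by (cases x) (auto simp: std_cycle_def)
  then have "fpf_involution_on (crosses (std_cycle n)) (alpha1 (std_cycle n))"
    by (rule fpf_involution_onI) (auto simp: std_cycle_def split: if_splits)
  moreover have "fpf_involution_on (crosses (std_cycle n)) (alpha0 (std_cycle n))"
    by (rule fpf_involution_onI) (auto simp: std_cycle_def split: if_splits)
  moreover have "fpf_involution_on (crosses (std_cycle n)) (alpha2 (std_cycle n))"
    by (rule fpf_involution_onI) (auto simp: std_cycle_def split: if_splits)
  ultimately show ?thesis
    by (auto simp: is_map_def std_cycle_def fun_eq_iff)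
qed

lemma std_cycle_mem:
  assumes "n \<ge> 3" and "f \<in> {alpha0 (std_cycle n), alpha1 (std_cycle n), alpha2 (std_cycle n)}"
  shows "f u \<in> crosses (std_cycle n) \<longleftrightarrow> u \<in> crosses (std_cycle n)"
proof -
  have "f permutes crosses (std_cycle n)"
    using std_cycle_is_map[OF assms(1)] assms(2) by (auto simp: is_map_def fpf_involution_on_def)
  then show ?thesis by (rule permutes_in_image)
qed

lemma equivclp_fibreI:
  assumes "\<And>u. u \<in> C \<Longrightarrow> equivclp R u (r (p u))" "u \<in> C" "v \<in> C" "p u = p v"
  shows "equivclp R u v"
  using equivclp_trans[OF assms(1)[OF assms(2)], of v] equivclp_sym[OF assms(1)[OF assms(3)]] assms(4)
  by simp

lemma equivclp_step:
  assumes "equivclp (\<lambda>u v. \<exists>f\<in>F. v = f u) (g u) v" "g \<in> F"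
  shows "equivclp (\<lambda>u v. \<exists>f\<in>F. v = f u) u v"
  using equivclp_gen[OF assms(2)] assms(1) by (rule equivclp_trans)

lemma std_cycle_vertex_of:
  assumes "n \<ge> 3" "x \<in> crosses (std_cycle n)"
  defines "p \<equiv> \<lambda>(j, s, t :: bool). if s then Suc j mod n else j"
  shows "vertex_of (std_cycle n) x = {y \<in> crosses (std_cycle n). p y = p x}"
proof -
  define F where "F = {alpha1 (std_cycle n), alpha2 (std_cycle n)}"
  let ?R = "\<lambda>u v. \<exists>f\<in>F. v = f u"
  have mem: "alpha1 (std_cycle n) \<in> F" "alpha2 (std_cycle n) \<in> F" by (auto simp: F_def)
  have 1: "equivclp ?R (j, False, t) (j, False, False)" if "j < n" for j t
    using equivclp_step[of F "alpha2 (std_cycle n)" "(j, False, t)" "(j, False, False)", OF _ mem(2)] that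
    by (cases t) (auto simp: std_cycle_def)
  have 2: "equivclp ?R u (p u, False, False)" if "u \<in> crosses (std_cycle n)" for u
  proof -
    obtain j s t where u: "u = (j, s, t)" by (cases u)
    show ?thesis
      using equivclp_step[of F "alpha1 (std_cycle n)" u "(Suc j mod n, False, False)", OF _ mem(1)]
        1[of j t] 1[of "Suc j mod n" t] that assms(1) u
      by (cases s) (auto simp: std_cycle_def p_def)
  qed
  have "gorbit F x = {y \<in> crosses (std_cycle n). p y = p x}"
  proof (rule gorbit_eq_fibre)
    show "f u \<in> crosses (std_cycle n) \<longleftrightarrow> u \<in> crosses (std_cycle n)" if "f \<in> F" for f u
      using that by (intro std_cycle_mem[OF assms(1)]) (auto simp: F_def)
    show "p (f u) = p u" if "f \<in> F" "u \<in> crosses (std_cycle n)" for f u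
      using that pred_mod[of "fst u" n]
      by (cases u) (auto simp: F_def std_cycle_def p_def)
    show "equivclp ?R u v"
      if "u \<in> crosses (std_cycle n)" "v \<in> crosses (std_cycle n)" "p u = p v" for u v
      using equivclp_fibreI[of "crosses (std_cycle n)" ?R "\<lambda>j. (j, False, False)" p] 2 that by blast
  qed (fact assms(2))
  then show ?thesis by (simp add: vertex_of_def F_def)
qed

lemma std_cycle_edge_of:
  assumes "n \<ge> 3" "x \<in> crosses (std_cycle n)"
  shows "edge_of (std_cycle n) x = {y \<in> crosses (std_cycle n). fst y = fst x}"
proof -
  define F where "F = {alpha0 (std_cycle n), alpha2 (std_cycle n)}"
  let ?R = "\<lambda>u v. \<exists>f\<in>F. v = f u"
  have mem: "alpha0 (std_cycle n) \<in> F" "alpha2 (std_cycle n) \<in> F" by (auto simp: F_def)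
  have 1: "equivclp ?R (j, False, t) (j, False, False)" if "j < n" for j t
    using equivclp_step[of F "alpha2 (std_cycle n)" "(j, False, t)" "(j, False, False)", OF _ mem(2)] that
    by (cases t) (auto simp: std_cycle_def)
  have 2: "equivclp ?R u (fst u, False, False)" if "u \<in> crosses (std_cycle n)" for u
  proof -
    obtain j s t where u: "u = (j, s, t)" by (cases u)
    show ?thesis
      using equivclp_step[of F "alpha0 (std_cycle n)" u "(j, False, False)", OF _ mem(1)]
        1[of j t] that assms(1) u
      by (cases s) (auto simp: std_cycle_def)
  qed
  have "gorbit F x = {y \<in> crosses (std_cycle n). fst y = fst x}"
  proof (rule gorbit_eq_fibre)
    show "f u \<in> crosses (std_cycle n) \<longleftrightarrow> u \<in> crosses (std_cycle n)" if "f \<in> F" for f u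
      using that by (intro std_cycle_mem[OF assms(1)]) (auto simp: F_def)
    show "fst (f u) = fst u" if "f \<in> F" "u \<in> crosses (std_cycle n)" for f u
      using that by (cases u) (auto simp: F_def std_cycle_def)
    show "equivclp ?R u v"
      if "u \<in> crosses (std_cycle n)" "v \<in> crosses (std_cycle n)" "fst u = fst v" for u v
      using equivclp_fibreI[of "crosses (std_cycle n)" ?R "\<lambda>j. (j, False, False)" fst] 2 that by blast
  qed (fact assms(2))
  then show ?thesis by (simp add: edge_of_def F_def)
qed

lemma std_cycle_walk:
  assumes "n \<ge> 3" "alpha0 (std_cycle n) \<in> F" "alpha1 (std_cycle n) \<in> F" "j < n"
  shows "equivclp (\<lambda>u v. \<exists>f\<in>F. v = f u) (j, s, t) (0, False, t)"
proof -
  let ?R = "\<lambda>u v. \<exists>f\<in>F. v = f u"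
  have 1: "equivclp ?R (j, False, t) (0, False, t)" if "j < n" for j
    using that
  proof (induction j)
    case 0
    then show ?case by simp
  next
    case (Suc j)
    have "equivclp ?R (j, True, t) (0, False, t)"
      using equivclp_step[of F "alpha0 (std_cycle n)" "(j, True, t)" "(0, False, t)", OF _ assms(2)] Suc
      by (auto simp: std_cycle_def)
    then show ?case
      using equivclp_step[of F "alpha1 (std_cycle n)" "(Suc j, False, t)" "(0, False, t)", OF _ assms(3)]
        Suc.prems
      by (auto simp: std_cycle_def)
  qed
  show ?thesis
    using equivclp_step[of F "alpha0 (std_cycle n)" "(j, s, t)" "(0, False, t)", OF _ assms(2)]
      1[OF assms(4)] assms(4)
    by (cases s) (auto simp: std_cycle_def)
qed

lemma std_cycle_face_of:
  assumes "n \<ge> 3" "x \<in> crosses (std_cycle n)"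
  shows "face_of (std_cycle n) x = {y \<in> crosses (std_cycle n). snd (snd y) = snd (snd x)}"
proof -
  define F where "F = {alpha0 (std_cycle n), alpha1 (std_cycle n)}"
  let ?R = "\<lambda>u v. \<exists>f\<in>F. v = f u"
  have 2: "equivclp ?R u (0, False, snd (snd u))" if "u \<in> crosses (std_cycle n)" for u
    using std_cycle_walk[OF assms(1), of F "fst u" "fst (snd u)" "snd (snd u)"] that
    by (cases u) (auto simp: F_def std_cycle_def)
  have "gorbit F x = {y \<in> crosses (std_cycle n). snd (snd y) = snd (snd x)}"
  proof (rule gorbit_eq_fibre)
    show "f u \<in> crosses (std_cycle n) \<longleftrightarrow> u \<in> crosses (std_cycle n)" if "f \<in> F" for f u
      using that by (intro std_cycle_mem[OF assms(1)]) (auto simp: F_def)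
    show "snd (snd (f u)) = snd (snd u)" if "f \<in> F" "u \<in> crosses (std_cycle n)" for f u
      using that by (cases u) (auto simp: F_def std_cycle_def split: if_splits)
    show "equivclp ?R u v"
      if "u \<in> crosses (std_cycle n)" "v \<in> crosses (std_cycle n)" "snd (snd u) = snd (snd v)" for u v
      using equivclp_trans[OF 2[OF that(1)], of v] equivclp_sym[OF 2[OF that(2)]] that(3) by simp
  qed (fact assms(2))
  then show ?thesis by (simp add: face_of_def F_def)
qed

lemma std_cycle_component_of:
  assumes "n \<ge> 3" "x \<in> crosses (std_cycle n)"
  shows "component_of (std_cycle n) x = crosses (std_cycle n)"
proof -
  define F where "F = {alpha0 (std_cycle n), alpha1 (std_cycle n), alpha2 (std_cycle n)}"
  let ?R = "\<lambda>u v. \<exists>f\<in>F. v = f u"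
  have 1: "equivclp ?R (0, False, t) (0, False, False)" for t
    using equivclp_step[of F "alpha2 (std_cycle n)" "(0, False, t)" "(0, False, False)"] assms(1)
    by (cases t) (auto simp: std_cycle_def F_def)
  have 2: "equivclp ?R u (0, False, False)" if "u \<in> crosses (std_cycle n)" for u
  proof -
    have "equivclp ?R u (0, False, snd (snd u))"
      using std_cycle_walk[OF assms(1), of F "fst u" "fst (snd u)" "snd (snd u)"] that
      by (cases u) (auto simp: F_def std_cycle_def)
    then show ?thesis using 1 by (rule equivclp_trans)
  qed
  have "gorbit F x = {y \<in> crosses (std_cycle n). () = ()}"
  proof (rule gorbit_eq_fibre)
    show "f u \<in> crosses (std_cycle n) \<longleftrightarrow> u \<in> crosses (std_cycle n)" if "f \<in> F" for f u
      using that by (intro std_cycle_mem[OF assms(1)]) (auto simp: F_def)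
    show "equivclp ?R u v"
      if "u \<in> crosses (std_cycle n)" "v \<in> crosses (std_cycle n)" for u v
      using 2[OF that(1)] equivclp_sym[OF 2[OF that(2)]] by (rule equivclp_trans)
  qed (use assms(2) in simp_all)
  then show ?thesis by (simp add: component_of_def F_def)
qed

lemma plane_cycle_std_cycle:
  assumes "n \<ge> 3"
  shows "plane_cycle n (std_cycle n)"
proof -
  let ?M = "std_cycle n"
  define p where "p = (\<lambda>(j, s, t :: bool). if s then Suc j mod n else j)"
  define V where "V j = {y \<in> crosses ?M. p y = j}" for j
  define E where "E j = {y \<in> crosses ?M. fst y = j}" for j
  define G where "G t = {y \<in> crosses ?M. snd (snd y) = t}" for t
  have C: "crosses ?M = {..<n} \<times> UNIV" and iso0: "isolated ?M = 0"
    by (auto simp: std_cycle_def)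
  have in_V: "(j, False, False) \<in> V j" and in_E: "(j, False, False) \<in> E j" if "j < n" for j
    using that by (auto simp: V_def E_def C p_def)
  have in_G: "(0, False, t) \<in> G t" for t
    using assms by (auto simp: G_def C)
  have injV: "inj_on V {..<n}"
    using in_V by (fastforce intro!: inj_onI simp: V_def)
  have injE: "inj_on E {..<n}"
    using in_E by (fastforce intro!: inj_onI simp: E_def)
  have injG: "inj G"
    using in_G by (fastforce intro!: injI simp: G_def)
  have pC: "p ` crosses ?M = {..<n}"
  proof
    show "p ` crosses ?M \<subseteq> {..<n}" using assms by (auto simp: C p_def)
    show "{..<n} \<subseteq> p ` crosses ?M"
    proof
      fix j assume "j \<in> {..<n}"
      then show "j \<in> p ` crosses ?M"
        by (intro image_eqI[of _ _ "(j, False, False)"]) (auto simp: C p_def)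
    qed
  qed
  have fC: "fst ` crosses ?M = {..<n}" by (force simp: C)
  have "t \<in> (\<lambda>y. snd (snd y)) ` crosses ?M" for t
    using assms by (intro image_eqI[of _ _ "(0, False, t)"]) (auto simp: C)
  then have sC: "(\<lambda>y. snd (snd y)) ` crosses ?M = UNIV" by blast
  have "vertex_of ?M ` crosses ?M = (\<lambda>x. V (p x)) ` crosses ?M"
    using std_cycle_vertex_of[OF assms] by (intro image_cong) (auto simp: V_def p_def)
  also have "\<dots> = V ` p ` crosses ?M" by (simp only: image_image)
  finally have v: "vertex_of ?M ` crosses ?M = V ` {..<n}" by (simp only: pC)
  have "edge_of ?M ` crosses ?M = (\<lambda>x. E (fst x)) ` crosses ?M"
    using std_cycle_edge_of[OF assms] by (intro image_cong) (auto simp: E_def)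
  also have "\<dots> = E ` fst ` crosses ?M" by (simp only: image_image)
  finally have e: "edges ?M = E ` {..<n}" by (simp only: edges_def fC)
  have "face_of ?M ` crosses ?M = (\<lambda>x. G (snd (snd x))) ` crosses ?M"
    using std_cycle_face_of[OF assms] by (intro image_cong) (auto simp: G_def)
  also have "\<dots> = G ` (\<lambda>x. snd (snd x)) ` crosses ?M" by (simp only: image_image)
  finally have f: "face_of ?M ` crosses ?M = range G" by (simp only: sC)
  have "crosses ?M \<noteq> {}" using assms by (auto simp: C lessThan_empty_iff)
  then have k: "component_of ?M ` crosses ?M = {crosses ?M}"
    by (simp add: std_cycle_component_of[OF assms] image_constant_conv cong: image_cong)
  have verts: "vertices ?M = Inl ` V ` {..<n}"
    by (simp add: vertices_def v iso0 Plus_def)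
  have "card (vertices ?M) = n" "card (edges ?M) = n"
    using injV injE by (simp_all add: verts e card_image)
  moreover have "card (faces ?M) = 2"
    using card_image[OF injG] by (simp add: faces_def f iso0 Plus_def card_image)
  moreover have "card (map_components ?M) = 1"
    unfolding map_components_def k iso0 by (simp add: Plus_def)
  ultimately have "plane ?M" by (simp add: plane_def euler_genus_def euler_char_def)
  moreover have "cycle_graph n (vertices ?M) (edges ?M) incident"
    unfolding cycle_graph_def
  proof (intro exI[of _ "\<lambda>j. Inl (V j)"] exI[of _ E] conjI allI impI)
    show "bij_betw (\<lambda>j. Inl (V j)) {..<n} (vertices ?M)"
      using injV by (auto simp: bij_betw_def verts inj_on_def)
    show "bij_betw E {..<n} (edges ?M)" using injE by (simp add: bij_betw_def e)
    fix j assume j: "j < n"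
    have in1: "(j, False, False) \<in> V j \<inter> E j" and in2: "(j, True, False) \<in> V (Suc j mod n) \<inter> E j"
      using j by (simp_all add: V_def E_def C p_def)
    have "i = j \<or> i = Suc j mod n" if "V i \<inter> E j \<noteq> {}" for i
      using that by (auto simp: V_def E_def p_def split: if_splits)
    then have "V i \<inter> E j \<noteq> {} \<longleftrightarrow> i = j \<or> i = Suc j mod n" for i
      using in1 in2 by blast
    then have "{x \<in> vertices ?M. incident x (E j)} = (\<lambda>i. Inl (V i)) ` {i. i < n \<and> (i = j \<or> i = Suc j mod n)}"
      unfolding verts incident_def by blast
    also have "{i. i < n \<and> (i = j \<or> i = Suc j mod n)} = {j, Suc j mod n}"
      using j by auto
    finally show "{x \<in> vertices ?M. incident x (E j)} = {Inl (V j), Inl (V (Suc j mod n))}"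
      by simp
  qed
  ultimately show ?thesis using std_cycle_is_map[OF assms] by (simp add: plane_cycle_def)
qed

end

theory Submission
  imports Defs "HOL-Library.Transitive_Closure_Table"
begin

text \<open>
  Let \<open>n = 2k + 1\<close>. If a plane map \<open>N\<close> has a homomorphism to the cycle of length \<open>n\<close>, then
  pulling back the cyclic direction of this cycle along the gluings directs every dart of \<open>N\<close> by
  \<open>t = 1\<close> or \<open>t = -1\<close>, such that in each component the sum of \<open>t\<close> around a face is zero for all faces
  except possibly one with sum \<open>n\<close> and one with sum \<open>-n\<close>. Read in the dual map, \<open>t\<close> is a flow of
  value \<open>n\<close> between these two faces. If it can be augmented in all components, there is such a \<open>t\<close>
  with \<open>n + 2\<close> in place of \<open>n\<close>. Otherwise there is a dual cut of \<open>n\<close> edges; since walking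
  along its edges always winds around in the same direction, they form a cycle of length \<open>n\<close>,
  which gives a homomorphism from the cycle of length \<open>n\<close> to \<open>N\<close>.

  Conversely, a plane map with such a \<open>t\<close> for \<open>m\<close> folds onto the cycle of length \<open>m\<close> or onto an edge
  or vertex: while two consecutive darts of a face have opposite directions, their outer ends can be
  glued, followed by a duplicate edge gluing; when no such darts are left, the map is a cycle.
  Hence \<open>N\<close> maps to the cycle of length \<open>n + 2\<close>, or is mapped to from the cycle of length \<open>n\<close>.
\<close>

section \<open>Orbits of permutations\<close>

text \<open>The increment 2 is the effect of one augmenting dual path: crossing an edge turns a
  value -1 of \<open>t\<close> into 1, so the flow out of the source grows by two. If no such path
  exists, every dart leaving the reachable faces has \<open>t = 1\<close>, so the cut has exactly as
  many edges as the flow has units. That these \<open>n\<close> edges form one cycle and not several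
  needs the vertex labels modulo \<open>n\<close> that are pulled back together with
  \<open>t\<close>: they grow by one along each cut edge, so every closed walk in the cut has length
  divisible by \<open>n\<close>. The condition that a component has at most one face winding in each
  direction gives the flow a single source and a single sink, and it leaves a connected unfoldable
  map with only two faces. The main obstacle is that gluings are given on crosses, while planarity
  is given by counting orbits. Hence the work takes place on one orientation class of crosses, where
  a vertex gluing is a composition of the vertex permutation with a transposition, and planarity is
  used as a cohomological condition that survives gluings and yields a discrete Jordan curve
  theorem.\<close>

lemma orbit_eq_of_mem:
  assumes "permutation f" "y \<in> orbit f x"
  shows "orbit f y = orbit f x"
  using orbit_cyclic_eq3[OF cyclic_on_orbit'[OF assms(1)] assms(2)] .

lemma orbit_mem_sym: "permutation f \<Longrightarrow> y \<in> orbit f x \<Longrightarrow> x \<in> orbit f y"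
  by (metis orbit_eq_of_mem permutation_self_in_orbit)

lemma orbit_disjoint:
  assumes "permutation f" "y \<notin> orbit f x"
  shows "orbit f x \<inter> orbit f y = {}"
proof -
  have False if "z \<in> orbit f x" "z \<in> orbit f y" for z
    using that assms orbit_eq_of_mem[OF assms(1)] permutation_self_in_orbit[OF assms(1)] by metis
  then show ?thesis by blast
qed

lemma orbit_closed:
  assumes "\<And>x. f x \<in> S \<longleftrightarrow> x \<in> S" "x \<in> S"
  shows "orbit f x \<subseteq> S"
proof
  fix y assume "y \<in> orbit f x"
  then show "y \<in> S" by induct (use assms in auto)
qed

lemma permutation_inj: "permutation f \<Longrightarrow> f x = f y \<longleftrightarrow> x = y"
  by (metis permutation_bijective bij_def inj_eq)

lemma orbit_image_iff: "permutation f \<Longrightarrow> f y \<in> orbit f x \<longleftrightarrow> y \<in> orbit f x"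
  by (metis orbit.step orbit_mem_sym orbit_trans permutation_orbit_step)

lemma finite_orbit_permutation: "permutation f \<Longrightarrow> finite (orbit f x)"
  by (simp add: finite_orbit permutation_self_in_orbit)

lemma permutation_transpose_comp: "permutation f \<Longrightarrow> permutation (transpose a b \<circ> f)"
  by (simp add: permutation_compose permutation_swap_id)

lemma orbit_transpose_other:
  assumes "permutation f" "a \<notin> orbit f x" "b \<notin> orbit f x"
  shows "orbit (transpose a b \<circ> f) x = orbit f x"
proof (rule orbit_cong)
  show "x \<in> orbit f x" by (rule permutation_self_in_orbit[OF assms(1)])
  fix s assume "s \<in> orbit f x"
  then have "f s \<in> orbit f x" by (rule orbit.step)
  then show "(transpose a b \<circ> f) s = f s" using assms by (auto simp: transpose_def)
qed

text \<open>The last point before \<open>a\<close> on its cycle is sent to \<open>b\<close> instead.\<close>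

lemma transpose_joins:
  assumes f: "permutation f" and b: "b \<notin> orbit f a"
  shows "b \<in> orbit (transpose a b \<circ> f) a"
proof (rule ccontr)
  let ?g = "transpose a b \<circ> f"
  have g: "permutation ?g" using f by (rule permutation_transpose_comp)
  assume nb: "b \<notin> orbit ?g a"
  have "y \<in> orbit ?g a" if "y \<in> orbit f a" for y using that
  proof induct
    case base
    have "f a \<noteq> b" using b orbit.base by metis
    then show ?case
      by (metis comp_apply transpose_apply_other orbit.base permutation_self_in_orbit[OF g])
  next
    case (step y)
    have "f y \<noteq> b" using b step(1) orbit.step by metis
    then show ?case
      by (metis comp_apply transpose_apply_other orbit.step[OF step(2)] permutation_self_in_orbit[OF g])
  qed
  moreover obtain z where z: "z \<in> orbit f a" "f z = a"
    by (metis (no_types, opaque_lifting) f orbit_image_iff permutation_self_in_orbit bij_pointE permutation_bijective)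
  ultimately have "?g z \<in> orbit ?g a" using orbit.step by metis
  then show False using nb z by simp
qed

text \<open>Makes splitting and joining of cycles inverse to each other, so that each statement
  about one yields the statement about the other.\<close>

lemma transpose_comp_twice: "transpose a b \<circ> (transpose a b \<circ> f) = f"
  by (simp add: fun_eq_iff)

text \<open>Let \<open>k\<close> be the first time at which the cycle of \<open>a\<close> reaches
  \<open>b\<close>. Up to then the transposed permutation follows \<open>f\<close>, and in step
  \<open>k\<close> it goes back to \<open>a\<close> instead of \<open>b\<close>; its cycle through
  \<open>a\<close> is thus the initial stretch, which avoids \<open>b\<close>.\<close>

lemma transpose_separates:
  assumes f: "permutation f" and b: "b \<in> orbit f a" and ab: "a \<noteq> b"
  shows "b \<notin> orbit (transpose a b \<circ> f) a"
proof -
  let ?g = "transpose a b \<circ> f"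
  define k where "k = (LEAST k. 0 < k \<and> (f ^^ k) a = b)"
  have ex: "\<exists>k. 0 < k \<and> (f ^^ k) a = b" using b by (auto simp: orbit_altdef)
  have k: "0 < k" "(f ^^ k) a = b" using LeastI_ex[OF ex] by (auto simp: k_def)
  have kmin: "(f ^^ i) a \<noteq> b" if "0 < i" "i < k" for i
    using not_less_Least[of i "\<lambda>k. 0 < k \<and> (f ^^ k) a = b"] that by (auto simp: k_def)
  \<comment> \<open>A return to \<open>a\<close> before time \<open>k\<close> would make
    \<open>b\<close> be reached earlier.\<close>
  have ka: "(f ^^ i) a \<noteq> a" if "0 < i" "i < k" for i
  proof
    assume *: "(f ^^ i) a = a"
    have "b = (f ^^ (k - i)) ((f ^^ i) a)"
      using k that funpow_add[of "k - i" i f] by simp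
    then have "(f ^^ (k - i)) a = b" using * by simp
    then show False using kmin[of "k - i"] that by simp
  qed
  have gi: "(?g ^^ i) a = (f ^^ i) a" if "i < k" for i using that
  proof (induct i)
    case (Suc i)
    then show ?case using kmin[of "Suc i"] ka[of "Suc i"] by (simp add: transpose_def)
  qed simp
  have "(?g ^^ k) a = ?g ((?g ^^ (k - 1)) a)" using k(1) by (cases k) auto
  also have "\<dots> = transpose a b ((f ^^ k) a)" using gi[of "k - 1"] k(1) by (cases k) auto
  finally have "(?g ^^ k) a = a" using k by simp
  then have orb: "orbit ?g a = {(?g ^^ m) a | m. m < k}" using k(1) by (rule orbit_altdef_bounded)
  have ne: "(?g ^^ m) a \<noteq> b" if "m < k" for m
    using gi[OF that] kmin[of m] ab that by (cases m) auto
  show ?thesis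
  proof
    assume "b \<in> orbit ?g a"
    then obtain m where "b = (?g ^^ m) a" "m < k" unfolding orb by blast
    then show False using ne[of m] by metis
  qed
qed

lemma orbit_transpose_split:
  assumes f: "permutation f" and b: "b \<in> orbit f a" and ab: "a \<noteq> b"
  defines "g \<equiv> transpose a b \<circ> f"
  shows "orbit f a = orbit g a \<union> orbit g b" and "orbit g a \<inter> orbit g b = {}"
    and "\<And>x. x \<notin> orbit f a \<Longrightarrow> orbit g x = orbit f x"
proof -
  have g: "permutation g" unfolding g_def using f by (rule permutation_transpose_comp)
  have f_g: "f = transpose a b \<circ> g" by (simp add: g_def transpose_comp_twice)
  have nb: "b \<notin> orbit g a" unfolding g_def by (rule transpose_separates[OF f b ab])
  show "orbit g a \<inter> orbit g b = {}" by (rule orbit_disjoint[OF g nb])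
  show "orbit g x = orbit f x" if "x \<notin> orbit f a" for x
    unfolding g_def
  proof (rule orbit_transpose_other[OF f])
    show "a \<notin> orbit f x" using that orbit_mem_sym[OF f] by blast
    then show "b \<notin> orbit f x" using b orbit_mem_sym[OF f] orbit_trans by metis
  qed
  show "orbit f a = orbit g a \<union> orbit g b"
  proof
    show "orbit f a \<subseteq> orbit g a \<union> orbit g b"
    proof
      fix y assume "y \<in> orbit f a"
      then have *: "a \<in> orbit f y" by (rule orbit_mem_sym[OF f])
      show "y \<in> orbit g a \<union> orbit g b"
      proof (rule ccontr)
        assume "\<not> ?thesis"
        then have n: "a \<notin> orbit g y" "b \<notin> orbit g y" using orbit_mem_sym[OF g] by blast+
        \<comment> \<open>A cycle of \<open>g\<close> through neither point is also a cycle of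
          \<open>f\<close>, as \<open>f\<close> arises from \<open>g\<close> by the same
          transposition.\<close>
        then have "orbit f y = orbit g y" using orbit_transpose_other[OF g n] f_g by simp
        then show False using * n by simp
      qed
    qed
    have in_f: "g y \<in> orbit f a" if "y \<in> orbit f a" for y
      using orbit.step[OF that] b permutation_self_in_orbit[OF f, of a]
      by (cases "f y = a"; cases "f y = b") (simp_all add: g_def)
    have "y \<in> orbit f a" if "y \<in> orbit g x" "x \<in> orbit f a" for x y using that
      by induct (simp_all add: in_f)
    then show "orbit g a \<union> orbit g b \<subseteq> orbit f a"
      using b permutation_self_in_orbit[OF f] by blast
  qed
qed

lemma orbit_transpose_join:
  assumes f: "permutation f" and b: "b \<notin> orbit f a"
  defines "g \<equiv> transpose a b \<circ> f"
  shows "orbit g a = orbit f a \<union> orbit f b" and "orbit g b = orbit f a \<union> orbit f b"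
    and "orbit f a \<inter> orbit f b = {}"
    and "\<And>x. x \<notin> orbit f a \<Longrightarrow> x \<notin> orbit f b \<Longrightarrow> orbit g x = orbit f x"
proof -
  have g: "permutation g" unfolding g_def using f by (rule permutation_transpose_comp)
  have f_g: "f = transpose a b \<circ> g" by (simp add: g_def transpose_comp_twice)
  have bg: "b \<in> orbit g a" unfolding g_def by (rule transpose_joins[OF f b])
  have ab: "a \<noteq> b" using b permutation_self_in_orbit[OF f] by blast
  note * = orbit_transpose_split[OF g bg ab, folded f_g]
  show "orbit g a = orbit f a \<union> orbit f b" by (rule *(1))
  then show "orbit g b = orbit f a \<union> orbit f b" using orbit_eq_of_mem[OF g bg] by simp
  show "orbit f a \<inter> orbit f b = {}" by (rule *(2))
  show "orbit g x = orbit f x" if "x \<notin> orbit f a" "x \<notin> orbit f b" for x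
    using *(3)[of x] that unfolding *(1) by simp
qed

text \<open>With \<open>f\<close> the face permutation this is the circulation of \<open>w\<close>
  around the face of \<open>x\<close>.\<close>

definition osum :: "('a \<Rightarrow> 'a) \<Rightarrow> ('a \<Rightarrow> 'b::comm_monoid_add) \<Rightarrow> 'a \<Rightarrow> 'b" where
  "osum f w x = sum w (orbit f x)"

lemma osum_cong_orbit: "permutation f \<Longrightarrow> y \<in> orbit f x \<Longrightarrow> osum f w y = osum f w x"
  by (simp add: osum_def orbit_eq_of_mem)

lemma sum_eq_sum_osum:
  assumes f: "permutation f" and S: "finite S" "\<And>x. x \<in> S \<Longrightarrow> orbit f x \<subseteq> S"
  shows "sum w S = (\<Sum>A\<in>orbit f ` S. sum w A)"
proof -
  have "S = \<Union>(orbit f ` S)" using S(2) permutation_self_in_orbit[OF f] by blast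
  then have "sum w S = sum w (\<Union>(orbit f ` S))" by simp
  also have "\<dots> = (sum \<circ> sum) w (orbit f ` S)"
  proof (rule sum.Union_disjoint)
    show "\<forall>A\<in>orbit f ` S. finite A" using finite_orbit_permutation[OF f] by blast
    show "\<forall>A\<in>orbit f ` S. \<forall>B\<in>orbit f ` S. A \<noteq> B \<longrightarrow> A \<inter> B = {}"
      using orbit_disjoint[OF f] orbit_eq_of_mem[OF f] by (metis (no_types, lifting) imageE)
  qed
  finally show ?thesis by simp
qed

lemma sum_osum_0:
  assumes "permutation f" "finite S" "\<And>x. x \<in> S \<Longrightarrow> orbit f x \<subseteq> S" "\<And>x. x \<in> S \<Longrightarrow> osum f w x = 0"
  shows "sum w S = 0"
  using assms by (subst sum_eq_sum_osum[OF assms(1-3)]) (auto intro: sum.neutral simp: osum_def)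

lemma sum_osum_dvd:
  fixes w :: "'a \<Rightarrow> int"
  assumes "permutation f" "finite S" "\<And>x. x \<in> S \<Longrightarrow> orbit f x \<subseteq> S" "\<And>x. x \<in> S \<Longrightarrow> n dvd osum f w x"
  shows "n dvd sum w S"
  using assms by (subst sum_eq_sum_osum[OF assms(1-3)]) (auto intro: dvd_sum simp: osum_def)

lemma sum_osum_nonpos:
  fixes w :: "'a \<Rightarrow> int"
  assumes "permutation f" "finite S" "\<And>x. x \<in> S \<Longrightarrow> orbit f x \<subseteq> S" "\<And>x. x \<in> S \<Longrightarrow> osum f w x \<le> 0"
  shows "sum w S \<le> 0"
  using assms by (subst sum_eq_sum_osum[OF assms(1-3)]) (auto intro: sum_nonpos simp: osum_def)

lemma osum_split:
  assumes f: "permutation f" and b: "b \<in> orbit f a" and ab: "a \<noteq> b"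
  defines "g \<equiv> transpose a b \<circ> f"
  shows "osum f w a = osum g w a + osum g w b"
    and "\<And>x. x \<notin> orbit f a \<Longrightarrow> osum g w x = osum f w x"
proof -
  note * = orbit_transpose_split[OF f b ab, folded g_def]
  have g: "permutation g" unfolding g_def using f by (rule permutation_transpose_comp)
  show "osum f w a = osum g w a + osum g w b" unfolding osum_def *(1)
    by (rule sum.union_disjoint[OF finite_orbit_permutation[OF g] finite_orbit_permutation[OF g] *(2)])
  show "osum g w x = osum f w x" if "x \<notin> orbit f a" for x
    using *(3)[OF that] by (simp add: osum_def)
qed

lemma osum_join:
  assumes f: "permutation f" and b: "b \<notin> orbit f a"
  defines "g \<equiv> transpose a b \<circ> f"
  shows "osum g w a = osum f w a + osum f w b"
    and "\<And>x. x \<notin> orbit f a \<Longrightarrow> x \<notin> orbit f b \<Longrightarrow> osum g w x = osum f w x"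
proof -
  note * = orbit_transpose_join[OF f b, folded g_def]
  show "osum g w a = osum f w a + osum f w b" unfolding osum_def *(1)
    by (rule sum.union_disjoint[OF finite_orbit_permutation[OF f] finite_orbit_permutation[OF f] *(3)])
  show "osum g w x = osum f w x" if "x \<notin> orbit f a" "x \<notin> orbit f b" for x
    using *(4)[OF that] by (simp add: osum_def)
qed

section \<open>Orbits of several maps\<close>

lemma gorbit_self [simp]: "x \<in> gorbit F x"
  by (simp add: gorbit_def)

lemma gorbit_sym: "y \<in> gorbit F x \<Longrightarrow> x \<in> gorbit F y"
  by (auto simp: gorbit_def intro: equivclp_sym)

lemma gorbit_trans: "z \<in> gorbit F y \<Longrightarrow> y \<in> gorbit F x \<Longrightarrow> z \<in> gorbit F x"
  by (auto simp: gorbit_def intro: equivclp_trans)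

lemma gorbit_eq: "y \<in> gorbit F x \<Longrightarrow> gorbit F y = gorbit F x"
  by (blast intro: gorbit_trans gorbit_sym)

lemma gorbit_step: "f \<in> F \<Longrightarrow> f x \<in> gorbit F x"
  by (simp add: gorbit_def equivclp_gen)

lemma gorbit_image_iff: "f \<in> F \<Longrightarrow> f y \<in> gorbit F x \<longleftrightarrow> y \<in> gorbit F x"
  by (meson gorbit_step gorbit_sym gorbit_trans)

text \<open>The step is an equivalence because orbits are also closed under going backwards along
  the maps.\<close>

lemma gorbit_induct [consumes 1, case_names base step]:
  assumes "y \<in> gorbit F x" "P x" "\<And>u f. f \<in> F \<Longrightarrow> P (f u) \<longleftrightarrow> P u"
  shows "P y"
proof -
  have "equivclp (\<lambda>u v. \<exists>f\<in>F. v = f u) x y" using assms(1) by (simp add: gorbit_def)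
  then show ?thesis
  proof (induction rule: equivclp_induct)
    case base then show ?case by (rule assms(2))
  next
    case (step y z) then show ?case using assms(3) by metis
  qed
qed

lemma gorbit_closed: "(\<And>f u. f \<in> F \<Longrightarrow> f u \<in> D \<longleftrightarrow> u \<in> D) \<Longrightarrow> x \<in> D \<Longrightarrow> gorbit F x \<subseteq> D"
  using gorbit_induct[of _ F x "\<lambda>y. y \<in> D"] by blast

lemma orbit_subset_gorbit: "f \<in> F \<Longrightarrow> orbit f x \<subseteq> gorbit F x"
proof
  fix y assume f: "f \<in> F" and "y \<in> orbit f x"
  from this(2) show "y \<in> gorbit F x"
    by induct (simp_all add: gorbit_step gorbit_image_iff f)
qed

lemma orbit_comp_subset_gorbit: "f \<in> F \<Longrightarrow> g \<in> F \<Longrightarrow> orbit (f \<circ> g) x \<subseteq> gorbit F x"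
proof
  fix y assume f: "f \<in> F" "g \<in> F" and "y \<in> orbit (f \<circ> g) x"
  from this(3) show "y \<in> gorbit F x"
    by induct (simp_all add: gorbit_step gorbit_image_iff f)
qed

lemma transpose_mem_iff: "(a \<in> S \<longleftrightarrow> b \<in> S) \<Longrightarrow> transpose a b x \<in> S \<longleftrightarrow> x \<in> S"
  by (cases "x = a"; cases "x = b") auto

lemma gorbit2_iff:
  "v u \<in> gorbit {v, e} x \<longleftrightarrow> u \<in> gorbit {v, e} x"
  "e u \<in> gorbit {v, e} x \<longleftrightarrow> u \<in> gorbit {v, e} x"
  by (rule gorbit_image_iff; simp)+

lemma gorbit2_induct [consumes 1, case_names base v e]:
  assumes "y \<in> gorbit {v, e} x" "P x" "\<And>u. P (v u) \<longleftrightarrow> P u" "\<And>u. P (e u) \<longleftrightarrow> P u"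
  shows "P y"
  using assms(1,2) by (rule gorbit_induct) (use assms(3,4) in auto)

text \<open>Once \<open>a\<close> and \<open>b\<close> lie in one orbit of the new maps, exchanging
  them does not leave any new orbit, so every new orbit is closed under the old \<open>v\<close> as
  well.\<close>

lemma gorbit_transpose_subset:
  assumes "b \<in> gorbit {transpose a b \<circ> v, e} a"
  shows "gorbit {v, e} x \<subseteq> gorbit {transpose a b \<circ> v, e} x"
proof
  let ?K = "gorbit {transpose a b \<circ> v, e} x"
  fix y assume "y \<in> gorbit {v, e} x"
  then show "y \<in> ?K"
  proof (induct rule: gorbit2_induct)
    case base show ?case by simp
  next
    case (v u)
    have *: "a \<in> ?K \<longleftrightarrow> b \<in> ?K" using assms by (meson gorbit_sym gorbit_trans)
    have "v u \<in> ?K \<longleftrightarrow> (transpose a b \<circ> v) u \<in> ?K" using transpose_mem_iff[OF *] by simp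
    then show ?case using gorbit2_iff(1)[of "transpose a b \<circ> v" u e x] by (rule trans)
  next
    case (e u) show ?case by (rule gorbit2_iff(2))
  qed
qed

lemma gorbit_transpose_same:
  assumes "b \<in> gorbit {transpose a b \<circ> v, e} a" "b \<in> gorbit {v, e} a"
  shows "gorbit {transpose a b \<circ> v, e} x = gorbit {v, e} x"
  using gorbit_transpose_subset[OF assms(1)] gorbit_transpose_subset[of b a "transpose a b \<circ> v" e] assms(2)
  by (simp add: transpose_comp_twice set_eq_subset)

lemma gorbit_transpose_join:
  assumes "permutation v" "b \<notin> gorbit {v, e} a"
  shows "gorbit {transpose a b \<circ> v, e} a = gorbit {v, e} a \<union> gorbit {v, e} b"
    and "b \<in> gorbit {transpose a b \<circ> v, e} a"
    and "\<And>x. x \<notin> gorbit {v, e} a \<Longrightarrow> x \<notin> gorbit {v, e} b \<Longrightarrow> gorbit {transpose a b \<circ> v, e} x = gorbit {v, e} x"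
proof -
  let ?F = "{v, e}" and ?F' = "{transpose a b \<circ> v, e}"
  have "b \<notin> orbit v a" using assms(2) orbit_subset_gorbit[of v ?F a] by blast
  then have "b \<in> orbit (transpose a b \<circ> v) a" by (rule transpose_joins[OF assms(1)])
  then show ab: "b \<in> gorbit ?F' a" using orbit_subset_gorbit[of "transpose a b \<circ> v" ?F' a] by blast
  have 1: "y \<in> gorbit ?F a \<union> gorbit ?F b" if "y \<in> gorbit ?F' a" for y using that
  proof (induct rule: gorbit2_induct)
    case base show ?case by simp
  next
    case (v u)
    have *: "a \<in> gorbit ?F a \<union> gorbit ?F b \<longleftrightarrow> b \<in> gorbit ?F a \<union> gorbit ?F b" by simp
    show ?case using transpose_mem_iff[OF *, of "v u"] by (simp add: gorbit2_iff)
  next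
    case (e u) show ?case by (simp add: gorbit2_iff)
  qed
  have 2: "gorbit ?F a \<subseteq> gorbit ?F' a" by (rule gorbit_transpose_subset[OF ab])
  have 3: "gorbit ?F b \<subseteq> gorbit ?F' a"
    unfolding gorbit_eq[OF ab, symmetric] by (rule gorbit_transpose_subset[OF ab])
  show "gorbit ?F' a = gorbit ?F a \<union> gorbit ?F b"
    by (rule subset_antisym[OF subsetI[OF 1] Un_least[OF 2 3]])
  show "gorbit ?F' x = gorbit ?F x" if x: "x \<notin> gorbit ?F a" "x \<notin> gorbit ?F b" for x
  proof
    show "gorbit ?F x \<subseteq> gorbit ?F' x" by (rule gorbit_transpose_subset[OF ab])
    have n: "a \<notin> gorbit ?F x" "b \<notin> gorbit ?F x" using x by (auto dest: gorbit_sym)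
    then have *: "a \<in> gorbit ?F x \<longleftrightarrow> b \<in> gorbit ?F x" by simp
    show "gorbit ?F' x \<subseteq> gorbit ?F x"
    proof
      fix y assume "y \<in> gorbit ?F' x"
      then show "y \<in> gorbit ?F x"
      proof (induct rule: gorbit2_induct)
        case base show ?case by simp
      next
        case (v u)
        show ?case using transpose_mem_iff[OF *, of "v u"] by (simp add: gorbit2_iff)
      next
        case (e u) show ?case by (rule gorbit2_iff(2))
      qed
    qed
  qed
qed

section \<open>Rotation systems of oriented maps\<close>

text \<open>
  The combinatorial map of an oriented map: \<open>D\<close> is the set of darts, \<open>v\<close> rotates
  around vertices, \<open>e\<close> reverses darts, and the faces are the cycles of \<open>v \<circ> e\<close>.
\<close>

definition darts :: "'a set \<Rightarrow> ('a \<Rightarrow> 'a) \<Rightarrow> ('a \<Rightarrow> 'a) \<Rightarrow> bool" where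
  "darts D v e \<longleftrightarrow> finite D \<and> permutation v \<and> permutation e \<and> (\<forall>x. v x \<in> D \<longleftrightarrow> x \<in> D) \<and>
     (\<forall>x. e x \<in> D \<longleftrightarrow> x \<in> D) \<and> (\<forall>x. e (e x) = x)"

lemma dartsD:
  assumes "darts D v e"
  shows "finite D" "permutation v" "permutation e" "v x \<in> D \<longleftrightarrow> x \<in> D" "e x \<in> D \<longleftrightarrow> x \<in> D"
    "e (e x) = x" "permutation (v \<circ> e)"
  using assms by (auto simp: darts_def permutation_compose)

lemma darts_transpose:
  assumes "darts D v e" "a \<in> D" "b \<in> D"
  shows "darts D (transpose a b \<circ> v) e"
  using assms transpose_mem_iff[of a D b] by (auto simp: darts_def permutation_transpose_comp)

lemma darts_gorbit_subset: "darts D v e \<Longrightarrow> x \<in> D \<Longrightarrow> gorbit {v, e} x \<subseteq> D"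
  by (rule gorbit_closed) (auto simp: darts_def)

lemma darts_face_subset: "darts D v e \<Longrightarrow> x \<in> D \<Longrightarrow> orbit (v \<circ> e) x \<subseteq> D"
  by (rule orbit_closed) (auto simp: darts_def)

lemma darts_orbit_subset: "darts D v e \<Longrightarrow> x \<in> D \<Longrightarrow> orbit v x \<subseteq> D"
  by (rule orbit_closed) (auto simp: darts_def)

lemma transpose_comp_assoc: "(transpose a b \<circ> v) \<circ> e = transpose a b \<circ> (v \<circ> e)"
  by (simp add: comp_assoc)

lemma face_subset_gorbit: "orbit (v \<circ> e) x \<subseteq> gorbit {v, e} x"
  by (rule orbit_comp_subset_gorbit) auto

text \<open>Reindexing along \<open>e\<close> turns the sum into its own negative: the two darts of
  an edge cancel.\<close>

lemma antisym_sum_0: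
  fixes w :: "'a \<Rightarrow> 'b::linordered_idom"
  assumes "\<And>x. x \<in> S \<Longrightarrow> e x \<in> S" "\<And>x. e (e x) = x" "\<And>x. x \<in> S \<Longrightarrow> w (e x) = - w x"
  shows "sum w S = 0"
proof -
  have "sum w S = sum (\<lambda>x. w (e x)) S"
    by (rule sum.reindex_bij_witness[of _ e e]) (use assms in auto)
  also have "\<dots> = - sum w S" using assms(3) by (simp add: sum_negf)
  finally show ?thesis by simp
qed

text \<open>
  Vanishing of the first cohomology, which characterizes plane maps and, unlike the Euler
  characteristic, is easily transported along gluings.
\<close>

definition planar :: "'a set \<Rightarrow> ('a \<Rightarrow> 'a) \<Rightarrow> ('a \<Rightarrow> 'a) \<Rightarrow> bool" where
  "planar D v e \<longleftrightarrow> (\<forall>w :: 'a \<Rightarrow> real.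
     (\<forall>x\<in>D. w (e x) = - w x) \<longrightarrow> (\<forall>x\<in>D. osum (v \<circ> e) w x = 0) \<longrightarrow>
     (\<exists>p. \<forall>x\<in>D. p (v x) = p x \<and> w x = p (e x) - p x))"

text \<open>The old face of \<open>a\<close> and \<open>b\<close> is the union of two new ones, so
  vanishing face sums pass to the unglued map, which supplies a potential \<open>p\<close> constant
  at the old vertices. It remains to see \<open>p a = p b\<close>: around the new face of
  \<open>a\<close> the old and new face permutations differ only at the dart \<open>z\<close> sent
  to \<open>a\<close>, and the sum of \<open>w\<close> there collapses to
  \<open>p b - p a\<close>.\<close>

lemma planar_glue_same_face:
  assumes d: "darts D v e" and ab: "a \<in> D" "b \<in> D" "a \<noteq> b" and bo: "b \<in> orbit (v \<circ> e) a"
    and pl: "planar D v e"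
  shows "planar D (transpose a b \<circ> v) e"
  unfolding planar_def
proof (intro allI impI)
  let ?f = "v \<circ> e" and ?g = "transpose a b \<circ> (v \<circ> e)"
  note [simp] = dartsD[OF d]
  have f: "permutation ?f" and g: "permutation ?g" by (simp_all add: permutation_transpose_comp permutation_compose)
  fix w :: "'a \<Rightarrow> real"
  assume w: "\<forall>x\<in>D. w (e x) = - w x" and w0: "\<forall>x\<in>D. osum ((transpose a b \<circ> v) \<circ> e) w x = 0"
  have w0: "osum ?g w x = 0" if "x \<in> D" for x using w0 that by (simp add: comp_assoc)
  have "osum ?f w x = 0" if "x \<in> D" for x
  proof (cases "x \<in> orbit ?f a")
    case True
    then have "osum ?f w x = osum ?f w a" by (rule osum_cong_orbit[OF f])
    then show ?thesis using osum_split(1)[OF f bo ab(3), of w] w0 ab by simp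
  next
    case False
    then show ?thesis using osum_split(2)[OF f bo ab(3) False, of w] w0[OF that] by simp
  qed
  then obtain p where p: "\<forall>x\<in>D. p (v x) = p x \<and> w x = p (e x) - p x"
    using pl w unfolding planar_def by blast
  define S where "S = orbit ?g a"
  have SD: "S \<subseteq> D" unfolding S_def
    by (rule orbit_closed) (use transpose_mem_iff[of a D b] ab in auto)
  have aS: "a \<in> S" unfolding S_def by (rule permutation_self_in_orbit[OF g])
  have bS: "b \<notin> S" unfolding S_def by (rule transpose_separates[OF f bo ab(3)])
  have fin: "finite S" using SD finite_subset by fastforce
  obtain z where ga: "?g z = a" using permutation_bijective[OF g] by (metis bij_pointE)
  have "z \<in> S" using orbit_image_iff[OF g, of z a] aS unfolding S_def ga by simp
  note z = this ga
  then have fz: "?f z = b" by (metis comp_apply transpose_apply_first transpose_involutory)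
  have bij: "bij_betw ?g S S"
    unfolding bij_betw_def S_def
  proof
    show "inj_on ?g (orbit ?g a)" using permutation_inj[OF g] by (auto intro: inj_onI)
    show "?g ` orbit ?g a = orbit ?g a"
      by (metis (no_types, lifting) cyclic_on_def cyclic_on_orbit' g orbit_inverse orbit_mem_sym permutation_orbit_step permutation_self_in_orbit)
  qed
  have "0 = sum w S" using w0[OF ab(1)] by (simp add: osum_def S_def)
  also have "\<dots> = (\<Sum>x\<in>S. p (?f x) - p x)" using p SD by (intro sum.cong) auto
  also have "\<dots> = (\<Sum>x\<in>S. p (?f x)) - (\<Sum>x\<in>S. p (?g x))"
    using sum.reindex_bij_betw[OF bij, of p] by (simp add: sum_subtractf)
  also have "\<dots> = (\<Sum>x\<in>S. p (?f x) - p (?g x))" by (simp add: sum_subtractf)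
  also have "\<dots> = (\<Sum>x\<in>S. if x = z then p b - p a else 0)"
  proof (rule sum.cong[OF refl])
    fix x assume x: "x \<in> S"
    show "p (?f x) - p (?g x) = (if x = z then p b - p a else 0)"
    proof (cases "x = z")
      case True then show ?thesis using fz z by simp
    next
      case False
      have "?f x \<noteq> b" using fz False permutation_inj[OF f] by metis
      moreover have "?f x \<noteq> a"
      proof
        assume "?f x = a"
        then have "?g x = b" by simp
        then show False using orbit.step[of x ?g a] x bS by (simp add: S_def)
      qed
      ultimately show ?thesis using False by (simp add: transpose_def)
    qed
  qed
  also have "\<dots> = p b - p a" using fin z by simp
  finally have pab: "p a = p b" by simp
  have "p ((transpose a b \<circ> v) x) = p x" if "x \<in> D" for x
  proof -
    have "p (transpose a b (v x)) = p (v x)" using pab by (auto simp: transpose_def)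
    then show ?thesis using p that by simp
  qed
  then show "\<exists>p. \<forall>x\<in>D. p ((transpose a b \<circ> v) x) = p x \<and> w x = p (e x) - p x" using p by blast
qed

text \<open>Only the two faces that are merged lose their separate sums. Within one component the
  total of \<open>w\<close> is zero because edges cancel, and all other faces of the component have
  sum zero, so the face at \<open>a\<close>, or at \<open>b\<close>, has sum zero too. The resulting
  potential is then made equal at \<open>a\<close> and \<open>b\<close> by a constant shift on one
  component.\<close>

lemma planar_glue_components:
  assumes d: "darts D v e" and ab: "a \<in> D" "b \<in> D" and bo: "b \<notin> gorbit {v, e} a"
    and pl: "planar D v e"
  shows "planar D (transpose a b \<circ> v) e"
  unfolding planar_def
proof (intro allI impI)
  let ?f = "v \<circ> e" and ?g = "transpose a b \<circ> (v \<circ> e)"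
  note [simp] = dartsD[OF d]
  have f: "permutation ?f" by (simp add: permutation_compose)
  fix w :: "'a \<Rightarrow> real"
  assume w: "\<forall>x\<in>D. w (e x) = - w x" and w0: "\<forall>x\<in>D. osum ((transpose a b \<circ> v) \<circ> e) w x = 0"
  have w0: "osum ?g w x = 0" if "x \<in> D" for x using w0 that by (simp add: comp_assoc)
  have nb: "b \<notin> orbit ?f a" using bo face_subset_gorbit by fastforce
  have zero: "osum ?f w c = 0"
    if c: "c \<in> D" "c = a \<and> c' = b \<or> c = b \<and> c' = a" for c c'
  proof -
    let ?K = "gorbit {v, e} c"
    have KD: "?K \<subseteq> D" using c by (intro darts_gorbit_subset[OF d])
    have c': "c' \<notin> ?K" using c bo gorbit_sym by metis
    have s0: "sum w ?K = 0"
      by (rule antisym_sum_0[of _ e]) (use w KD in \<open>auto simp: gorbit2_iff\<close>)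
    have sub: "orbit ?f x \<subseteq> ?K" if "x \<in> ?K" for x
      using face_subset_gorbit[of v e x] gorbit_eq[OF that] by simp
    have "sum w (?K - orbit ?f c) = 0"
    proof (rule sum_osum_0[OF f])
      show "finite (?K - orbit ?f c)" using KD finite_subset by fastforce
      fix x assume x: "x \<in> ?K - orbit ?f c"
      then have dis: "orbit ?f x \<inter> orbit ?f c = {}" using orbit_disjoint[OF f] by blast
      then show "orbit ?f x \<subseteq> ?K - orbit ?f c" using sub x by blast
      have "c \<notin> orbit ?f x" using dis permutation_self_in_orbit[OF f] by blast
      moreover have "c' \<notin> orbit ?f x" using sub x c' by blast
      ultimately have "x \<notin> orbit ?f a" "x \<notin> orbit ?f b" using c orbit_mem_sym[OF f] by metis+
      then show "osum ?f w x = 0" using osum_join(2)[OF f nb, of x w] w0[of x] x KD by auto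
    qed
    moreover have "sum w ?K = sum w (?K - orbit ?f c) + sum w (orbit ?f c)"
      using KD sub[of c] by (intro sum.subset_diff) (auto intro: finite_subset)
    ultimately show ?thesis using s0 by (simp add: osum_def)
  qed
  have "osum ?f w x = 0" if "x \<in> D" for x
  proof -
    consider "x \<in> orbit ?f a" | "x \<in> orbit ?f b" | "x \<notin> orbit ?f a" "x \<notin> orbit ?f b" by blast
    then show ?thesis
    proof cases
      case 1 then show ?thesis using osum_cong_orbit[OF f 1, of w] zero[of a b] ab by simp
    next
      case 2 then show ?thesis using osum_cong_orbit[OF f 2, of w] zero[of b a] ab by simp
    next
      case 3 then show ?thesis using osum_join(2)[OF f nb 3, of w] w0[OF that] by simp
    qed
  qed
  then obtain p where p: "\<forall>x\<in>D. p (v x) = p x \<and> w x = p (e x) - p x"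
    using pl w unfolding planar_def by blast
  define p' where "p' x = p x + (if x \<in> gorbit {v, e} a then p b - p a else 0)" for x
  have "p' a = p' b" using bo by (simp add: p'_def)
  then have "p' (transpose a b y) = p' y" for y by (auto simp: transpose_def)
  moreover have "p' (v x) = p' x \<and> w x = p' (e x) - p' x" if "x \<in> D" for x
    using p that by (simp add: p'_def gorbit2_iff)
  ultimately show "\<exists>p. \<forall>x\<in>D. p ((transpose a b \<circ> v) x) = p x \<and> w x = p (e x) - p x"
    by (intro exI[of _ p']) simp
qed

lemma telescope_orbit:
  fixes p :: "'a \<Rightarrow> 'b::ab_group_add"
  assumes f: "permutation f" and w: "\<And>y. y \<in> orbit f x \<Longrightarrow> w y = p (f y) - p y"
  shows "osum f w x = 0"
proof -
  have bij: "bij_betw f (orbit f x) (orbit f x)"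
    unfolding bij_betw_def
  proof
    show "inj_on f (orbit f x)" using permutation_inj[OF f] by (auto intro: inj_onI)
    then show "f ` orbit f x = orbit f x"
      by (intro endo_inj_surj finite_orbit_permutation[OF f]) (auto intro: orbit.step)
  qed
  have "osum f w x = (\<Sum>y\<in>orbit f x. p (f y) - p y)" unfolding osum_def using w by (rule sum.cong[OF refl])
  then show ?thesis using sum.reindex_bij_betw[OF bij, of p] by (simp add: sum_subtractf)
qed

text \<open>
  A combinatorial Jordan curve theorem. The indicator function of one half of the split vertex has
  vanishing face sums in the unsplit map as well, so by planarity its gradient is the gradient
  of a function that does not distinguish the two halves.
\<close>

lemma split_disconnects:
  assumes d: "darts D v e" and pl: "planar D v e" and ab: "a \<in> D" "b \<in> D" "a \<noteq> b"
    and bv: "b \<in> orbit v a" and bf: "b \<in> orbit (v \<circ> e) a"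
  shows "b \<notin> gorbit {transpose a b \<circ> v, e} a"
proof
  let ?v = "transpose a b \<circ> v" let ?f = "v \<circ> e" and ?g = "transpose a b \<circ> (v \<circ> e)"
  assume bK: "b \<in> gorbit {?v, e} a"
  note [simp] = dartsD[OF d]
  have d': "darts D ?v e" by (rule darts_transpose[OF d ab(1,2)])
  have f: "permutation ?f" and g: "permutation ?g" and v': "permutation ?v"
    by (simp_all add: permutation_transpose_comp permutation_compose)
  define p2 :: "'a \<Rightarrow> real" where "p2 x = (if x \<in> orbit ?v a then 1 else 0)" for x
  define w where "w x = p2 (e x) - p2 x" for x
  have p2v: "p2 (?v x) = p2 x" for x using orbit_image_iff[OF v', of x a] by (simp add: p2_def)
  have "osum ?g w x = 0" for x
    by (rule telescope_orbit[OF g, of _ _ p2]) (use p2v in \<open>simp add: w_def\<close>)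
  then have "osum ?f w x = 0" for x
    using osum_split(1)[OF f bf ab(3), of w] osum_split(2)[OF f bf ab(3), of x w] osum_cong_orbit[OF f, of x a w] by (cases "x \<in> orbit ?f a") auto
  moreover have "\<forall>x\<in>D. w (e x) = - w x" by (simp add: w_def)
  ultimately obtain p where p: "\<forall>x\<in>D. p (v x) = p x \<and> w x = p (e x) - p x"
    using pl unfolding planar_def by blast
  have pv: "p y = p a" if "y \<in> orbit v a" for y using that
  proof induct
    case base then show ?case using p ab by simp
  next
    case (step y)
    then show ?case using p darts_orbit_subset[OF d ab(1)] by auto
  qed
  have pab: "p a = p b" using pv[OF bv] by simp
  have pt: "p (transpose a b y) = p y" for y using pab by (auto simp: transpose_def)
  \<comment> \<open>\<open>p\<close> and \<open>p2\<close> have the same gradient and both are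
    constant at the vertices of the split map, so their difference is constant on the component of
    \<open>a\<close>.\<close>
  have "y \<in> D \<and> p y - p2 y = p a - p2 a" if "y \<in> gorbit {?v, e} a" for y using that
  proof (induct rule: gorbit2_induct)
    case base show ?case using ab by simp
  next
    case (v u)
    have "?v u \<in> D \<longleftrightarrow> u \<in> D" by (rule dartsD(4)[OF d'])
    moreover have "p (?v u) = p u" if "u \<in> D" using p that pt by simp
    ultimately show ?case using p2v by metis
  next
    case (e u)
    show ?case using p by (cases "u \<in> D") (auto simp: w_def algebra_simps)
  qed
  then have "p2 b = p2 a" using bK pab by force
  moreover have "b \<notin> orbit ?v a" by (rule transpose_separates[OF _ bv ab(3)]) simp
  ultimately show False using permutation_self_in_orbit[OF v', of a] by (simp add: p2_def)
qed

section \<open>Euler's formula\<close>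

lemma image_Diff_Un: "U \<subseteq> C \<Longrightarrow> h ` C = h ` (C - U) \<union> h ` U"
  by blast

lemma card_orbits_split:
  assumes f: "permutation f" and C: "finite C" "a \<in> C" "b \<in> C" "\<And>x. f x \<in> C \<longleftrightarrow> x \<in> C"
    and b: "b \<in> orbit f a" and ab: "a \<noteq> b"
  shows "card (orbit (transpose a b \<circ> f) ` C) = Suc (card (orbit f ` C))"
proof -
  let ?g = "transpose a b \<circ> f"
  note * = orbit_transpose_split[OF f b ab]
  have g: "permutation ?g" using f by (rule permutation_transpose_comp)
  define R where "R = orbit f ` (C - orbit f a)"
  have "orbit f ` C = insert (orbit f a) R"
    using orbit_eq_of_mem[OF f, of _ a] C(2) unfolding R_def by auto
  moreover have "orbit f a \<notin> R"
    using permutation_self_in_orbit[OF f] unfolding R_def by (metis DiffD2 imageE)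
  ultimately have 1: "card (orbit f ` C) = Suc (card R)" using C(1) by (simp add: R_def)
  have "orbit ?g ` C = insert (orbit ?g a) (insert (orbit ?g b) R)"
  proof -
    have R: "R = orbit ?g ` (C - orbit f a)"
      unfolding R_def by (rule image_cong[OF refl]) (use *(3) in blast)
    have "orbit ?g ` (orbit f a) = {orbit ?g a, orbit ?g b}"
    proof
      show "orbit ?g ` (orbit f a) \<subseteq> {orbit ?g a, orbit ?g b}"
        using *(1) orbit_eq_of_mem[OF g] by blast
      show "{orbit ?g a, orbit ?g b} \<subseteq> orbit ?g ` (orbit f a)"
        using b permutation_self_in_orbit[OF f] by blast
    qed
    moreover have "orbit f a \<subseteq> C" by (rule orbit_closed) (use C in auto)
    ultimately show ?thesis using image_Diff_Un[of "orbit f a" C "orbit ?g"] unfolding R by auto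
  qed
  moreover have "orbit ?g a \<notin> R" "orbit ?g b \<notin> R"
  proof -
    have "orbit ?g a \<subseteq> orbit f a" "orbit ?g b \<subseteq> orbit f a" using *(1) by blast+
    then show "orbit ?g a \<notin> R" "orbit ?g b \<notin> R"
      using permutation_self_in_orbit[OF f] unfolding R_def by (metis DiffD2 imageE subsetD)+
  qed
  moreover have "orbit ?g a \<noteq> orbit ?g b" using *(2) orbit_nonempty[of ?g a] by auto
  ultimately have "card (orbit ?g ` C) = Suc (Suc (card R))" using C(1) by (simp add: R_def)
  then show ?thesis using 1 by simp
qed

lemma card_orbits_join:
  assumes f: "permutation f" and C: "finite C" "a \<in> C" "b \<in> C" "\<And>x. f x \<in> C \<longleftrightarrow> x \<in> C"
    and b: "b \<notin> orbit f a"
  shows "card (orbit f ` C) = Suc (card (orbit (transpose a b \<circ> f) ` C))"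
proof -
  let ?g = "transpose a b \<circ> f"
  have g: "permutation ?g" using f by (rule permutation_transpose_comp)
  have "b \<in> orbit ?g a" by (rule transpose_joins[OF f b])
  moreover have "a \<noteq> b" using b permutation_self_in_orbit[OF f] by blast
  moreover have "?g x \<in> C \<longleftrightarrow> x \<in> C" for x using transpose_mem_iff[of a C b] C by simp
  ultimately show ?thesis using card_orbits_split[OF g C(1-3)] by (simp add: transpose_comp_twice)
qed

lemma gorbit_image_gorbit: "gorbit F ` gorbit F a = {gorbit F a}"
proof
  show "gorbit F ` gorbit F a \<subseteq> {gorbit F a}" using gorbit_eq[of _ F a] by blast
qed simp

lemma card_gorbits_join:
  assumes v: "permutation v" and C: "finite C" "a \<in> C" "b \<in> C" "\<And>x. v x \<in> C \<longleftrightarrow> x \<in> C" "\<And>x. e x \<in> C \<longleftrightarrow> x \<in> C"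
    and b: "b \<notin> gorbit {v, e} a"
  shows "card (gorbit {v, e} ` C) = Suc (card (gorbit {transpose a b \<circ> v, e} ` C))"
proof -
  let ?G = "gorbit {v, e}" and ?G' = "gorbit {transpose a b \<circ> v, e}"
  note * = gorbit_transpose_join[OF v b]
  define R where "R = ?G ` (C - (?G a \<union> ?G b))"
  have sub: "?G x \<subseteq> C" if "x \<in> C" for x
    by (rule gorbit_closed) (use C(4,5) that in auto)
  then have U: "?G a \<union> ?G b \<subseteq> C" using C(2,3) by blast
  have "?G ` (?G a \<union> ?G b) = {?G a, ?G b}"
    unfolding image_Un gorbit_image_gorbit by blast
  then have "?G ` C = insert (?G a) (insert (?G b) R)"
    using image_Diff_Un[OF U, of ?G] unfolding R_def by auto
  moreover have "?G a \<notin> R" "?G b \<notin> R" "?G a \<noteq> ?G b"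
    unfolding R_def using gorbit_self[of _ "{v, e}"] b by blast+
  ultimately have 1: "card (?G ` C) = Suc (Suc (card R))" using C(1) by (simp add: R_def)
  have "?G' ` (?G a \<union> ?G b) = {?G' a}"
    unfolding *(1)[symmetric] by (rule gorbit_image_gorbit)
  moreover have R: "R = ?G' ` (C - (?G a \<union> ?G b))"
    unfolding R_def by (rule image_cong[OF refl]) (use *(3) in blast)
  ultimately have "?G' ` C = insert (?G' a) R"
    using image_Diff_Un[OF U, of ?G'] by auto
  moreover have "?G' a \<notin> R" unfolding R_def *(1) using gorbit_self[of _ "{v, e}"] by blast
  ultimately have "card (?G' ` C) = Suc (card R)" using C(1) by (simp add: R_def)
  then show ?thesis using 1 by simp
qed

text \<open>Induction on the number of darts moved by \<open>v\<close>: a dart \<open>a\<close> is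
  made a vertex of its own, and gluing it back restores \<open>v\<close>. If this joins two
  components or divides a face, the two sides stay balanced and planarity is passed on; if it merges
  two faces of one component, the left side drops by two against the right one, so equality cannot
  hold.\<close>

lemma euler_planar:
  assumes "darts C v e"
  shows "card (orbit v ` C) + card (orbit e ` C) + card (orbit (v \<circ> e) ` C)
           \<le> card C + 2 * card (gorbit {v, e} ` C) \<and>
     (card (orbit v ` C) + card (orbit e ` C) + card (orbit (v \<circ> e) ` C)
           = card C + 2 * card (gorbit {v, e} ` C) \<longrightarrow> planar C v e)"
  using assms
proof (induction "card {x \<in> C. v x \<noteq> x}" arbitrary: v rule: less_induct)
  case less
  note d = less.prems
  note [simp] = dartsD[OF d]
  show ?case
  proof (cases "\<exists>a\<in>C. v a \<noteq> a")
    case False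
    then have id: "v x = x" if "x \<in> C" for x using that by blast
    have "orbit v x = {x}" if "x \<in> C" for x using id[OF that] orbit_eq_singleton_iff[of v x] by simp
    then have "orbit v ` C = (\<lambda>x. {x}) ` C" by (intro image_cong) auto
    then have 1: "card (orbit v ` C) = card C" by (simp add: card_image)
    have "orbit (v \<circ> e) x = orbit e x" if "x \<in> C" for x
      by (rule orbit_cong0[of x C]) (use that id in auto)
    then have 2: "orbit (v \<circ> e) ` C = orbit e ` C" by (intro image_cong) auto
    have "gorbit {v, e} x = orbit e x" if x: "x \<in> C" for x
    proof
      show "orbit e x \<subseteq> gorbit {v, e} x" by (rule orbit_subset_gorbit) simp
      show "gorbit {v, e} x \<subseteq> orbit e x"
      proof
        fix y assume "y \<in> gorbit {v, e} x"
        then have "y \<in> C \<and> y \<in> orbit e x"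
        proof (induct rule: gorbit2_induct)
          case base then show ?case using x permutation_self_in_orbit[of e x] by simp
        next
          case (v u)
          then show ?case using id[of u] by auto
        next
          case (e u)
          then show ?case using orbit_image_iff[of e u x] by simp
        qed
        then show "y \<in> orbit e x" by simp
      qed
    qed
    then have 3: "gorbit {v, e} ` C = orbit e ` C" by (intro image_cong) auto
    have "planar C v e" unfolding planar_def
    proof (intro allI impI)
      fix w :: "'a \<Rightarrow> real" assume w: "\<forall>x\<in>C. w (e x) = - w x"
      \<comment> \<open>With every vertex reduced to one dart a potential is subject to no vertex
        condition, and antisymmetry of \<open>w\<close> makes half of \<open>- w\<close>
        suitable.\<close>
      show "\<exists>p. \<forall>x\<in>C. p (v x) = p x \<and> w x = p (e x) - p x"
        using w id by (intro exI[of _ "\<lambda>x. - w x / 2"]) auto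
    qed
    then show ?thesis using 1 2 3 by simp
  next
    case True
    then obtain a where a: "a \<in> C" "v a \<noteq> a" by blast
    \<comment> \<open>This choice makes \<open>a\<close> a fixed point of the transposed
      permutation, which lowers the measure.\<close>
    define b where "b = v a"
    have b: "b \<in> C" "a \<noteq> b" "b \<in> orbit v a" using a by (auto simp: b_def orbit.base)
    let ?v = "transpose a b \<circ> v"
    have d': "darts C ?v e" by (rule darts_transpose[OF d a(1) b(1)])
    have tw: "transpose a b \<circ> ?v = v" by (rule transpose_comp_twice)
    have va: "?v a = a" by (simp add: b_def)
    have vx: "?v x = x" if "v x = x" "x \<noteq> a" for x
      using that permutation_inj[of v x a] by (simp add: b_def transpose_def)
    have "{x \<in> C. ?v x \<noteq> x} \<subseteq> {x \<in> C. v x \<noteq> x} - {a}"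
    proof
      fix x assume x: "x \<in> {x \<in> C. ?v x \<noteq> x}"
      then have "x \<noteq> a" using va by auto
      then show "x \<in> {x \<in> C. v x \<noteq> x} - {a}" using vx x by blast
    qed
    then have "card {x \<in> C. ?v x \<noteq> x} < card {x \<in> C. v x \<noteq> x}"
      using a by (intro psubset_card_mono) auto
    note IH = less.hyps[OF this d']
    have cv: "card (orbit ?v ` C) = Suc (card (orbit v ` C))"
      by (rule card_orbits_split) (use a b in auto)
    have g: "permutation (?v \<circ> e)" "\<And>x. (?v \<circ> e) x \<in> C \<longleftrightarrow> x \<in> C" "permutation ?v" "\<And>x. ?v x \<in> C \<longleftrightarrow> x \<in> C"
      using dartsD(4)[OF d'] by (simp_all only: dartsD(2,7)[OF d'] comp_apply[of "?v" e] dartsD(5)[OF d])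
    have vf: "v \<circ> e = transpose a b \<circ> (?v \<circ> e)" by (simp add: fun_eq_iff)
    have bG: "b \<in> gorbit {v, e} a" using b(3) orbit_subset_gorbit[of v "{v, e}"] by blast
    show ?thesis
    proof (cases "b \<in> gorbit {?v, e} a")
      case True
      then have k: "gorbit {?v, e} ` C = gorbit {v, e} ` C" using gorbit_transpose_same[OF True bG] by simp
      show ?thesis
      proof (cases "b \<in> orbit (?v \<circ> e) a")
        case True
        have "card (orbit (v \<circ> e) ` C) = Suc (card (orbit (?v \<circ> e) ` C))"
          unfolding vf by (rule card_orbits_split) (use a b g True in auto)
        moreover have "planar C v e" if "planar C ?v e"
          using planar_glue_same_face[OF d' a(1) b(1,2) True that] unfolding tw .
        ultimately show ?thesis using IH cv k by auto
      next
        case False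
        have "card (orbit (?v \<circ> e) ` C) = Suc (card (orbit (v \<circ> e) ` C))"
          unfolding vf by (rule card_orbits_join) (use a b g False in auto)
        then show ?thesis using IH cv k by auto
      qed
    next
      case False
      have "card (gorbit {?v, e} ` C) = Suc (card (gorbit {transpose a b \<circ> ?v, e} ` C))"
        by (rule card_gorbits_join) (use a b g False in auto)
      then have k: "card (gorbit {?v, e} ` C) = Suc (card (gorbit {v, e} ` C))" unfolding tw .
      have "b \<notin> orbit (?v \<circ> e) a" using False
        by (rule contrapos_nn) (rule face_subset_gorbit[THEN subsetD])
      then have "card (orbit (?v \<circ> e) ` C) = Suc (card (orbit (v \<circ> e) ` C))"
        unfolding vf by (intro card_orbits_join) (use a b g in auto)
      moreover have "planar C v e" if "planar C ?v e"
        using planar_glue_components[OF d' a(1) b(1) False that] unfolding tw .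
      ultimately show ?thesis using IH cv k by auto
    qed
  qed
qed

section \<open>Tensions\<close>

text \<open>
  A homomorphism to a cycle of length \<open>n\<close> gives every dart a direction \<open>t\<close>; going around a
  face, one winds around the cycle \<open>-1\<close>, \<open>0\<close> or \<open>1\<close> times, and in each component at most one
  face winds in each direction.
\<close>

definition tens :: "'a set \<Rightarrow> ('a \<Rightarrow> 'a) \<Rightarrow> ('a \<Rightarrow> 'a) \<Rightarrow> int \<Rightarrow> ('a \<Rightarrow> int) \<Rightarrow> bool" where
  "tens D v e n t \<longleftrightarrow>
     (\<forall>x\<in>D. (t x = 1 \<or> t x = -1) \<and> t (e x) = - t x \<and> osum (v \<circ> e) t x \<in> {0, n, -n}) \<and>
     (\<forall>x\<in>D. \<forall>y\<in>D. y \<in> gorbit {v, e} x \<longrightarrow> osum (v \<circ> e) t x = osum (v \<circ> e) t y \<longrightarrow>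
        osum (v \<circ> e) t x \<noteq> 0 \<longrightarrow> y \<in> orbit (v \<circ> e) x)"

lemma tensD:
  assumes "tens D v e n t" "x \<in> D"
  shows "t x = 1 \<or> t x = -1" "t (e x) = - t x" "osum (v \<circ> e) t x \<in> {0, n, -n}"
  using assms unfolding tens_def by blast+

lemma tens_unique:
  assumes "tens D v e n t" "x \<in> D" "y \<in> D" "y \<in> gorbit {v, e} x"
    "osum (v \<circ> e) t x = osum (v \<circ> e) t y" "osum (v \<circ> e) t x \<noteq> 0"
  shows "y \<in> orbit (v \<circ> e) x"
  using assms unfolding tens_def by blast

lemma tensI:
  assumes "\<And>x. x \<in> D \<Longrightarrow> t x = 1 \<or> t x = -1" "\<And>x. x \<in> D \<Longrightarrow> t (e x) = - t x"
    "\<And>x. x \<in> D \<Longrightarrow> osum (v \<circ> e) t x \<in> {0, n, -n}"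
    "\<And>x y. x \<in> D \<Longrightarrow> y \<in> D \<Longrightarrow> y \<in> gorbit {v, e} x \<Longrightarrow> osum (v \<circ> e) t x = osum (v \<circ> e) t y \<Longrightarrow>
       osum (v \<circ> e) t x \<noteq> 0 \<Longrightarrow> y \<in> orbit (v \<circ> e) x"
  shows "tens D v e n t"
  unfolding tens_def using assms by blast

lemma tens_mono: "tens D v e n t \<Longrightarrow> S \<subseteq> D \<Longrightarrow> tens S v e n t"
  unfolding tens_def by blast

lemma tens_local:
  assumes "\<And>x. x \<in> D \<Longrightarrow> tens (gorbit {v, e} x) v e n t"
  shows "tens D v e n t"
proof (rule tensI)
  fix x assume x: "x \<in> D"
  show "t x = 1 \<or> t x = -1" "t (e x) = - t x" "osum (v \<circ> e) t x \<in> {0, n, -n}"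
    using tensD[OF assms[OF x] gorbit_self] by auto
next
  fix x y assume "x \<in> D" "y \<in> gorbit {v, e} x" "osum (v \<circ> e) t x = osum (v \<circ> e) t y" "osum (v \<circ> e) t x \<noteq> 0"
  then show "y \<in> orbit (v \<circ> e) x" using tens_unique[OF assms gorbit_self] by blast
qed

lemma gorbit_face_subset: "x \<in> gorbit {v, e} c \<Longrightarrow> orbit (v \<circ> e) x \<subseteq> gorbit {v, e} c"
  using face_subset_gorbit[of v e x] gorbit_eq[of x "{v, e}" c] by simp

lemma closed_Diff_orbit:
  assumes "permutation f" "\<And>x. x \<in> S \<Longrightarrow> orbit f x \<subseteq> S" "x \<in> S - orbit f c"
  shows "orbit f x \<subseteq> S - orbit f c"
  using assms(2)[of x] orbit_disjoint[OF assms(1), of x c] assms(3) by blast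

text \<open>Otherwise all nonzero face sums in \<open>S\<close> would have the sign of the one at
  \<open>x\<close>, and the total could not vanish.\<close>

lemma opposite_face:
  fixes t :: "'a \<Rightarrow> int"
  assumes f: "permutation f" and S: "finite S" "\<And>x. x \<in> S \<Longrightarrow> orbit f x \<subseteq> S"
    and t: "\<And>x. x \<in> S \<Longrightarrow> osum f t x \<in> {0, n, -n}" "sum t S = 0" and x: "x \<in> S" "osum f t x \<noteq> 0"
  shows "\<exists>y\<in>S. osum f t y = - osum f t x"
proof (rule ccontr)
  assume no: "\<not> ?thesis"
  define s where "s = osum f t x"
  \<comment> \<open>The factor \<open>- s\<close> treats the two signs of \<open>s\<close> at once:
    face sums of the same sign as \<open>s\<close> become negative.\<close>
  define w where "w y = - s * t y" for y
  have ow: "osum f w y = - s * osum f t y" for y by (simp add: osum_def w_def sum_negf sum_distrib_left)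
  have "sum w (S - orbit f x) \<le> 0"
  proof (rule sum_osum_nonpos[OF f])
    show "finite (S - orbit f x)" using S by simp
    show "orbit f y \<subseteq> S - orbit f x" if "y \<in> S - orbit f x" for y
      by (rule closed_Diff_orbit[OF f S(2) that])
    show "osum f w y \<le> 0" if "y \<in> S - orbit f x" for y
    proof -
      have "osum f t y = 0 \<or> osum f t y = s" using t(1)[of y] t(1)[of x] no that x s_def by auto
      then show ?thesis unfolding ow by auto
    qed
  qed
  moreover have "sum w S = sum w (S - orbit f x) + sum w (orbit f x)"
    by (rule sum.subset_diff) (use S x in auto)
  moreover have "sum w (orbit f x) = - s * s" using ow[of x] by (simp add: osum_def s_def)
  moreover have "sum w S = 0" using t(2) by (simp add: w_def sum_negf flip: sum_distrib_left)
  moreover have "s * s > 0" using x by (auto simp: s_def zero_less_mult_iff)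
  ultimately show False by simp
qed

text \<open>At most one face of sum \<open>n\<close> and one of sum \<open>- n\<close> occur in
  \<open>S\<close>, so the nonzero face sums are a single one or cancel.\<close>

lemma sum_closed_faces:
  fixes t :: "'a \<Rightarrow> int"
  assumes f: "permutation f" and S: "finite S" "\<And>x. x \<in> S \<Longrightarrow> orbit f x \<subseteq> S"
    and t: "\<And>x. x \<in> S \<Longrightarrow> osum f t x \<in> {0, n, -n}"
    and u: "\<And>x y. x \<in> S \<Longrightarrow> y \<in> S \<Longrightarrow> osum f t x = osum f t y \<Longrightarrow> osum f t x \<noteq> 0 \<Longrightarrow> y \<in> orbit f x"
  shows "sum t S \<in> {0, n, -n}" and "\<And>x. x \<in> S \<Longrightarrow> osum f t x \<noteq> 0 \<Longrightarrow> sum t S = osum f t x \<or> sum t S = 0"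
proof -
  have key: "sum t S = osum f t x \<or> sum t S = 0" if x: "x \<in> S" "osum f t x \<noteq> 0" for x
  proof -
    define S' where "S' = S - orbit f x"
    have S': "finite S'" "\<And>y. y \<in> S' \<Longrightarrow> orbit f y \<subseteq> S'"
      using S closed_Diff_orbit[OF f S(2)] by (auto simp: S'_def)
    have sS: "sum t S = sum t S' + osum f t x"
      unfolding S'_def osum_def by (rule sum.subset_diff) (use S x in auto)
    have s': "osum f t y = 0 \<or> osum f t y = - osum f t x" if "y \<in> S'" for y
      using t[OF x(1)] t[of y] u[OF x(1), of y] x that unfolding S'_def by auto
    show ?thesis
    proof (cases "\<exists>y\<in>S'. osum f t y \<noteq> 0")
      case False
      then have "sum t S' = 0" using S' by (intro sum_osum_0[OF f]) auto
      then show ?thesis using sS by simp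
    next
      case True
      then obtain y where y: "y \<in> S'" "osum f t y \<noteq> 0" by blast
      then have yx: "osum f t y = - osum f t x" using s' by blast
      have "sum t (S' - orbit f y) = 0"
      proof (rule sum_osum_0[OF f])
        show "finite (S' - orbit f y)" using S' by simp
        show "orbit f z \<subseteq> S' - orbit f y" if "z \<in> S' - orbit f y" for z
          by (rule closed_Diff_orbit[OF f S'(2) that])
        show "osum f t z = 0" if "z \<in> S' - orbit f y" for z
          using s'[of z] yx u[of y z] y that unfolding S'_def by auto
      qed
      moreover have "sum t S' = sum t (S' - orbit f y) + osum f t y"
        unfolding osum_def by (rule sum.subset_diff) (use S' y in auto)
      ultimately show ?thesis using sS yx by simp
    qed
  qed
  then show "\<And>x. x \<in> S \<Longrightarrow> osum f t x \<noteq> 0 \<Longrightarrow> sum t S = osum f t x \<or> sum t S = 0" .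
  show "sum t S \<in> {0, n, -n}"
  proof (cases "\<exists>x\<in>S. osum f t x \<noteq> 0")
    case True
    then show ?thesis using key t by fastforce
  next
    case False
    then have "sum t S = 0" using S by (intro sum_osum_0[OF f]) auto
    then show ?thesis by simp
  qed
qed

section \<open>Tensions under vertex gluings and their undoing\<close>

lemma gorbit_glue_same_face:
  assumes "darts D v e" "b \<in> orbit (v \<circ> e) a" "b \<notin> orbit v a"
  shows "gorbit {transpose a b \<circ> v, e} x = gorbit {v, e} x"
proof (rule gorbit_transpose_same)
  have "b \<in> orbit (transpose a b \<circ> v) a" by (rule transpose_joins[OF dartsD(2)[OF assms(1)] assms(3)])
  then show "b \<in> gorbit {transpose a b \<circ> v, e} a" by (rule orbit_subset_gorbit[THEN subsetD, rotated]) simp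
  show "b \<in> gorbit {v, e} a" using assms(2) by (rule face_subset_gorbit[THEN subsetD])
qed

text \<open>Undoing the gluing merges two different faces of one component, with sums
  \<open>A\<close> and \<open>B\<close>. These cannot be equal unless zero, so \<open>A + B\<close>
  is again admissible; if it is nonzero, it is the sum of just one of the two, whose uniqueness is
  inherited by the merged face.\<close>

lemma tens_unglue_same_face:
  assumes d: "darts D v e" and ab: "a \<in> D" "b \<in> D" "a \<noteq> b" and bf: "b \<in> orbit (v \<circ> e) a" and bv: "b \<notin> orbit v a"
    and t: "tens D (transpose a b \<circ> v) e n t"
  shows "tens D v e n t"
proof -
  let ?f = "v \<circ> e" and ?g = "transpose a b \<circ> (v \<circ> e)"
  have f: "permutation ?f" and g: "permutation ?g" using dartsD[OF d] by (simp_all add: permutation_transpose_comp)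
  note G = gorbit_glue_same_face[OF d bf bv]
  note t' = tensD[OF t, unfolded transpose_comp_assoc]
  note u = tens_unique[OF t, unfolded transpose_comp_assoc G]
  note sp = orbit_transpose_split[OF f bf ab(3)]
  define A where "A = osum ?g t a" define B where "B = osum ?g t b"
  have sa: "osum ?f t x = A + B" if "x \<in> orbit ?f a" for x
    using osum_cong_orbit[OF f that, of t] osum_split(1)[OF f bf ab(3), of t] by (simp add: A_def B_def)
  have so: "osum ?f t x = osum ?g t x" if "x \<notin> orbit ?f a" for x
    using osum_split(2)[OF f bf ab(3) that, of t] by simp
  have bG: "b \<in> gorbit {v, e} a" by (rule face_subset_gorbit[THEN subsetD, OF bf])
  have nb: "b \<notin> orbit ?g a" by (rule transpose_separates[OF f bf ab(3)])
  have AB: "A \<in> {0, n, -n}" "B \<in> {0, n, -n}" "A = B \<Longrightarrow> A = 0"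
    using t'(3)[OF ab(1)] t'(3)[OF ab(2)] u[OF ab(1,2) bG] nb by (auto simp: A_def B_def)
  show ?thesis
  proof (rule tensI)
    show "t x = 1 \<or> t x = -1" "t (e x) = - t x" if "x \<in> D" for x using tensD[OF t that] by auto
    show "osum ?f t x \<in> {0, n, -n}" if "x \<in> D" for x
      using sa[of x] so[of x] t'(3)[OF that] AB by (cases "x \<in> orbit ?f a") auto
    have mixed: False if "x \<in> orbit ?f a" "y \<in> D" "y \<notin> orbit ?f a" "y \<in> gorbit {v, e} x"
      "osum ?f t x = osum ?f t y" "osum ?f t x \<noteq> 0" for x y
    proof -
      have "y \<in> gorbit {v, e} a"
        using that(1,4) face_subset_gorbit gorbit_trans by (metis subsetD)
      then have ya: "y \<in> gorbit {v, e} a" "y \<in> gorbit {v, e} b" using bG by (auto dest: gorbit_eq)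
      have "A + B = osum ?g t y" "A + B \<noteq> 0" using sa[OF that(1)] so[OF that(3)] that(5,6) by auto
      then have "A = osum ?g t y \<and> A \<noteq> 0 \<or> B = osum ?g t y \<and> B \<noteq> 0" using AB t'(3)[OF that(2)] by auto
      then have "y \<in> orbit ?g a \<or> y \<in> orbit ?g b"
        using u[OF ab(1) that(2) ya(1)] u[OF ab(2) that(2) ya(2)] by (auto simp: A_def B_def)
      then show False using that(3) sp(1) by blast
    qed
    fix x y assume xy: "x \<in> D" "y \<in> D" "y \<in> gorbit {v, e} x" "osum ?f t x = osum ?f t y" "osum ?f t x \<noteq> 0"
    show "y \<in> orbit ?f x"
    proof (cases "x \<in> orbit ?f a")
      case True
      then have "y \<in> orbit ?f a" using mixed[of x y] xy by blast
      then show ?thesis using orbit_eq_of_mem[OF f True] by simp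
    next
      case False
      moreover have "y \<notin> orbit ?f a" using mixed[of y x] xy False by (metis gorbit_sym)
      ultimately have "osum ?g t x = osum ?g t y" "osum ?g t x \<noteq> 0" using so xy by auto
      then have "y \<in> orbit ?g x" using u xy by blast
      then show ?thesis using sp(3)[OF False] by simp
    qed
  qed
qed

text \<open>Used in folding: the piece cut off from the face has sum zero, so the rest of the face
  keeps the old sum and its uniqueness.\<close>

lemma tens_glue_same_face:
  assumes d: "darts D v e" and ab: "a \<in> D" "b \<in> D" "a \<noteq> b" and bf: "b \<in> orbit (v \<circ> e) a" and bv: "b \<notin> orbit v a"
    and t: "tens D v e n t" and A: "osum (transpose a b \<circ> (v \<circ> e)) t a = 0"
  shows "tens D (transpose a b \<circ> v) e n t"
proof -
  let ?f = "v \<circ> e" and ?g = "transpose a b \<circ> (v \<circ> e)"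
  have f: "permutation ?f" and g: "permutation ?g" using dartsD[OF d] by (simp_all add: permutation_transpose_comp)
  note G = gorbit_glue_same_face[OF d bf bv]
  note sp = orbit_transpose_split[OF f bf ab(3)]
  have s: "osum ?g t x = (if x \<in> orbit ?g a then 0 else osum ?f t x)" for x
  proof -
    consider "x \<in> orbit ?g a" | "x \<in> orbit ?g b" "x \<notin> orbit ?g a" | "x \<notin> orbit ?f a" "x \<notin> orbit ?g a"
      using sp(1) by blast
    then show ?thesis
    proof cases
      case 1 then show ?thesis using A osum_cong_orbit[OF g 1, of t] by simp
    next
      case 2
      have "x \<in> orbit ?f a" using 2 sp(1) by blast
      then have "osum ?f t x = osum ?g t b"
        using A osum_split(1)[OF f bf ab(3), of t] osum_cong_orbit[OF f, of x a t] by simp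
      then show ?thesis using 2 osum_cong_orbit[OF g 2(1), of t] by simp
    next
      case 3 then show ?thesis using osum_split(2)[OF f bf ab(3) 3(1), of t] by simp
    qed
  qed
  show ?thesis
  proof (rule tensI, unfold transpose_comp_assoc G)
    show "t x = 1 \<or> t x = -1" "t (e x) = - t x" "osum ?g t x \<in> {0, n, -n}" if "x \<in> D" for x
      using tensD[OF t that] s[of x] by auto
    fix x y assume xy: "x \<in> D" "y \<in> D" "y \<in> gorbit {v, e} x" "osum ?g t x = osum ?g t y" "osum ?g t x \<noteq> 0"
    have n: "x \<notin> orbit ?g a" "y \<notin> orbit ?g a" using s[of x] s[of y] xy by auto
    then have yx: "y \<in> orbit ?f x" using tens_unique[OF t xy(1-3)] s[of x] s[of y] xy by simp
    show "y \<in> orbit ?g x"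
    proof (cases "x \<in> orbit ?f a")
      case True
      then have "y \<in> orbit ?f a" using yx orbit_trans by metis
      then have "x \<in> orbit ?g b" "y \<in> orbit ?g b" using True n sp(1) by blast+
      then show ?thesis using orbit_eq_of_mem[OF g] by metis
    next
      case False then show ?thesis using sp(3)[OF False] yx by simp
    qed
  qed
qed

text \<open>The sum of \<open>t\<close> over the component of \<open>a\<close> vanishes, so its face
  at \<open>a\<close> has the negative of the total \<open>sum t S\<close> of the other faces. These
  are also faces of the glued map and lie in one component there, so their total is admissible by
  \<open>sum_closed_faces\<close>. A nonzero total equals every nonzero face sum among them, hence
  the face at \<open>a\<close> winds the other way.\<close>

lemma tens_unglue_component:
  assumes d: "darts D v e" and ab: "a \<in> D" "b \<in> D" and bo: "b \<notin> gorbit {v, e} a"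
    and t: "tens D (transpose a b \<circ> v) e n t"
  shows "tens (gorbit {v, e} a) v e n t"
proof -
  let ?f = "v \<circ> e" and ?g = "transpose a b \<circ> (v \<circ> e)" and ?K = "gorbit {v, e} a"
  have f: "permutation ?f" and v: "permutation v" using dartsD[OF d] by simp_all
  note u = tens_unique[OF t, unfolded transpose_comp_assoc]
  note t' = tensD[OF t, unfolded transpose_comp_assoc]
  have nb: "b \<notin> orbit ?f a" using bo by (rule contrapos_nn) (rule face_subset_gorbit[THEN subsetD])
  have KD: "?K \<subseteq> D" by (rule darts_gorbit_subset[OF d ab(1)])
  define S where "S = ?K - orbit ?f a"
  have K: "finite ?K" using KD dartsD(1)[OF d] finite_subset by blast
  have Kc: "orbit ?f x \<subseteq> ?K" if "x \<in> ?K" for x by (rule gorbit_face_subset[OF that])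
  have nbK: "x \<notin> orbit ?f b" if "x \<in> ?K" for x
    using Kc[OF that] bo orbit_mem_sym[OF f] by blast
  have so: "osum ?f t x = osum ?g t x" "orbit ?g x = orbit ?f x" if "x \<in> S" for x
    using osum_join(2)[OF f nb, of x t] orbit_transpose_join(4)[OF f nb, of x] nbK[of x] that by (auto simp: S_def)
  have Su: "y \<in> orbit ?f x" if "x \<in> S" "y \<in> S" "osum ?f t x = osum ?f t y" "osum ?f t x \<noteq> 0" for x y
  proof -
    have "x \<in> ?K" "y \<in> ?K" using that by (auto simp: S_def)
    then have "y \<in> gorbit {transpose a b \<circ> v, e} x"
      using gorbit_transpose_join(1)[OF v bo] by (metis UnCI gorbit_eq)
    then have "y \<in> orbit ?g x" using u[of x y] so[OF that(1)] so[OF that(2)] that KD by (auto simp: S_def)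
    then show ?thesis using so(2)[OF that(1)] by simp
  qed
  have S: "finite S" "\<And>x. x \<in> S \<Longrightarrow> orbit ?f x \<subseteq> S"
    using K closed_Diff_orbit[OF f Kc] by (auto simp: S_def)
  have St: "osum ?f t x \<in> {0, n, -n}" if "x \<in> S" for x
    using so(1)[OF that] t'(3)[of x] that KD by (auto simp: S_def)
  have sum: "sum t S \<in> {0, n, -n}"
    "\<And>x. x \<in> S \<Longrightarrow> osum ?f t x \<noteq> 0 \<Longrightarrow> sum t S = osum ?f t x \<or> sum t S = 0"
    using sum_closed_faces[OF f S, of t n] St Su by blast+
  have "sum t ?K = 0"
    by (rule antisym_sum_0[of _ e]) (use dartsD[OF d] t' KD in \<open>auto simp: gorbit2_iff\<close>)
  moreover have "sum t ?K = sum t S + osum ?f t a"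
    unfolding S_def osum_def by (rule sum.subset_diff) (use K Kc in auto)
  ultimately have A: "osum ?f t a = - sum t S" by simp
  have sa: "osum ?f t x = - sum t S" if "x \<in> orbit ?f a" for x using osum_cong_orbit[OF f that, of t] A by simp
  have mixed: False if "x \<in> orbit ?f a" "y \<in> S" "osum ?f t x = osum ?f t y" "osum ?f t y \<noteq> 0" for x y
    using sum(2)[of y] sa[OF that(1)] that by simp
  show ?thesis
  proof (rule tensI)
    fix x assume x: "x \<in> ?K"
    show "t x = 1 \<or> t x = -1" "t (e x) = - t x" using tensD[OF t, of x] x KD by auto
    show "osum ?f t x \<in> {0, n, -n}"
      using St[of x] sa[of x] sum(1) x by (cases "x \<in> orbit ?f a") (auto simp: S_def)
  next
    fix x y assume xy: "x \<in> ?K" "y \<in> ?K" "osum ?f t x = osum ?f t y" "osum ?f t x \<noteq> 0"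
    show "y \<in> orbit ?f x"
    proof (cases "x \<in> orbit ?f a")
      case True
      have "y \<notin> S" using mixed[OF True, of y] xy by auto
      then have "y \<in> orbit ?f a" using xy by (simp add: S_def)
      then show ?thesis using orbit_eq_of_mem[OF f True] by simp
    next
      case False
      then have x: "x \<in> S" using xy by (simp add: S_def)
      then have "y \<in> S" using mixed[of y x] xy by (auto simp: S_def)
      then show ?thesis using Su x xy by blast
    qed
  qed
qed

lemma tens_unglue_components:
  assumes d: "darts D v e" and ab: "a \<in> D" "b \<in> D" and bo: "b \<notin> gorbit {v, e} a"
    and t: "tens D (transpose a b \<circ> v) e n t"
  shows "tens D v e n t"
proof (rule tens_local)
  let ?f = "v \<circ> e" and ?g = "transpose a b \<circ> (v \<circ> e)"
  have f: "permutation ?f" and v: "permutation v" using dartsD[OF d] by simp_all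
  fix x assume x: "x \<in> D"
  have ao: "a \<notin> gorbit {v, e} b" using bo by (auto dest: gorbit_sym)
  consider "x \<in> gorbit {v, e} a" | "x \<in> gorbit {v, e} b" | "x \<notin> gorbit {v, e} a" "x \<notin> gorbit {v, e} b" by blast
  then show "tens (gorbit {v, e} x) v e n t"
  proof cases
    case 1 then show ?thesis using tens_unglue_component[OF d ab bo t] gorbit_eq by metis
  next
    case 2
    then show ?thesis
      using tens_unglue_component[OF d ab(2,1) ao] t gorbit_eq transpose_commute by metis
  next
    case 3
    let ?K = "gorbit {v, e} x"
    have KD: "?K \<subseteq> D" by (rule darts_gorbit_subset[OF d x])
    have ab': "a \<notin> ?K" "b \<notin> ?K" using 3 by (auto dest: gorbit_sym)
    have nb: "b \<notin> orbit ?f a" using bo by (rule contrapos_nn) (rule face_subset_gorbit[THEN subsetD])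
    have o: "orbit ?g y = orbit ?f y" if "y \<in> ?K" for y
    proof (rule orbit_transpose_other[OF f])
      show "a \<notin> orbit ?f y" "b \<notin> orbit ?f y" using gorbit_face_subset[OF that] ab' by blast+
    qed
    have K: "gorbit {transpose a b \<circ> v, e} x = ?K" by (rule gorbit_transpose_join(3)[OF v bo 3])
    have "tens ?K (transpose a b \<circ> v) e n t" by (rule tens_mono[OF t KD])
    note t' = tensD[OF this, unfolded transpose_comp_assoc] tens_unique[OF this, unfolded transpose_comp_assoc]
    show ?thesis
    proof (rule tensI)
      fix y assume y: "y \<in> ?K"
      show "t y = 1 \<or> t y = -1" "t (e y) = - t y" "osum ?f t y \<in> {0, n, -n}"
        using t'(1-3)[OF y] o[OF y] by (auto simp: osum_def)
    next
      fix y z assume y: "y \<in> ?K" "z \<in> ?K" "osum ?f t y = osum ?f t z" "osum ?f t y \<noteq> 0"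
      then have "z \<in> gorbit {transpose a b \<circ> v, e} y" using K gorbit_eq by metis
      then show "z \<in> orbit ?f y" using t'(4)[of y z] y o by (simp add: osum_def)
    qed
  qed
qed

text \<open>The alternatives in the last assumption keep a component from getting two faces that
  wind in the same direction: either the merged faces cancel, which uses up one face of each sign,
  or one of the components has no winding faces.\<close>

lemma tens_glue_components:
  assumes d: "darts D v e" and ab: "a \<in> D" "b \<in> D" and bo: "b \<notin> gorbit {v, e} a"
    and t: "tens D v e n t"
    and c: "osum (v \<circ> e) t a = - osum (v \<circ> e) t b \<and> osum (v \<circ> e) t a \<noteq> 0 \<or>
      (\<forall>x\<in>gorbit {v, e} a. osum (v \<circ> e) t x = 0) \<or> (\<forall>x\<in>gorbit {v, e} b. osum (v \<circ> e) t x = 0)"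
  shows "tens D (transpose a b \<circ> v) e n t"
proof -
  let ?f = "v \<circ> e" and ?g = "transpose a b \<circ> (v \<circ> e)" and ?Ka = "gorbit {v, e} a" and ?Kb = "gorbit {v, e} b"
  have f: "permutation ?f" and v: "permutation v" and g: "permutation ?g"
    using dartsD[OF d] by (simp_all add: permutation_transpose_comp)
  define A where "A = osum ?f t a" define B where "B = osum ?f t b"
  have nb: "b \<notin> orbit ?f a" using bo by (rule contrapos_nn) (rule face_subset_gorbit[THEN subsetD])
  define F where "F = orbit ?f a \<union> orbit ?f b"
  note j = orbit_transpose_join[OF f nb] osum_join(1)[OF f nb, of t] osum_join(2)[OF f nb, of _ t]
  have oF: "orbit ?g x = F" if "x \<in> F" for x
    using that orbit_eq_of_mem[OF g, of x a] unfolding j(1) F_def by blast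
  have oN: "orbit ?g x = orbit ?f x" if "x \<notin> F" for x using that j(4)[of x] by (simp add: F_def)
  have s: "osum ?g t x = (if x \<in> F then A + B else osum ?f t x)" for x
  proof (cases "x \<in> F")
    case True
    then have "x \<in> orbit ?g a" using j(1) F_def by blast
    then show ?thesis using osum_cong_orbit[OF g, of x a t] True j by (simp add: A_def B_def)
  qed (use j(6)[of x] in \<open>simp add: F_def\<close>)
  have AB: "A + B \<in> {0, n, -n}"
  proof -
    consider "A = - B" | "A = 0" | "B = 0" using c gorbit_self unfolding A_def B_def by metis
    then show ?thesis using tensD(3)[OF t ab(1)] tensD(3)[OF t ab(2)] by cases (auto simp: A_def B_def)
  qed
  have inK: "x \<in> ?Ka \<union> ?Kb" if "x \<in> F" for x
    using that subsetD[OF face_subset_gorbit, of x v e a] subsetD[OF face_subset_gorbit, of x v e b]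
    unfolding F_def by blast
  have KD: "?Ka \<subseteq> D" "?Kb \<subseteq> D" by (rule darts_gorbit_subset[OF d ab(1)] darts_gorbit_subset[OF d ab(2)])+
  have uniq: "y \<in> orbit ?f x" if "x \<in> gorbit {v, e} z" "y \<in> gorbit {v, e} z" "z \<in> D"
    "osum ?f t x = osum ?f t y" "osum ?f t x \<noteq> 0" for x y z
  proof -
    have "y \<in> gorbit {v, e} x" using that gorbit_eq by metis
    moreover have "x \<in> D" "y \<in> D" using darts_gorbit_subset[OF d that(3)] that by auto
    ultimately show ?thesis using tens_unique[OF t] that by blast
  qed
  have mixed: False if x: "x \<in> F" and y: "y \<in> ?Ka \<union> ?Kb" "y \<notin> F" and eq: "osum ?g t x = osum ?g t y" "osum ?g t x \<noteq> 0" for x y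
  proof -
    have e: "A + B = osum ?f t y" "A + B \<noteq> 0" using s[of x] s[of y] x y eq by auto
    consider "A = - B" | "\<forall>x\<in>?Ka. osum ?f t x = 0" | "\<forall>x\<in>?Kb. osum ?f t x = 0"
      using c by (auto simp: A_def B_def)
    then show False
    proof cases
      case 1 then show False using e by simp
    next
      case 2
      then have "A = 0" "y \<in> ?Kb" using y e by (auto simp: A_def)
      then have "y \<in> orbit ?f b" using uniq[of b b y] e ab by (simp add: B_def)
      then show False using y by (simp add: F_def)
    next
      case 3
      then have "B = 0" "y \<in> ?Ka" using y e by (auto simp: B_def)
      then have "y \<in> orbit ?f a" using uniq[of a a y] e ab by (simp add: A_def)
      then show False using y by (simp add: F_def)
    qed
  qed
  \<comment> \<open>After cancellation a remaining winding face on the side of \<open>a\<close> has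
    sum \<open>- A\<close>, and one on the side of \<open>b\<close> has sum
    \<open>A\<close>.\<close>
  have cross: False if x: "x \<in> ?Ka" "x \<notin> F" and y: "y \<in> ?Kb" "y \<notin> F" and eq: "osum ?f t x = osum ?f t y" "osum ?f t x \<noteq> 0" for x y
  proof -
    from c have "A = - B \<and> A \<noteq> 0" using x y eq by (auto simp: A_def B_def)
    moreover have "osum ?f t x \<noteq> A" using uniq[of a a x] x eq ab by (auto simp: A_def F_def)
    moreover have "osum ?f t y \<noteq> B" using uniq[of b b y] y eq ab by (auto simp: B_def F_def)
    ultimately show False
      using tensD(3)[OF t ab(1)] tensD(3)[OF t ab(2)] tensD(3)[OF t, of x] x KD eq by (auto simp: A_def B_def)
  qed
  show ?thesis
  proof (rule tensI, unfold transpose_comp_assoc)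
    show "t x = 1 \<or> t x = -1" "t (e x) = - t x" "osum ?g t x \<in> {0, n, -n}" if "x \<in> D" for x
      using tensD[OF t that] s[of x] AB by auto
    fix x y assume xy: "x \<in> D" "y \<in> D" "y \<in> gorbit {transpose a b \<circ> v, e} x"
      "osum ?g t x = osum ?g t y" "osum ?g t x \<noteq> 0"
    show "y \<in> orbit ?g x"
    proof (cases "x \<in> ?Ka \<union> ?Kb")
      case True
      then have y: "y \<in> ?Ka \<union> ?Kb" using xy(3) gorbit_transpose_join(1)[OF v bo] gorbit_eq by metis
      show ?thesis
      proof (cases "x \<in> F")
        case xF: True
        then have "y \<in> F" using mixed[OF xF y] xy by blast
        then show ?thesis using oF[OF xF] by simp
      next
        case xF: False
        then have yF: "y \<notin> F" using mixed[OF _ True xF, of y] xy by auto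
        then have eq: "osum ?f t x = osum ?f t y" "osum ?f t x \<noteq> 0" using s[of x] s[of y] xy xF by auto
        have "x \<in> ?Ka \<and> y \<in> ?Ka \<or> x \<in> ?Kb \<and> y \<in> ?Kb"
          using True y cross[of x y] cross[of y x] xF yF eq by auto
        then have "y \<in> orbit ?f x" using uniq[of x a y] uniq[of x b y] ab eq by blast
        then show ?thesis using oN[OF xF] by simp
      qed
    next
      case False
      then have yx: "y \<in> gorbit {v, e} x" using xy(3) gorbit_transpose_join(3)[OF v bo] by auto
      have "x \<notin> F" using False inK by blast
      moreover have "y \<notin> F"
      proof
        assume "y \<in> F"
        then have "y \<in> ?Ka \<union> ?Kb" by (rule inK)
        then have "x \<in> ?Ka \<union> ?Kb" using gorbit_trans[OF gorbit_sym[OF yx]] by blast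
        then show False using False by blast
      qed
      moreover note yx
      ultimately show ?thesis using uniq[of x x y] s[of x] s[of y] xy oN by simp
    qed
  qed
qed

text \<open>If the ends of \<open>x\<close> met without \<open>x\<close> bounding a face alone,
  splitting their vertex would disconnect the map, by planarity, and leave a component in which
  \<open>x\<close> alone bounds a face while all other faces are old ones. Summing over this
  component shows that \<open>n\<close> divides \<open>t x\<close>.\<close>

lemma no_loop:
  assumes d: "darts D v e" and pl: "planar D v e" and t: "tens D v e n t" and n: "n \<ge> 2" and x: "x \<in> D"
  shows "v (e x) \<notin> orbit v x"
proof
  let ?f = "v \<circ> e" and ?y = "v (e x)"
  assume l: "?y \<in> orbit v x"
  have f: "permutation ?f" using dartsD[OF d] by simp
  have tx: "t x = 1 \<or> t x = -1" by (rule tensD(1)[OF t x])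
  show False
  proof (cases "?y = x")
    case True
    then have "orbit ?f x = {x}" using orbit_eq_singleton_iff[of ?f x] by simp
    then have "osum ?f t x = t x" by (simp add: osum_def)
    then show False using tensD(3)[OF t x] tx n by auto
  next
    case False
    let ?w = "transpose x ?y \<circ> v" and ?g = "transpose x ?y \<circ> (v \<circ> e)"
    have y: "?y \<in> D" using x dartsD[OF d] by simp
    have yf: "?y \<in> orbit ?f x" using orbit.base[of ?f x] by simp
    have g: "permutation ?g" by (rule permutation_transpose_comp[OF f])
    note dis = split_disconnects[OF d pl x y False[symmetric] l yf]
    let ?K = "gorbit {?w, e} x"
    have d': "darts D ?w e" by (rule darts_transpose[OF d x y])
    have KD: "?K \<subseteq> D" by (rule darts_gorbit_subset[OF d' x])
    have fin: "finite ?K" using KD dartsD(1)[OF d] finite_subset by blast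
    have "?g x = x" by simp
    then have ox: "orbit ?g x = {x}" using orbit_eq_singleton_iff[of ?g x] by simp
    have "n dvd sum t (?K - orbit ?g x)"
    proof (rule sum_osum_dvd[OF f])
      show "finite (?K - orbit ?g x)" using fin by simp
      fix z assume z: "z \<in> ?K - orbit ?g x"
      have zK: "orbit ?g z \<subseteq> ?K - orbit ?g x"
      proof (rule closed_Diff_orbit[OF g _ z])
        show "orbit ?g u \<subseteq> ?K" if "u \<in> ?K" for u
          using gorbit_face_subset[OF that] by (simp add: transpose_comp_assoc)
      qed
      then have "x \<notin> orbit ?g z" "?y \<notin> orbit ?g z" using ox dis by blast+
      then have "orbit ?f z = orbit ?g z"
        using orbit_transpose_other[OF g, of x z ?y] by (simp add: transpose_comp_twice)
      then show "orbit ?f z \<subseteq> ?K - orbit ?g x" using zK by simp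
      have "z \<in> D" using z KD by blast
      then show "n dvd osum ?f t z" using tensD(3)[OF t, of z] by auto
    qed
    moreover have "sum t ?K = 0"
      by (rule antisym_sum_0[of _ e]) (use dartsD[OF d] tensD[OF t] KD in \<open>auto simp: gorbit2_iff\<close>)
    moreover have "sum t ?K = sum t (?K - orbit ?g x) + sum t (orbit ?g x)"
      by (rule sum.subset_diff) (use fin ox in auto)
    ultimately have "n dvd t x" using ox by (simp add: add_eq_0_iff)
    then show False using tx n by auto
  qed
qed

text \<open>
  If two consecutive darts of opposite direction cannot be folded because their ends already
  coincide, then they cut off a part of the map, in which all directions may be reversed.
\<close>

lemma fold_exists:
  assumes d: "darts D v e" and pl: "planar D v e" and t: "tens D v e n t" and n: "n \<ge> 2" and c: "c \<in> D"
    and tc: "t c \<noteq> t (v (e c))" and c2: "v (e (v (e c))) \<noteq> c"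
  shows "\<exists>t' x. tens D v e n t' \<and> x \<in> D \<and> t' x \<noteq> t' (v (e x)) \<and> v (e (v (e x))) \<noteq> x \<and>
    v (e (v (e x))) \<notin> orbit v x"
proof (cases "v (e (v (e c))) \<in> orbit v c")
  case False
  then show ?thesis using assms by blast
next
  case True
  let ?f = "v \<circ> e"
  define c1 where "c1 = v (e c)"
  define c2 where "c2 = v (e c1)"
  define c3 where "c3 = v (e c2)"
  have f: "permutation ?f" and v: "permutation v" using dartsD[OF d] by simp_all
  have D: "c \<in> D" "c1 \<in> D" "c2 \<in> D" "c3 \<in> D"
    using c dartsD(4,5)[OF d] by (simp_all add: c1_def c2_def c3_def)
  have ne: "c2 \<noteq> c" and c2v: "c2 \<in> orbit v c" using c2 True by (simp_all add: c2_def c1_def)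
  have inj: "v (e x) = v (e y) \<longleftrightarrow> x = y" for x y using permutation_inj[OF f, of x y] by simp
  have c1c: "c1 \<noteq> c" using tc c1_def by metis
  have c1c2: "c1 \<noteq> c2" using inj[of c c1] c1c by (auto simp: c1_def c2_def)
  have c31: "c3 \<noteq> c1" using inj[of c2 c] ne by (auto simp: c1_def c3_def)
  have ov: "orbit v c2 = orbit v c" by (rule orbit_eq_of_mem[OF v c2v])
  have l1: "c1 \<notin> orbit v c" unfolding c1_def by (rule no_loop[OF d pl t n D(1)])
  have l3: "c3 \<notin> orbit v c" using no_loop[OF d pl t n D(3)] unfolding c3_def ov .
  have c2f: "c2 \<in> orbit ?f c"
    using orbit.step[OF orbit.base[of ?f c]] by (simp add: c2_def c1_def)
  let ?w = "transpose c c2 \<circ> v" and ?g = "transpose c c2 \<circ> (v \<circ> e)"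
  \<comment> \<open>The part that is cut off when the vertex of \<open>c\<close> and
    \<open>c2\<close> is split; the darts \<open>c\<close> and \<open>c1\<close> then form a face of
    it.\<close>
  let ?K = "gorbit {?w, e} c"
  have d': "darts D ?w e" by (rule darts_transpose[OF d D(1,3)])
  have w: "permutation ?w" and g: "permutation ?g" using dartsD[OF d'] f by (simp_all add: permutation_transpose_comp)
  have dis: "c2 \<notin> ?K" by (rule split_disconnects[OF d pl D(1,3) ne[symmetric] c2v c2f])
  have KD: "?K \<subseteq> D" by (rule darts_gorbit_subset[OF d' D(1)])
  have fin: "finite ?K" using KD dartsD(1)[OF d] finite_subset by blast
  have Kg: "orbit ?g u \<subseteq> ?K" if "u \<in> ?K" for u
    using gorbit_face_subset[OF that] by (simp add: transpose_comp_assoc)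
  have Kgiff: "?g u \<in> ?K \<longleftrightarrow> u \<in> ?K" for u
    using gorbit2_iff[of ?w "e u" e c] gorbit2_iff(2)[of e u ?w c] by simp
  have cK: "c \<in> ?K" by simp
  have gc: "?g c = c1" using c1c c1c2 by (simp add: transpose_def c1_def)
  have gc1: "?g c1 = c" by (simp add: c2_def)
  have c1K: "c1 \<in> ?K" using Kgiff[of c] gc by simp
  have og: "orbit ?g c = {c, c1}"
  proof -
    have "(?g ^^ 2) c = c" using gc gc1 by (simp add: numeral_2_eq_2)
    then have "orbit ?g c = {(?g ^^ m) c | m. m < 2}" by (rule orbit_altdef_bounded) simp
    also have "\<dots> = {c, c1}" using gc by (auto simp: less_2_cases_iff simp del: comp_apply intro: exI[of _ 0] exI[of _ "Suc 0"])
    finally show ?thesis .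
  qed
  have "c \<notin> orbit v c1" "c2 \<notin> orbit v c1" using l1 ov orbit_mem_sym[OF v] by metis+
  then have "orbit ?w c1 = orbit v c1" by (rule orbit_transpose_other[OF v])
  moreover have "orbit ?w c1 \<subseteq> ?K"
    using orbit_subset_gorbit[of ?w "{?w, e}" c1] gorbit_eq[OF c1K] by simp
  moreover have "c3 \<notin> ?K"
  proof -
    have "c3 \<noteq> c" "c3 \<noteq> c2" using l3 c2v permutation_self_in_orbit[OF v, of c] by metis+
    then have "?g c2 = c3" by (simp add: c3_def transpose_def)
    then show ?thesis using Kgiff[of c2] dis by simp
  qed
  \<comment> \<open>So the pair \<open>c1\<close>, \<open>c2\<close> has distinct outer ends, one
    inside \<open>?K\<close> and one outside; only the directions may have to be corrected.\<close>
  ultimately have c3v: "c3 \<notin> orbit v c1" by blast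
  show ?thesis
  proof (cases "t c1 = t c2")
    case False
    then show ?thesis using t D c3v c31 by (intro exI[of _ t] exI[of _ c1]) (simp add: c2_def c3_def)
  next
    case True
    define t' where "t' x = (if x \<in> ?K then - t x else t x)" for x
    \<comment> \<open>Picks the faces whose sum changes sign. The face of \<open>c\<close> keeps its
      sum, since its two darts inside \<open>?K\<close> have opposite directions.\<close>
    define P where "P x \<longleftrightarrow> x \<in> ?K \<and> x \<notin> orbit ?f c" for x
    note sp = orbit_transpose_split[OF f c2f ne[symmetric]]
    have g0: "osum ?g t c = 0"
    proof -
      have "osum ?g t c = t c + t c1" using og c1c by (simp add: osum_def)
      then show ?thesis using tensD(1)[OF t D(1)] tensD(1)[OF t D(2)] tc by (auto simp: c1_def)
    qed
    have gin: "osum ?g t' x = - osum ?g t x" if "x \<in> ?K" for x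
    proof -
      have "osum ?g t' x = (\<Sum>y\<in>orbit ?g x. - t y)"
        unfolding osum_def by (rule sum.cong) (use Kg[OF that] in \<open>auto simp: t'_def\<close>)
      then show ?thesis by (simp add: osum_def sum_negf)
    qed
    have gout: "osum ?g t' x = osum ?g t x" if "x \<notin> ?K" for x
      unfolding osum_def
    proof (rule sum.cong[OF refl])
      fix y assume "y \<in> orbit ?g x"
      then have "x \<in> orbit ?g y" by (rule orbit_mem_sym[OF g])
      then have "y \<notin> ?K" using Kg that by blast
      then show "t' y = t y" by (simp add: t'_def)
    qed
    have s: "osum ?f t' x = (if P x then - osum ?f t x else osum ?f t x)" for x
    proof (cases "x \<in> orbit ?f c")
      case True
      have "osum ?f t' x = osum ?g t' c + osum ?g t' c2"
        using osum_cong_orbit[OF f True, of t'] osum_split(1)[OF f c2f ne[symmetric], of t'] by simp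
      also have "\<dots> = osum ?g t c + osum ?g t c2" using gin[OF cK] gout[OF dis] g0 by simp
      also have "\<dots> = osum ?f t x"
        using osum_cong_orbit[OF f True, of t] osum_split(1)[OF f c2f ne[symmetric], of t] by simp
      finally show ?thesis using True by (simp add: P_def)
    next
      case False
      then show ?thesis
        using osum_split(2)[OF f c2f ne[symmetric] False, of t] osum_split(2)[OF f c2f ne[symmetric] False, of t']
          gin[of x] gout[of x] by (simp add: P_def)
    qed
    have sub: "gorbit {?w, e} x \<subseteq> gorbit {v, e} x" for x
      using gorbit_transpose_subset[of c2 c ?w e x] face_subset_gorbit[of v e c] c2f
      unfolding transpose_comp_twice by (metis subsetD)
    \<comment> \<open>The faces inside the part have total zero, so a reversed face has a partner
      there of the opposite sum. Uniqueness identifies a conflicting face with that partner, which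
      is reversed as well.\<close>
    have mixed: False if xy: "x \<in> D" "y \<in> D" "y \<in> gorbit {v, e} x" "P x" "\<not> P y"
      "osum ?f t x = - osum ?f t y" "osum ?f t x \<noteq> 0" for x y
    proof -
      let ?S = "?K - orbit ?g c"
      have Sg: "orbit ?g u \<subseteq> ?S" if "u \<in> ?S" for u by (rule closed_Diff_orbit[OF g Kg that])
      have Sf: "orbit ?f u = orbit ?g u" "u \<notin> orbit ?f c" if u: "u \<in> ?S" for u
      proof -
        have "c2 \<notin> orbit ?g u" using Sg[OF u] dis by blast
        then have "u \<notin> orbit ?g c2" using orbit_mem_sym[OF g] by blast
        then show "u \<notin> orbit ?f c" using sp(1) u by blast
        then show "orbit ?f u = orbit ?g u" using sp(3) by simp
      qed
      have "sum t ?K = 0"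
        by (rule antisym_sum_0[of _ e]) (use dartsD[OF d] tensD[OF t] KD in \<open>auto simp: gorbit2_iff\<close>)
      moreover have "sum t ?K = sum t ?S + osum ?g t c"
        unfolding osum_def by (rule sum.subset_diff) (use fin Kg[OF cK] in auto)
      ultimately have S0: "sum t ?S = 0" using g0 by simp
      have "x \<in> ?S" using xy(4) sp(1) by (auto simp: P_def)
      have "\<exists>z\<in>?S. osum ?f t z = - osum ?f t x"
      proof (rule opposite_face[OF f])
        show "finite ?S" using fin by simp
        show "orbit ?f u \<subseteq> ?S" if "u \<in> ?S" for u using Sf(1)[OF that] Sg[OF that] by simp
        show "osum ?f t u \<in> {0, n, -n}" if "u \<in> ?S" for u using tensD(3)[OF t] that KD by blast
      qed fact+
      then obtain z where z: "z \<in> ?S" "osum ?f t z = osum ?f t y" using xy(6) by auto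
      have "z \<in> gorbit {?w, e} x" using z(1) \<open>x \<in> ?S\<close> gorbit_eq by (metis DiffD1)
      then have "z \<in> gorbit {v, e} x" using sub by blast
      then have "y \<in> gorbit {v, e} z" using xy(3) by (auto dest: gorbit_eq)
      moreover have "z \<in> D" using z(1) KD by blast
      ultimately have "y \<in> orbit ?f z" using tens_unique[OF t, of z y] xy(2,6,7) z(2) by simp
      then have "y \<in> ?S" using Sf(1)[OF z(1)] Sg[OF z(1)] by blast
      then show False using xy(5) Sf(2) by (simp add: P_def)
    qed
    have "tens D v e n t'"
    proof (rule tensI)
      fix x assume x: "x \<in> D"
      show "t' x = 1 \<or> t' x = -1" "t' (e x) = - t' x" "osum ?f t' x \<in> {0, n, -n}"
        using tensD[OF t x] s[of x] gorbit2_iff(2)[of e x ?w c] by (auto simp: t'_def)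
    next
      fix x y assume xy: "x \<in> D" "y \<in> D" "y \<in> gorbit {v, e} x" "osum ?f t' x = osum ?f t' y" "osum ?f t' x \<noteq> 0"
      have "P x \<longleftrightarrow> P y"
      proof (rule ccontr)
        assume "\<not> ?thesis"
        then consider "P x" "\<not> P y" | "P y" "\<not> P x" by blast
        then show False
        proof cases
          case 1 then show False using mixed[OF xy(1-3)] s[of x] s[of y] xy by simp
        next
          case 2 then show False using mixed[OF xy(2,1) gorbit_sym[OF xy(3)]] s[of x] s[of y] xy by simp
        qed
      qed
      then show "y \<in> orbit ?f x"
        using tens_unique[OF t xy(1-3)] s[of x] s[of y] xy by (auto split: if_splits)
    qed
    moreover have "t' c1 \<noteq> t' c2" using True c1K dis tensD(1)[OF t D(2)] by (auto simp: t'_def)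
    ultimately show ?thesis using D c3v c31 by (intro exI[of _ t'] exI[of _ c1]) (simp add: c2_def c3_def)
  qed
qed

section \<open>Duplicate edges\<close>

text \<open>
  Removal of the edge \<open>{c1, d}\<close>, where \<open>{c0, c1}\<close> is a face of degree two: up to removal of this
  face, \<open>c0\<close> takes the place of \<open>d\<close>.
\<close>

locale duplicate =
  fixes D D1 :: "'a set" and v e v1 e1 :: "'a \<Rightarrow> 'a" and c0 c1 d :: 'a
  assumes darts: "darts D v e" and darts1: "darts D1 v1 e1" and D1: "D1 = D - {c1, d}"
    and c: "c0 \<in> D" "c1 \<in> D" "e c1 = d" "v (e c0) = c1" "v (e c1) = c0" "c1 \<noteq> c0" "d \<noteq> c0" "d \<noteq> c1"
    and e1: "\<And>x. x \<in> D1 \<Longrightarrow> e1 x = e x"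
    and v1: "\<And>x. x \<in> D1 \<Longrightarrow> v1 x =
      (if v x \<noteq> c1 \<and> v x \<noteq> d then v x else if v x = d \<or> v c1 = d then c0 else v c1)"
begin

abbreviation "f \<equiv> v \<circ> e"
abbreviation "f1 \<equiv> v1 \<circ> e1"

text \<open>Bijection from the darts outside the face \<open>{c0, c1}\<close> to \<open>D1\<close>
  that carries the old face permutation to the new one: \<open>c0\<close> inherits the place of
  \<open>d\<close> in its face.\<close>

definition \<theta> :: "'a \<Rightarrow> 'a" where "\<theta> x = (if x = d then c0 else x)"
text \<open>Retraction of all darts to \<open>D1\<close> that moves the removed edge to the parallel
  edge of \<open>c0\<close>; it transports connectivity and, later, labels.\<close>

definition \<rho> :: "'a \<Rightarrow> 'a" where "\<rho> x = (if x = c1 then e c0 else if x = d then c0 else x)"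

lemma vd: "v d = c0" and ed: "e d = c1" and dD: "d \<in> D"
  using c(2,3,5) dartsD(5,6)[OF darts] by (simp, metis, metis)

lemma ec0: "e c0 \<noteq> c1" "e c0 \<noteq> d" "e c0 \<in> D" "e c0 \<in> D1" "c0 \<in> D1"
  using c dartsD(5,6)[OF darts] D1 by (metis, metis, metis, metis Diff_iff insertE singletonD, blast)

lemma v_inj: "v x = v y \<longleftrightarrow> x = y" by (rule permutation_inj[OF dartsD(2)[OF darts]])

lemma f_perm: "permutation f" "permutation f1"
  using dartsD[OF darts] dartsD[OF darts1] by auto

lemma digon: "orbit f c0 = {c0, c1}" "orbit f c1 = {c0, c1}"
proof -
  have "(f ^^ 2) c0 = c0" using c by (simp add: numeral_2_eq_2)
  then have "orbit f c0 = {(f ^^ m) c0 | m. m < 2}" by (rule orbit_altdef_bounded) simp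
  also have "\<dots> = {c0, c1}" using c by (auto simp: less_2_cases_iff intro: exI[of _ 0] exI[of _ "Suc 0"])
  finally show o: "orbit f c0 = {c0, c1}" .
  have "c1 \<in> orbit f c0" using o by simp
  from orbit_eq_of_mem[OF f_perm(1) this] o show "orbit f c1 = {c0, c1}" by simp
qed

lemma theta_D1: "x \<in> D - {c0, c1} \<Longrightarrow> \<theta> x \<in> D1"
  using ec0 by (auto simp: \<theta>_def D1)

lemma theta_surj: "x \<in> D1 \<Longrightarrow> \<exists>y \<in> D - {c0, c1}. x = \<theta> y"
proof (cases "x = c0")
  case True
  then show ?thesis using c(7,8) dD by (intro bexI[of _ d]) (simp_all add: \<theta>_def)
next
  case False
  assume "x \<in> D1"
  then show ?thesis using False by (intro bexI[of _ x]) (simp_all add: \<theta>_def D1)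
qed

lemma theta_inj: "inj_on \<theta> (D - {c0, c1})"
  by (auto simp: inj_on_def \<theta>_def)

lemma f_subset: "x \<in> D - {c0, c1} \<Longrightarrow> orbit f x \<subseteq> D - {c0, c1}"
  using closed_Diff_orbit[OF f_perm(1), of D x c0] darts_face_subset[OF darts] digon by simp

lemma f1_theta:
  assumes "x \<in> D - {c0, c1}"
  shows "f1 (\<theta> x) = \<theta> (f x)"
proof -
  have fx: "f x \<in> D - {c0, c1}" using f_subset[OF assms] orbit.base[of f x] by blast
  show ?thesis
  proof (cases "x = d")
    case True
    have "v1 (e c0) = (if v c1 = d then c0 else v c1)" using v1[OF ec0(4)] c(4,8) by simp
    then show ?thesis using True ed e1[OF ec0(5)] by (simp add: \<theta>_def)
  next
    case False
    then have "x \<in> D1" using assms by (auto simp: D1)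
    then have "e x \<in> D1" using dartsD(5)[OF darts1, of x] e1 by simp
    then show ?thesis using False fx v1[of "e x"] e1[OF \<open>x \<in> D1\<close>] by (simp add: \<theta>_def)
  qed
qed

lemma orbit_theta: "x \<in> D - {c0, c1} \<Longrightarrow> orbit f1 (\<theta> x) = \<theta> ` orbit f x"
  using f_subset f1_theta by (intro orbit_inverse[symmetric] permutation_self_in_orbit f_perm) blast

lemma orbit_theta_iff:
  assumes "x \<in> D - {c0, c1}" "y \<in> D - {c0, c1}"
  shows "\<theta> y \<in> orbit f1 (\<theta> x) \<longleftrightarrow> y \<in> orbit f x"
  unfolding orbit_theta[OF assms(1)]
  using inj_on_image_mem_iff[OF theta_inj assms(2) f_subset[OF assms(1)]] .

lemma osum_theta:
  assumes "w d = w c0" "x \<in> D - {c0, c1}"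
  shows "osum f1 w (\<theta> x) = osum f w x"
proof -
  have inj: "inj_on \<theta> (orbit f x)" by (rule inj_on_subset[OF theta_inj f_subset[OF assms(2)]])
  have "osum f1 w (\<theta> x) = sum (w \<circ> \<theta>) (orbit f x)"
    unfolding osum_def orbit_theta[OF assms(2)] by (rule sum.reindex[OF inj])
  also have "\<dots> = osum f w x"
    unfolding osum_def by (rule sum.cong) (use assms(1) in \<open>auto simp: \<theta>_def\<close>)
  finally show ?thesis .
qed

lemma v1_gorbit: "x \<in> D1 \<Longrightarrow> v1 x \<in> gorbit {v, e} y \<longleftrightarrow> x \<in> gorbit {v, e} y"
  using gorbit2_iff(1)[of v x e y] gorbit2_iff(1)[of v "v x" e y] gorbit2_iff(1)[of v "v (v x)" e y] vd v1[of x]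
  by (auto split: if_splits)

lemma gorbit_up:
  assumes "x \<in> D1" "y \<in> gorbit {v1, e1} x"
  shows "y \<in> gorbit {v, e} x"
proof -
  from assms(2) have "y \<in> D1 \<and> y \<in> gorbit {v, e} x"
  proof (induct rule: gorbit2_induct)
    case base then show ?case using assms by simp
  next
    case (v u)
    show ?case using dartsD(4)[OF darts1, of u] v1_gorbit[of u x] by blast
  next
    case (e u)
    show ?case using dartsD(5)[OF darts1, of u] e1[of u] gorbit2_iff(2)[of e u v x] by metis
  qed
  then show ?thesis by simp
qed

lemma gorbit_down:
  assumes "x \<in> D" "y \<in> gorbit {v, e} x"
  shows "\<rho> y \<in> gorbit {v1, e1} (\<rho> x)"
proof -
  let ?K = "gorbit {v1, e1} (\<rho> x)"
  from assms(2) have "y \<in> D \<and> \<rho> y \<in> ?K"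
  proof (induct rule: gorbit2_induct)
    case base then show ?case using assms by simp
  next
    case (v u)
    have "\<rho> (v u) \<in> ?K \<longleftrightarrow> \<rho> u \<in> ?K" if u: "u \<in> D"
    proof -
      note step = gorbit2_iff(1)[of v1 _ e1 "\<rho> x"]
      consider "u = c1" | "u = d" | "u \<in> D1" using u D1 by blast
      then show ?thesis
      proof cases
        case 1
        have "v c1 \<noteq> c1" using v_inj[of c1 "e c0"] c(4) ec0(1) by metis
        then have "v1 (e c0) = \<rho> (v c1)" using v1[OF ec0(4)] c(4,8) by (simp add: \<rho>_def)
        then show ?thesis using step[of "e c0"] 1 by (simp add: \<rho>_def)
      next
        case 2
        then show ?thesis using vd c by (simp add: \<rho>_def)
      next
        case 3
        then have ru: "\<rho> u = u" by (auto simp: \<rho>_def D1)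
        show ?thesis
        proof (cases "v u = c1")
          case True
          then have "u = e c0" using v_inj[of u "e c0"] c by simp
          then show ?thesis using True ru by (simp add: \<rho>_def)
        next
          case False
          then have "v1 u = \<rho> (v u)" using v1[OF 3] by (simp add: \<rho>_def)
          then show ?thesis using step[of u] ru by simp
        qed
      qed
    qed
    then show ?case using dartsD(4)[OF darts, of u] by blast
  next
    case (e u)
    have "\<rho> (e u) \<in> ?K \<longleftrightarrow> \<rho> u \<in> ?K" if u: "u \<in> D"
    proof -
      note step = gorbit2_iff(2)[of e1 _ v1 "\<rho> x"]
      consider "u = c1" | "u = d" | "u \<in> D1" using u D1 by blast
      then show ?thesis
      proof cases
        case 1 then show ?thesis using step[of c0] e1[OF ec0(5)] c by (simp add: \<rho>_def)
      next
        case 2 then show ?thesis using step[of c0] e1[OF ec0(5)] c ed by (simp add: \<rho>_def)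
      next
        case 3
        then have "e u \<in> D1" using dartsD(5)[OF darts1, of u] e1 by simp
        then have "\<rho> u = u" "\<rho> (e u) = e u" using 3 by (auto simp: \<rho>_def D1)
        then show ?thesis using step[of u] e1[OF 3] by simp
      qed
    qed
    then show ?case using dartsD(5)[OF darts, of u] by blast
  qed
  then show ?thesis by simp
qed

lemma theta_gorbit: "\<theta> x \<in> gorbit {v, e} x"
  using gorbit2_iff(1)[of v d e d] vd by (simp add: \<theta>_def)

lemma gorbit_theta_iff:
  assumes "x \<in> D - {c0, c1}" "y \<in> D - {c0, c1}"
  shows "\<theta> y \<in> gorbit {v1, e1} (\<theta> x) \<longleftrightarrow> y \<in> gorbit {v, e} x"
proof
  assume "\<theta> y \<in> gorbit {v1, e1} (\<theta> x)"
  then have "\<theta> y \<in> gorbit {v, e} (\<theta> x)" by (rule gorbit_up[OF theta_D1[OF assms(1)]])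
  then show "y \<in> gorbit {v, e} x" using theta_gorbit gorbit_trans gorbit_sym by metis
next
  assume "y \<in> gorbit {v, e} x"
  then have "\<rho> y \<in> gorbit {v1, e1} (\<rho> x)" using gorbit_down assms by blast
  then show "\<theta> y \<in> gorbit {v1, e1} (\<theta> x)" using assms by (simp add: \<rho>_def \<theta>_def)
qed

text \<open>The removed face has sum zero, and the other faces correspond under
  \<open>\<theta>\<close> with equal sums, because \<open>t\<close> does not distinguish
  \<open>d\<close> and \<open>c0\<close>.\<close>

lemma tens_iff:
  fixes t :: "'a \<Rightarrow> int"
  assumes t: "t c0 = t d" "t c1 = - t d"
  shows "tens D v e n t \<longleftrightarrow> tens D1 v1 e1 n t"
proof
  assume T: "tens D v e n t"
  show "tens D1 v1 e1 n t"
  proof (rule tensI)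
    fix x assume x: "x \<in> D1"
    then have xD: "x \<in> D" by (simp add: D1)
    show "t x = 1 \<or> t x = -1" "t (e1 x) = - t x" using tensD[OF T xD] e1[OF x] by auto
    obtain y where y: "y \<in> D - {c0, c1}" "x = \<theta> y" using theta_surj[OF x] by blast
    then show "osum f1 t x \<in> {0, n, -n}" using osum_theta[of t y, OF t(1)[symmetric]] tensD(3)[OF T, of y] by simp
  next
    fix x y assume xy: "x \<in> D1" "y \<in> D1" "y \<in> gorbit {v1, e1} x" "osum f1 t x = osum f1 t y" "osum f1 t x \<noteq> 0"
    obtain x' y' where *: "x' \<in> D - {c0, c1}" "x = \<theta> x'" "y' \<in> D - {c0, c1}" "y = \<theta> y'"
      using theta_surj xy by metis
    then have "y' \<in> orbit f x'"
      using tens_unique[OF T, of x' y'] xy osum_theta[of t, OF t(1)[symmetric]] gorbit_theta_iff by auto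
    then show "y \<in> orbit f1 x" using orbit_theta_iff * by simp
  qed
next
  assume T: "tens D1 v1 e1 n t"
  have dig: "osum f t x = 0" if "x \<in> {c0, c1}" for x
  proof -
    have "sum t {c0, c1} = 0" using c(6) t by simp
    moreover have "orbit f x = {c0, c1}" using that digon by blast
    ultimately show ?thesis by (simp only: osum_def)
  qed
  show "tens D v e n t"
  proof (rule tensI)
    fix x assume x: "x \<in> D"
    have c0': "(t c0 = 1 \<or> t c0 = -1) \<and> t (e c0) = - t c0" using tensD[OF T ec0(5)] e1[OF ec0(5)] by auto
    have "(t x = 1 \<or> t x = -1) \<and> t (e x) = - t x"
    proof (cases "x \<in> D1")
      case True then show ?thesis using tensD[OF T True] e1[OF True] by auto
    next
      case False
      then have "x = c1 \<or> x = d" using x D1 by blast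
      then show ?thesis using c0' t c(3) ed by (elim disjE) (simp_all, blast)
    qed
    then show "t x = 1 \<or> t x = -1" "t (e x) = - t x" by auto
    show "osum f t x \<in> {0, n, -n}"
    proof (cases "x \<in> {c0, c1}")
      case True then show ?thesis using dig by simp
    next
      case False
      then show ?thesis using osum_theta[of t x, OF t(1)[symmetric]] tensD(3)[OF T theta_D1[of x]] x by auto
    qed
  next
    fix x y assume xy: "x \<in> D" "y \<in> D" "y \<in> gorbit {v, e} x" "osum f t x = osum f t y" "osum f t x \<noteq> 0"
    then have *: "x \<in> D - {c0, c1}" "y \<in> D - {c0, c1}" using dig[of x] dig[of y] by auto
    then have "\<theta> y \<in> orbit f1 (\<theta> x)"
      using tens_unique[OF T, of "\<theta> x" "\<theta> y"] theta_D1 xy osum_theta[of t, OF t(1)[symmetric]] gorbit_theta_iff by simp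
    then show "y \<in> orbit f x" using orbit_theta_iff * by simp
  qed
qed

text \<open>A function with vanishing face sums extends to the removed edge by copying the parallel
  edge, which gives the face of degree two sum zero; the potential on all darts then
  restricts.\<close>

lemma planar_remove:
  assumes "planar D v e"
  shows "planar D1 v1 e1"
  unfolding planar_def
proof (intro allI impI)
  fix w1 :: "'a \<Rightarrow> real"
  assume w1: "\<forall>x\<in>D1. w1 (e1 x) = - w1 x" and s1: "\<forall>x\<in>D1. osum f1 w1 x = 0"
  define w where "w x = (if x = c1 then - w1 c0 else if x = d then w1 c0 else w1 x)" for x
  have wD1: "w x = w1 x" if "x \<in> D1" for x using that by (simp add: w_def D1)
  have a: "w (e x) = - w x" if x: "x \<in> D" for x
  proof (cases "x \<in> D1")
    case True
    then have "e x \<in> D1" using dartsD(5)[OF darts1, of x] e1 by simp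
    then show ?thesis using w1[rule_format, OF True] wD1[OF True] wD1[of "e x"] e1[OF True] by simp
  next
    case False
    then have "x = c1 \<or> x = d" using x D1 by blast
    then show ?thesis using c(3,6-8) ed by (elim disjE) (simp_all add: w_def)
  qed
  have s: "osum f w x = 0" if x: "x \<in> D" for x
  proof (cases "x \<in> {c0, c1}")
    case True
    have "sum w {c0, c1} = 0" using c(6-8) by (simp add: w_def)
    moreover have "orbit f x = {c0, c1}" using True digon by blast
    ultimately show ?thesis by (simp only: osum_def)
  next
    case False
    then have x: "x \<in> D - {c0, c1}" using x by simp
    have "osum f w x = osum f1 w (\<theta> x)" by (rule osum_theta[symmetric, OF _ x]) (use c(6-8) in \<open>simp add: w_def\<close>)
    also have "\<dots> = osum f1 w1 (\<theta> x)"
      unfolding osum_def by (rule sum.cong[OF refl]) (use darts_face_subset[OF darts1 theta_D1[OF x]] wD1 in blast)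
    finally show ?thesis using s1 theta_D1[OF x] by simp
  qed
  obtain p where p: "\<forall>x\<in>D. p (v x) = p x \<and> w x = p (e x) - p x"
    using assms a s unfolding planar_def by blast
  have "p (v1 x) = p x \<and> w1 x = p (e1 x) - p x" if x: "x \<in> D1" for x
  proof
    have xD: "x \<in> D" "v x \<in> D" using x dartsD(4)[OF darts] by (auto simp: D1)
    show "w1 x = p (e1 x) - p x" using p xD wD1[OF x] e1[OF x] by simp
    have "p (v d) = p d" "p (v c1) = p c1" "p (v x) = p x" using p dD c(2) xD by auto
    then show "p (v1 x) = p x" using v1[OF x] vd by (auto split: if_splits)
  qed
  then show "\<exists>p. \<forall>x\<in>D1. p (v1 x) = p x \<and> w1 x = p (e1 x) - p x" by blast
qed

end

section \<open>Augmenting a tension\<close>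

text \<open>Needed because the vertex permutation of a glued map is the old one composed with a
  transposition only on the darts of one orientation class; elsewhere the two functions may
  differ.\<close>

lemma tens_cong:
  assumes d: "darts D v e" and d': "darts D v' e'"
    and eq: "\<And>x. x \<in> D \<Longrightarrow> v x = v' x" "\<And>x. x \<in> D \<Longrightarrow> e x = e' x" "\<And>x. x \<in> D \<Longrightarrow> t x = t' x"
    and T: "tens D v e n t"
  shows "tens D v' e' n t'"
proof -
  have o: "orbit (v' \<circ> e') x = orbit (v \<circ> e) x" if "x \<in> D" for x
  proof (rule orbit_cong)
    show "x \<in> orbit (v \<circ> e) x" by (rule permutation_self_in_orbit[OF dartsD(7)[OF d]])
    fix y assume "y \<in> orbit (v \<circ> e) x"
    then have "y \<in> D" using darts_face_subset[OF d that] by blast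
    then show "(v' \<circ> e') y = (v \<circ> e) y" using eq(1)[of "e y"] eq(2)[of y] dartsD(5)[OF d, of y] by simp
  qed
  have s: "osum (v' \<circ> e') t' x = osum (v \<circ> e) t x" if "x \<in> D" for x
    unfolding osum_def o[OF that]
    by (rule sum.cong) (use darts_face_subset[OF d that] eq in auto)
  have G: "y \<in> gorbit {v, e} x" if x: "x \<in> D" and y: "y \<in> gorbit {v', e'} x" for x y
  proof -
    from y have "y \<in> D \<and> y \<in> gorbit {v, e} x"
    proof (induct rule: gorbit2_induct)
      case base then show ?case using x by simp
    next
      case (v u)
      show ?case using dartsD(4)[OF d', of u] eq(1)[of u] gorbit2_iff(1)[of v u e x] by metis
    next
      case (e u)
      show ?case using dartsD(5)[OF d', of u] eq(2)[of u] gorbit2_iff(2)[of e u v x] by metis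
    qed
    then show ?thesis by simp
  qed
  show ?thesis
  proof (rule tensI)
    fix x assume x: "x \<in> D"
    then have "e' x \<in> D" using dartsD(5)[OF d'] by simp
    then show "t' x = 1 \<or> t' x = -1" "t' (e' x) = - t' x" "osum (v' \<circ> e') t' x \<in> {0, n, -n}"
      using tensD[OF T x] eq x s[OF x] by auto
  next
    fix x y assume "x \<in> D" "y \<in> D" "y \<in> gorbit {v', e'} x" "osum (v' \<circ> e') t' x = osum (v' \<circ> e') t' y"
      "osum (v' \<circ> e') t' x \<noteq> 0"
    then show "y \<in> orbit (v' \<circ> e') x" using tens_unique[OF T, of x y] G s o by simp
  qed
qed

lemma planar_cong:
  assumes d: "darts D v e" and d': "darts D v' e'"
    and eq: "\<And>x. x \<in> D \<Longrightarrow> v x = v' x" "\<And>x. x \<in> D \<Longrightarrow> e x = e' x"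
    and T: "planar D v e"
  shows "planar D v' e'"
  unfolding planar_def
proof (intro allI impI)
  fix w :: "'a \<Rightarrow> real"
  assume w: "\<forall>x\<in>D. w (e' x) = - w x" "\<forall>x\<in>D. osum (v' \<circ> e') w x = 0"
  have o: "orbit (v' \<circ> e') x = orbit (v \<circ> e) x" if "x \<in> D" for x
  proof (rule orbit_cong)
    show "x \<in> orbit (v \<circ> e) x" by (rule permutation_self_in_orbit[OF dartsD(7)[OF d]])
    fix y assume "y \<in> orbit (v \<circ> e) x"
    then have "y \<in> D" using darts_face_subset[OF d that] by blast
    then show "(v' \<circ> e') y = (v \<circ> e) y" using eq(1)[of "e y"] eq(2)[of y] dartsD(5)[OF d, of y] by simp
  qed
  have "\<forall>x\<in>D. w (e x) = - w x" "\<forall>x\<in>D. osum (v \<circ> e) w x = 0"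
    using w eq(2) o by (simp_all add: osum_def)
  then obtain p where "\<forall>x\<in>D. p (v x) = p x \<and> w x = p (e x) - p x" using T unfolding planar_def by blast
  then show "\<exists>p. \<forall>x\<in>D. p (v' x) = p x \<and> w x = p (e' x) - p x" using eq by auto
qed

text \<open>\<open>X\<close> consists of the darts crossed by the dual path, one for each step;
  their excess over the reversed darts is that of a unit flow from \<open>A\<close> to
  \<open>B\<close>. Distinctness of the faces keeps the new dart out of \<open>X\<close>.\<close>

lemma path_flow:
  assumes d: "darts D v e"
    and r: "r = (\<lambda>A B. \<exists>x\<in>D. A = orbit (v \<circ> e) x \<and> B = orbit (v \<circ> e) (e x) \<and> t x = (-1 :: int))"
    and p: "rtrancl_path r A xs B" and dis: "distinct (A # xs)"
  shows "\<exists>X\<subseteq>D. (\<forall>x\<in>X. t x = -1 \<and> orbit (v \<circ> e) x \<in> set (A # xs)) \<and>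
    (\<forall>C\<in>orbit (v \<circ> e) ` D. int (card (X \<inter> C)) - int (card (e ` X \<inter> C)) = of_bool (C = A) - of_bool (C = B))"
  using p dis
proof induct
  case (base A)
  then show ?case by (intro exI[of _ "{}"]) simp
next
  case (step A A' xs B)
  let ?f = "v \<circ> e"
  have f: "permutation ?f" by (rule dartsD(7)[OF d])
  have "distinct (A' # xs)" using step(4) by simp
  from step(3)[OF this] obtain X where X: "X \<subseteq> D" "\<forall>x\<in>X. t x = -1 \<and> orbit ?f x \<in> set (A' # xs)"
    "\<forall>C\<in>orbit ?f ` D. int (card (X \<inter> C)) - int (card (e ` X \<inter> C)) = of_bool (C = A') - of_bool (C = B)"
    by blast
  from step(1) obtain x where x: "x \<in> D" "A = orbit ?f x" "A' = orbit ?f (e x)" "t x = -1"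
    unfolding r by blast
  have fin: "finite X" using X(1) dartsD(1)[OF d] finite_subset by blast
  have xX: "x \<notin> X" using X(2) x(2) step(4) by auto
  have exX: "e x \<notin> e ` X"
  proof
    assume "e x \<in> e ` X"
    then obtain y where "y \<in> X" "e x = e y" by blast
    then have "x = y" using dartsD(6)[OF d] by metis
    then show False using xX \<open>y \<in> X\<close> by simp
  qed
  have mem: "y \<in> C \<longleftrightarrow> C = orbit ?f y" if "C \<in> orbit ?f ` D" for y C
    using that orbit_eq_of_mem[OF f] permutation_self_in_orbit[OF f] by (metis imageE)
  have "int (card (insert x X \<inter> C)) - int (card (e ` insert x X \<inter> C)) = of_bool (C = A) - of_bool (C = B)"
    if C: "C \<in> orbit ?f ` D" for C
  proof -
    have "card (insert x X \<inter> C) = card (X \<inter> C) + of_bool (C = A)"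
      using mem[OF C, of x] fin xX x(2) by (simp add: Int_insert_left)
    moreover have "card (e ` insert x X \<inter> C) = card (e ` X \<inter> C) + of_bool (C = A')"
      using mem[OF C, of "e x"] fin exX x(3) by (simp add: Int_insert_left)
    moreover have "int (card (X \<inter> C)) - int (card (e ` X \<inter> C)) = of_bool (C = A') - of_bool (C = B)"
      using X(3) C by blast
    ultimately show ?thesis by (simp only: of_nat_add of_nat_of_bool)
  qed
  moreover have "insert x X \<subseteq> D" using X(1) x(1) by simp
  moreover have "\<forall>y\<in>insert x X. t y = -1 \<and> orbit ?f y \<in> set (A # A' # xs)" using X(2) x(2,4) by simp
  ultimately show ?case by blast
qed

text \<open>
  Ford--Fulkerson in the dual map: either there is a dual path, along backward darts, from the face
  winding around positively to the one winding around negatively, or the faces \<open>R\<close> reachable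
  by such paths are bounded by \<open>n\<close> edges.
\<close>

lemma augment_connected:
  assumes d: "darts K v e" and T: "tens K v e n t" and n: "n > 0"
    and conn: "\<And>x y. x \<in> K \<Longrightarrow> y \<in> K \<Longrightarrow> y \<in> gorbit {v, e} x"
  shows "(\<exists>t'. tens K v e (n + 2) t') \<or>
    (\<exists>R\<subseteq>K. (\<forall>x\<in>R. v (e x) \<in> R) \<and> int (card {x \<in> R. e x \<notin> R}) = n \<and> (\<forall>x\<in>R. e x \<notin> R \<longrightarrow> t x = 1))"
proof (cases "\<exists>x\<in>K. osum (v \<circ> e) t x \<noteq> 0")
  case False
  then have "tens K v e (n + 2) t" using tensD[OF T] by (intro tensI) auto
  then show ?thesis by blast
next
  case True
  let ?f = "v \<circ> e"
  have f: "permutation ?f" by (rule dartsD(7)[OF d])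
  have finK: "finite K" by (rule dartsD(1)[OF d])
  have Kf: "orbit ?f x \<subseteq> K" if "x \<in> K" for x by (rule darts_face_subset[OF d that])
  have sK: "sum t K = 0"
    by (rule antisym_sum_0[of _ e]) (use dartsD[OF d] tensD[OF T] in auto)
  from True obtain x1 where x1: "x1 \<in> K" "osum ?f t x1 \<noteq> 0" by blast
  have "\<exists>y\<in>K. osum ?f t y = - osum ?f t x1"
    using opposite_face[OF f finK Kf tensD(3)[OF T] sK x1] .
  then obtain x0 where x0: "x0 \<in> K" "osum ?f t x0 = n" using x1 tensD(3)[OF T x1(1)] by auto
  have uniq: "orbit ?f y = orbit ?f x" if "x \<in> K" "y \<in> K" "osum ?f t x = osum ?f t y" "osum ?f t x \<noteq> 0" for x y
    using tens_unique[OF T that(1,2) conn that(3,4)] that orbit_eq_of_mem[OF f] by metis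
  define r where "r = (\<lambda>A B. \<exists>x\<in>K. A = orbit ?f x \<and> B = orbit ?f (e x) \<and> t x = -1)"
  define P where "P = orbit ?f x0"
  show ?thesis
  proof (cases "\<exists>y\<in>K. r\<^sup>*\<^sup>* P (orbit ?f y) \<and> osum ?f t y = - n")
    case True
    then obtain y where y: "y \<in> K" "r\<^sup>*\<^sup>* P (orbit ?f y)" "osum ?f t y = - n" by blast
    define Q where "Q = orbit ?f y"
    obtain xs where "rtrancl_path r P xs Q" "distinct (P # xs)"
      using y(2) rtranclp_eq_rtrancl_path rtrancl_path_distinct unfolding Q_def by metis
    from path_flow[OF d r_def this] obtain X where X: "X \<subseteq> K" "\<forall>x\<in>X. t x = -1"
      "\<forall>C\<in>orbit ?f ` K. int (card (X \<inter> C)) - int (card (e ` X \<inter> C)) = of_bool (C = P) - of_bool (C = Q)" by blast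
    have finX: "finite X" using X(1) finK finite_subset by blast
    have eX: "t x = 1" if "x \<in> e ` X" for x using that X tensD(2)[OF T] by fastforce
    have disj: "x \<notin> e ` X" if "x \<in> X" for x using that X(2) eX by force
    \<comment> \<open>Each crossed edge changes direction; since \<open>t\<close> is -1 on
      \<open>X\<close>, the face \<open>P\<close> gains two units and \<open>Q\<close> loses
      two.\<close>
    define t' where "t' x = t x + 2 * of_bool (x \<in> X) - 2 * of_bool (x \<in> e ` X)" for x
    have PQ: "P \<noteq> Q" using x0 y n osum_def P_def Q_def by (metis neg_0_less_iff_less order_less_asym)
    have s: "osum ?f t' x = osum ?f t x + 2 * (of_bool (orbit ?f x = P) - of_bool (orbit ?f x = Q))" if "x \<in> K" for x
    proof -
      have fin: "finite (orbit ?f x)" by (rule finite_orbit_permutation[OF f])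
      have "osum ?f t' x = osum ?f t x + 2 * (\<Sum>z\<in>orbit ?f x. of_bool (z \<in> X)) - 2 * (\<Sum>z\<in>orbit ?f x. of_bool (z \<in> e ` X))"
        unfolding osum_def t'_def sum_subtractf sum.distrib sum_distrib_left ..
      also have "(\<Sum>z\<in>orbit ?f x. of_bool (z \<in> X)) = int (card (X \<inter> orbit ?f x))"
        using fin by (simp add: of_bool_def sum.If_cases Int_commute)
      also have "(\<Sum>z\<in>orbit ?f x. of_bool (z \<in> e ` X)) = int (card (e ` X \<inter> orbit ?f x))"
        using fin by (simp add: of_bool_def sum.If_cases Int_commute)
      finally have 1: "osum ?f t' x = osum ?f t x + 2 * int (card (X \<inter> orbit ?f x)) - 2 * int (card (e ` X \<inter> orbit ?f x))" .
      have 2: "int (card (X \<inter> orbit ?f x)) - int (card (e ` X \<inter> orbit ?f x)) = of_bool (orbit ?f x = P) - of_bool (orbit ?f x = Q)"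
        using X(3) that by blast
      show ?thesis unfolding 1 2[symmetric] by (simp only: right_diff_distrib add_diff_eq)
    qed
    have eXX: "e x \<in> e ` X \<longleftrightarrow> x \<in> X" "e x \<in> X \<longleftrightarrow> x \<in> e ` X" for x
      using dartsD(6)[OF d] by (metis imageE image_eqI)+
    have s0: "osum ?f t x = 0" if "x \<in> K" "orbit ?f x \<noteq> P" "orbit ?f x \<noteq> Q" for x
      using tensD(3)[OF T that(1)] uniq[OF that(1) x0(1)] uniq[OF that(1) y(1)] that(2,3) x0(2) y(3) n
      by (auto simp: P_def Q_def)
    have sP: "osum ?f t x = n" if "orbit ?f x = P" for x using that x0(2) by (simp add: P_def osum_def)
    have sQ: "osum ?f t x = - n" if "orbit ?f x = Q" for x using that y(3) by (simp add: Q_def osum_def)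
    have s': "osum ?f t' x = (if orbit ?f x = P then n + 2 else if orbit ?f x = Q then - (n + 2) else 0)" if "x \<in> K" for x
      using s[OF that] s0[OF that] sP[of x] sQ[of x] PQ by auto
    have "tens K v e (n + 2) t'"
    proof (rule tensI)
      fix x assume x: "x \<in> K"
      show "t' x = 1 \<or> t' x = -1" using tensD(1)[OF T x] X(2) eX disj by (auto simp: t'_def)
      show "t' (e x) = - t' x" using tensD(2)[OF T x] by (simp add: t'_def eXX)
      show "osum ?f t' x \<in> {0, n + 2, - (n + 2)}" using s'[OF x] by simp
    next
      fix x z assume xz: "x \<in> K" "z \<in> K" "osum ?f t' x = osum ?f t' z" "osum ?f t' x \<noteq> 0"
      then have "orbit ?f z = orbit ?f x" using s'[OF xz(1)] s'[OF xz(2)] n by (auto split: if_splits)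
      then show "z \<in> orbit ?f x" using permutation_self_in_orbit[OF f, of z] by simp
    qed
    then show ?thesis by blast
  next
    case False
    define R where "R = {x \<in> K. r\<^sup>*\<^sup>* P (orbit ?f x)}"
    have RK: "R \<subseteq> K" by (auto simp: R_def)
    have fin: "finite R" using RK finK finite_subset by blast
    have Rf: "orbit ?f x \<subseteq> R" if "x \<in> R" for x
      using that Kf orbit_eq_of_mem[OF f, of _ x] by (fastforce simp: R_def)
    have bwd: "e x \<in> R" if "x \<in> R" "t x = -1" for x
    proof -
      have "r (orbit ?f x) (orbit ?f (e x))" using that unfolding r_def R_def by blast
      then show ?thesis using that dartsD(5)[OF d] unfolding R_def by (metis (no_types, lifting) mem_Collect_eq rtranclp.rtrancl_into_rtrancl)
    qed
    have P: "P \<subseteq> R" using Rf[of x0] x0(1) by (simp add: P_def R_def)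
    \<comment> \<open>No face of sum \<open>- n\<close> is reachable, and \<open>P\<close> is the
      only face of sum \<open>n\<close>.\<close>
    have "sum t (R - P) = 0"
    proof (rule sum_osum_0[OF f])
      show "finite (R - P)" using fin by simp
      show "orbit ?f x \<subseteq> R - P" if "x \<in> R - P" for x
        using closed_Diff_orbit[OF f Rf] that unfolding P_def by blast
      show "osum ?f t x = 0" if "x \<in> R - P" for x
      proof -
        have x: "x \<in> K" "r\<^sup>*\<^sup>* P (orbit ?f x)" "x \<notin> P" using that by (auto simp: R_def)
        then have "osum ?f t x \<noteq> - n" using False by blast
        moreover have "osum ?f t x \<noteq> n"
        proof
          assume "osum ?f t x = n"
          then have "orbit ?f x = P" using uniq[OF x0(1) x(1)] x0(2) n by (simp add: P_def)
          then show False using x(3) permutation_self_in_orbit[OF f] by blast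
        qed
        ultimately show ?thesis using tensD(3)[OF T x(1)] by auto
      qed
    qed
    moreover have "sum t R = sum t (R - P) + sum t P" by (rule sum.subset_diff[OF P fin])
    ultimately have sR: "sum t R = n" using x0(2) by (simp add: osum_def P_def)
    have pos: "t x = 1" if "x \<in> R" "e x \<notin> R" for x
      using bwd[OF that(1)] that RK tensD(1)[OF T, of x] by auto
    \<comment> \<open>Edges with both darts in \<open>R\<close> cancel, so the flow \<open>n\<close>
      out of \<open>R\<close> is carried by its boundary darts, all of which are directed
      forward.\<close>
    have "sum t (R - {x \<in> R. e x \<notin> R}) = 0"
      by (rule antisym_sum_0[of _ e]) (use dartsD(6)[OF d] tensD(2)[OF T] RK in auto)
    moreover have "sum t R = sum t (R - {x \<in> R. e x \<notin> R}) + sum t {x \<in> R. e x \<notin> R}"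
      by (rule sum.subset_diff) (use fin in auto)
    moreover have "sum t {x \<in> R. e x \<notin> R} = int (card {x \<in> R. e x \<notin> R})"
      using pos by simp
    ultimately have "int (card {x \<in> R. e x \<notin> R}) = n" using sR by simp
    moreover have "\<forall>x\<in>R. v (e x) \<in> R" using Rf orbit.base[of ?f] by fastforce
    ultimately show ?thesis using RK pos by blast
  qed
qed

text \<open>A cut in one component is enough for the second alternative; without cuts each component
  is augmented separately.\<close>

lemma augment:
  assumes d: "darts D v e" and T: "tens D v e n t" and n: "n > 0"
  shows "(\<exists>t'. tens D v e (n + 2) t') \<or>
    (\<exists>R\<subseteq>D. (\<forall>x\<in>R. v (e x) \<in> R) \<and> int (card {x \<in> R. e x \<notin> R}) = n \<and> (\<forall>x\<in>R. e x \<notin> R \<longrightarrow> t x = 1))"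
proof (rule disjCI)
  let ?G = "gorbit {v, e}"
  assume no: "\<not> (\<exists>R\<subseteq>D. (\<forall>x\<in>R. v (e x) \<in> R) \<and> int (card {x \<in> R. e x \<notin> R}) = n \<and> (\<forall>x\<in>R. e x \<notin> R \<longrightarrow> t x = 1))"
  have dK: "darts (?G x) v e" "?G x \<subseteq> D" if "x \<in> D" for x
  proof -
    show "?G x \<subseteq> D" by (rule darts_gorbit_subset[OF d that])
    then show "darts (?G x) v e" using d finite_subset unfolding darts_def by (metis gorbit2_iff)
  qed
  have "\<exists>t'. tens (?G x) v e (n + 2) t'" if x: "x \<in> D" for x
  proof -
    have "z \<in> ?G y" if "y \<in> ?G x" "z \<in> ?G x" for y z using that gorbit_eq by metis
    from augment_connected[OF dK(1)[OF x] tens_mono[OF T dK(2)[OF x]] n this]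
    show ?thesis
    proof
      assume "\<exists>R\<subseteq>?G x. (\<forall>y\<in>R. v (e y) \<in> R) \<and> int (card {y \<in> R. e y \<notin> R}) = n \<and> (\<forall>y\<in>R. e y \<notin> R \<longrightarrow> t y = 1)"
      then obtain R where R: "R \<subseteq> ?G x" "(\<forall>y\<in>R. v (e y) \<in> R) \<and> int (card {y \<in> R. e y \<notin> R}) = n \<and> (\<forall>y\<in>R. e y \<notin> R \<longrightarrow> t y = 1)"
        by blast
      have "R \<subseteq> D" using R(1) dK(2)[OF x] by (rule subset_trans)
      then show ?thesis using no R(2) by blast
    qed
  qed
  \<comment> \<open>The new values are chosen per component and not per dart, so that all darts of a
    component use the same choice.\<close>
  then have "\<forall>K\<in>?G ` D. \<exists>t'. tens K v e (n + 2) t'" by blast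
  then obtain tt where tt: "\<forall>K\<in>?G ` D. tens K v e (n + 2) (tt K)" by metis
  have "tens D v e (n + 2) (\<lambda>x. tt (?G x) x)"
  proof (rule tens_local)
    fix x assume x: "x \<in> D"
    show "tens (?G x) v e (n + 2) (\<lambda>x. tt (?G x) x)"
    proof (rule tens_cong[OF dK(1)[OF x] dK(1)[OF x]])
      show "tens (?G x) v e (n + 2) (tt (?G x))" using tt x by blast
      show "tt (?G x) y = tt (?G y) y" if "y \<in> ?G x" for y using gorbit_eq[OF that] by simp
    qed auto
  qed
  then show "\<exists>t'. tens D v e (n + 2) t'" by blast
qed

section \<open>Oriented maps\<close>

text \<open>Unlike \<open>alpha0\<close>, this reversal of a dart stays in the orientation class,
  and the face cycles are then those of \<open>vperm M \<circ> erev M\<close>.\<close>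

definition erev :: "'a premap \<Rightarrow> 'a \<Rightarrow> 'a" where
  "erev M = alpha0 M \<circ> alpha2 M"

lemma fpf_involution_onD:
  assumes "fpf_involution_on C f"
  shows "f x \<in> C \<longleftrightarrow> x \<in> C" "f (f x) = x" "x \<in> C \<Longrightarrow> f x \<noteq> x" "x \<notin> C \<Longrightarrow> f x = x"
proof -
  have f: "f permutes C" "\<And>c. c \<in> C \<Longrightarrow> f (f c) = c \<and> f c \<noteq> c"
    using assms by (auto simp: fpf_involution_on_def)
  show "f x \<in> C \<longleftrightarrow> x \<in> C" by (rule permutes_in_image[OF f(1)])
  show out: "x \<notin> C \<Longrightarrow> f x = x" by (rule permutes_not_in[OF f(1)])
  show "f (f x) = x" using f(2) out by (cases "x \<in> C") auto
  show "x \<in> C \<Longrightarrow> f x \<noteq> x" using f(2) by blast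
qed

lemma is_mapD:
  assumes "is_map M"
  shows "finite (crosses M)"
    "alpha0 M x \<in> crosses M \<longleftrightarrow> x \<in> crosses M" "alpha1 M x \<in> crosses M \<longleftrightarrow> x \<in> crosses M"
    "alpha2 M x \<in> crosses M \<longleftrightarrow> x \<in> crosses M"
    "alpha0 M (alpha0 M x) = x" "alpha1 M (alpha1 M x) = x" "alpha2 M (alpha2 M x) = x"
    "alpha0 M (alpha2 M x) = alpha2 M (alpha0 M x)"
    "permutation (alpha0 M)" "permutation (alpha1 M)" "permutation (alpha2 M)"
    "x \<in> crosses M \<Longrightarrow> alpha0 M x \<noteq> x" "x \<in> crosses M \<Longrightarrow> alpha1 M x \<noteq> x" "x \<in> crosses M \<Longrightarrow> alpha2 M x \<noteq> x"
    "x \<notin> crosses M \<Longrightarrow> alpha0 M x = x" "x \<notin> crosses M \<Longrightarrow> alpha1 M x = x" "x \<notin> crosses M \<Longrightarrow> alpha2 M x = x"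
proof -
  have c: "fpf_involution_on (crosses M) (alpha0 M)" "fpf_involution_on (crosses M) (alpha1 M)"
    "fpf_involution_on (crosses M) (alpha2 M)" and fin: "finite (crosses M)"
    and comm: "alpha0 M \<circ> alpha2 M = alpha2 M \<circ> alpha0 M"
    using assms by (auto simp: is_map_def)
  show "finite (crosses M)" by (rule fin)
  show "alpha0 M (alpha2 M x) = alpha2 M (alpha0 M x)" using comm by (simp add: fun_eq_iff)
  show "permutation (alpha0 M)" "permutation (alpha1 M)" "permutation (alpha2 M)"
    using c fin unfolding fpf_involution_on_def permutation_permutes by blast+
qed (use assms in \<open>auto simp: is_map_def fpf_involution_onD\<close>)

lemma is_mapI:
  assumes "finite (crosses M)" "\<And>x. alpha0 M (alpha0 M x) = x" "\<And>x. alpha1 M (alpha1 M x) = x"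
    "\<And>x. alpha2 M (alpha2 M x) = x" "\<And>x. alpha0 M (alpha2 M x) = alpha2 M (alpha0 M x)"
    "\<And>x. x \<in> crosses M \<Longrightarrow> alpha0 M x \<noteq> x \<and> alpha1 M x \<noteq> x \<and> alpha2 M x \<noteq> x"
    "\<And>x. x \<notin> crosses M \<Longrightarrow> alpha0 M x = x \<and> alpha1 M x = x \<and> alpha2 M x = x"
  shows "is_map M"
  unfolding is_map_def using assms by (auto intro!: fpf_involution_onI simp: fun_eq_iff)

text \<open>\<open>D\<close> is one of two classes of crosses that are exchanged by all three
  involutions. The condition on \<open>erev\<close> excludes edges with only two crosses, on which
  \<open>alpha0\<close> and \<open>alpha2\<close> coincide.\<close>

definition orients :: "'a set \<Rightarrow> 'a premap \<Rightarrow> bool" where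
  "orients D M \<longleftrightarrow> D \<subseteq> crosses M \<and> (\<forall>c\<in>crosses M. (alpha0 M c \<in> D \<longleftrightarrow> c \<notin> D) \<and> (alpha1 M c \<in> D \<longleftrightarrow> c \<notin> D) \<and>
     (alpha2 M c \<in> D \<longleftrightarrow> c \<notin> D) \<and> erev M c \<noteq> c)"

lemma orientsD:
  assumes "orients D M"
  shows "D \<subseteq> crosses M" "c \<in> crosses M \<Longrightarrow> alpha0 M c \<in> D \<longleftrightarrow> c \<notin> D"
    "c \<in> crosses M \<Longrightarrow> alpha1 M c \<in> D \<longleftrightarrow> c \<notin> D" "c \<in> crosses M \<Longrightarrow> alpha2 M c \<in> D \<longleftrightarrow> c \<notin> D"
    "c \<in> crosses M \<Longrightarrow> erev M c \<noteq> c"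
  using assms by (auto simp: orients_def)

lemma erev_simps:
  assumes "is_map M"
  shows "erev M (erev M x) = x" "erev M x \<in> crosses M \<longleftrightarrow> x \<in> crosses M"
    "erev M (alpha0 M x) = alpha2 M x" "erev M (alpha2 M x) = alpha0 M x"
    "alpha0 M (erev M x) = alpha2 M x" "alpha2 M (erev M x) = alpha0 M x"
  using is_mapD(2-8)[OF assms] by (simp_all add: erev_def)

lemma fperm_eq: "is_map M \<Longrightarrow> vperm M \<circ> erev M = fperm M"
  by (simp add: fun_eq_iff vperm_def erev_def fperm_def is_mapD)

lemma map_darts: 
  assumes "is_map M"
  shows "darts (crosses M) (vperm M) (erev M)"
  unfolding darts_def vperm_def erev_def using is_mapD[OF assms] by (auto intro: permutation_compose)

lemma orients_darts:
  assumes m: "is_map M" and o: "orients D M"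
  shows "darts D (vperm M) (erev M)"
proof -
  note * = is_mapD[OF m] and ** = orientsD[OF o]
  have "vperm M x \<in> D \<longleftrightarrow> x \<in> D" "erev M x \<in> D \<longleftrightarrow> x \<in> D" for x
  proof -
    have "alpha1 M (alpha2 M x) \<in> D \<longleftrightarrow> x \<in> D" "alpha0 M (alpha2 M x) \<in> D \<longleftrightarrow> x \<in> D"
      using *(4,15-17)[of x] **(2,3)[of "alpha2 M x"] **(4)[of x] *(15,16)[of "alpha2 M x"]
      by (cases "x \<in> crosses M"; simp)+
    then show "vperm M x \<in> D \<longleftrightarrow> x \<in> D" "erev M x \<in> D \<longleftrightarrow> x \<in> D" by (simp_all add: vperm_def erev_def)
  qed
  then show ?thesis using map_darts[OF m] **(1) *(1) finite_subset unfolding darts_def by blast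
qed

text \<open>Orbits under maps including \<open>alpha2\<close> are symmetric under this mirror, so it
  is enough to follow the cross that lies in \<open>D\<close>: \<open>y\<close> or its mirror image.
  The conditions on \<open>S\<close> depend on \<open>F\<close> so that vertices and components are
  covered alike.\<close>

lemma orients_subset_gorbit:
  assumes m: "is_map M" and o: "orients D M" and a: "a \<in> D"
    and F: "F \<subseteq> {alpha0 M, alpha1 M, alpha2 M}" "alpha2 M \<in> F"
    and S: "a \<in> S" "alpha0 M \<in> F \<Longrightarrow> (\<And>x. erev M x \<in> S \<longleftrightarrow> x \<in> S)" "alpha1 M \<in> F \<Longrightarrow> (\<And>x. vperm M x \<in> S \<longleftrightarrow> x \<in> S)"
    and y: "y \<in> gorbit F a"
  shows "y \<in> crosses M \<and> (if y \<in> D then y \<in> S else alpha2 M y \<in> S)"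
  using y
proof (induct rule: gorbit_induct)
  case base
  then show ?case using a S(1) orientsD(1)[OF o] by auto
next
  case (step u h)
  note * = is_mapD[OF m] and ** = orientsD[OF o]
  show ?case
  proof (cases "u \<in> crosses M")
    case True
    from step F consider "h = alpha0 M" "alpha0 M \<in> F" | "h = alpha1 M" "alpha1 M \<in> F" | "h = alpha2 M" by blast
    then show ?thesis
    proof cases
      case 1
      have "erev M u = alpha2 M (alpha0 M u)" "erev M (alpha2 M u) = alpha0 M u"
        using *(5-8) by (simp_all add: erev_def)
      then show ?thesis using S(2)[OF 1(2), of u] S(2)[OF 1(2), of "alpha2 M u"] **(2)[OF True] True *(2) 1(1) by simp
    next
      case 2
      have "vperm M (alpha2 M u) = alpha1 M u" "vperm M (alpha2 M (alpha1 M u)) = u"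
        using *(5-8) by (simp_all add: vperm_def)
      then show ?thesis
        using S(3)[OF 2(2), of "alpha2 M u"] S(3)[OF 2(2), of "alpha2 M (alpha1 M u)"] **(3)[OF True] True *(3) 2(1) by simp
    next
      case 3
      then show ?thesis using **(4)[OF True] True *(4,7) by simp
    qed
  next
    case False
    then have "h u = u" using step F *(15-17) by auto
    then show ?thesis by simp
  qed
qed

lemma vertex_of_oriented:
  assumes m: "is_map M" and o: "orients D M" and a: "a \<in> D" "b \<in> D" "b \<in> vertex_of M a"
  shows "b \<in> orbit (vperm M) a"
proof -
  have v: "permutation (vperm M)" by (rule dartsD(2)[OF orients_darts[OF m o]])
  \<comment> \<open>The generators form a set of functions, so \<open>alpha0\<close> belongs to it
    when it equals \<open>alpha1\<close>; reversal then coincides with rotation and preserves the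
    orbit.\<close>
  have n: "alpha0 M \<in> {alpha1 M, alpha2 M} \<Longrightarrow> erev M x \<in> orbit (vperm M) a \<longleftrightarrow> x \<in> orbit (vperm M) a" for x
  proof -
    assume "alpha0 M \<in> {alpha1 M, alpha2 M}"
    moreover have "alpha0 M \<noteq> alpha2 M"
      using orientsD(5)[OF o, of a] orientsD(1)[OF o] a(1) is_mapD[OF m] by (auto simp: erev_def)
    ultimately have "alpha0 M = alpha1 M" by blast
    then have "erev M = vperm M" by (simp add: erev_def vperm_def)
    then show ?thesis using orbit_image_iff[OF v] by simp
  qed
  show ?thesis
    using orients_subset_gorbit[OF m o a(1), of "{alpha1 M, alpha2 M}" "orbit (vperm M) a" b]
      a n orbit_image_iff[OF v] permutation_self_in_orbit[OF v, of a]
    by (simp add: vertex_of_def)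
qed

lemma component_of_oriented:
  assumes m: "is_map M" and o: "orients D M" and a: "a \<in> D"
  shows "y \<in> component_of M a \<Longrightarrow> y \<in> crosses M \<and> (if y \<in> D then y \<in> gorbit {vperm M, erev M} a else alpha2 M y \<in> gorbit {vperm M, erev M} a)"
  using orients_subset_gorbit[OF m o a, of "{alpha0 M, alpha1 M, alpha2 M}" "gorbit {vperm M, erev M} a" y]
  by (simp add: component_of_def gorbit2_iff)

lemma component_of_iff: 
  "alpha0 M x \<in> component_of M y \<longleftrightarrow> x \<in> component_of M y"
  "alpha1 M x \<in> component_of M y \<longleftrightarrow> x \<in> component_of M y"
  "alpha2 M x \<in> component_of M y \<longleftrightarrow> x \<in> component_of M y"
  unfolding component_of_def by (rule gorbit_image_iff; simp)+

lemma gorbit_subset_component_of: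
  assumes "y \<in> gorbit {vperm M, erev M} a"
  shows "y \<in> component_of M a"
  using assms
proof (induct rule: gorbit2_induct)
  case base then show ?case by (simp add: component_of_def)
qed (simp_all add: vperm_def erev_def component_of_iff)

text \<open>\<open>g\<close> is constant on components and selects those on which the orientation is
  kept; on the others it is reversed.\<close>

lemma orients_flip:
  assumes o: "orients D M" and m: "is_map M"
    and g: "\<And>x. g (alpha0 M x) = g x" "\<And>x. g (alpha1 M x) = g x" "\<And>x. g (alpha2 M x) = g x"
  shows "orients {x \<in> crosses M. (x \<in> D) = g x} M"
  using orientsD[OF o] g is_mapD(2-4)[OF m] unfolding orients_def by auto

section \<open>Deletion of edges\<close>

lemma skip_eqI:
  assumes "0 < m" "(t ^^ m) c \<notin> X" "\<And>i. 0 < i \<Longrightarrow> i < m \<Longrightarrow> (t ^^ i) c \<in> X"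
  shows "skip t X c = (t ^^ m) c"
proof -
  have "(LEAST n. 0 < n \<and> (t ^^ n) c \<notin> X) = m"
  proof (rule Least_equality)
    show "0 < m \<and> (t ^^ m) c \<notin> X" using assms by blast
    show "m \<le> n" if "0 < n \<and> (t ^^ n) c \<notin> X" for n using assms(3)[of n] that by (meson not_le)
  qed
  then show ?thesis by (simp add: skip_def)
qed

lemma skip_ex:
  assumes "permutation t" "c \<notin> X"
  obtains m where "0 < m" "(t ^^ m) c \<notin> X" "\<And>i. 0 < i \<Longrightarrow> i < m \<Longrightarrow> (t ^^ i) c \<in> X" "skip t X c = (t ^^ m) c"
proof -
  let ?P = "\<lambda>n. 0 < n \<and> (t ^^ n) c \<notin> X"
  have ex: "\<exists>n. ?P n" using permutation_self_in_orbit[OF assms(1), of c] assms(2) by (auto simp: orbit_altdef)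
  define m where "m = (LEAST n. ?P n)"
  have m: "?P m" unfolding m_def by (rule LeastI_ex[OF ex])
  moreover have "(t ^^ i) c \<in> X" if "0 < i" "i < m" for i
    using not_less_Least[of i ?P] that unfolding m_def by blast
  ultimately show ?thesis using that skip_eqI[of m t c X] by blast
qed

text \<open>Since \<open>alpha2\<close> conjugates \<open>vperm M\<close> to its inverse, an
  equation of length \<open>k\<close> can be shortened by one step at each end. Lengths 0 and 1 are
  excluded because \<open>alpha2\<close> and \<open>alpha1\<close> have no fixed points. So the two
  rotation cycles of a vertex are distinct.\<close>

lemma vperm_mirror_free:
  assumes m: "is_map M" and c: "c \<in> crosses M"
  shows "(vperm M ^^ k) (alpha2 M c) \<noteq> c"
  using c
proof (induct k arbitrary: c rule: less_induct)
  case (less k)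
  note * = is_mapD[OF m]
  consider "k = 0" | "k = 1" | j where "k = Suc (Suc j)" by (metis One_nat_def not0_implies_Suc)
  then show ?case
  proof cases
    case 1 then show ?thesis using *(14)[OF less.prems] by simp
  next
    case 2 then show ?thesis using *(13)[OF less.prems] *(7) by (simp add: vperm_def)
  next
    case 3
    let ?c = "alpha2 M (alpha1 M c)"
    have c: "?c \<in> crosses M" using less.prems *(3,4) by simp
    have "vperm M (alpha2 M c) = alpha2 M ?c" using *(7) by (simp add: vperm_def)
    then have "(vperm M ^^ k) (alpha2 M c) = vperm M ((vperm M ^^ j) (alpha2 M ?c))"
      using 3 by (simp add: funpow_swap1)
    moreover have "(vperm M ^^ j) (alpha2 M ?c) \<noteq> ?c" using less.hyps[of j, OF _ c] 3 by simp
    ultimately show ?thesis using *(6,7) by (metis vperm_def comp_apply)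
  qed
qed

lemma edge_of_eq:
  assumes "is_map M"
  shows "edge_of M c = {c, alpha0 M c, alpha2 M c, erev M c}"
proof
  note * = is_mapD[OF assms]
  let ?S = "{c, alpha0 M c, alpha2 M c, erev M c}"
  have "y \<in> ?S" if "y \<in> gorbit {alpha0 M, alpha2 M} c" for y using that
  proof (induct rule: gorbit2_induct)
    case (v u) show ?case using *(5,7,8) by (auto simp: erev_def) metis+
  next
    case (e u) show ?case using *(5,7,8) by (auto simp: erev_def) metis+
  qed simp
  then show "edge_of M c \<subseteq> ?S" by (auto simp: edge_of_def)
  show "?S \<subseteq> edge_of M c" by (simp add: edge_of_def erev_def gorbit2_iff)
qed

lemma edges_Union_iff:
  assumes "E \<subseteq> edges M"
  shows "alpha0 M x \<in> \<Union>E \<longleftrightarrow> x \<in> \<Union>E" "alpha2 M x \<in> \<Union>E \<longleftrightarrow> x \<in> \<Union>E"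
proof -
  have "alpha0 M x \<in> B \<longleftrightarrow> x \<in> B" "alpha2 M x \<in> B \<longleftrightarrow> x \<in> B" if "B \<in> edges M" for B
    using that by (auto simp: edges_def edge_of_def gorbit2_iff)
  then show "alpha0 M x \<in> \<Union>E \<longleftrightarrow> x \<in> \<Union>E" "alpha2 M x \<in> \<Union>E \<longleftrightarrow> x \<in> \<Union>E" using assms by blast+
qed

lemma delete_edges_simps:
  "crosses (delete_edges M E) = crosses M - \<Union>E"
  "c \<in> crosses M - \<Union>E \<Longrightarrow> alpha0 (delete_edges M E) c = alpha0 M c"
  "c \<in> crosses M - \<Union>E \<Longrightarrow> alpha2 (delete_edges M E) c = alpha2 M c"
  "c \<in> crosses M - \<Union>E \<Longrightarrow> alpha1 (delete_edges M E) c = skip (vperm M) (\<Union>E) (alpha2 M c)"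
  "c \<notin> crosses M - \<Union>E \<Longrightarrow> alpha0 (delete_edges M E) c = c"
  "c \<notin> crosses M - \<Union>E \<Longrightarrow> alpha1 (delete_edges M E) c = c"
  "c \<notin> crosses M - \<Union>E \<Longrightarrow> alpha2 (delete_edges M E) c = c"
  by (auto simp: delete_edges_def Let_def)

lemma vperm_iff:
  assumes "is_map M"
  shows "vperm M x \<in> crosses M \<longleftrightarrow> x \<in> crosses M" "(vperm M ^^ k) x \<in> crosses M \<longleftrightarrow> x \<in> crosses M"
proof -
  show 1: "vperm M x \<in> crosses M \<longleftrightarrow> x \<in> crosses M" for x using is_mapD(3,4)[OF assms] by (simp add: vperm_def)
  show "(vperm M ^^ k) x \<in> crosses M \<longleftrightarrow> x \<in> crosses M" by (induct k) (simp_all add: 1)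
qed

text \<open>\<open>alpha2\<close> conjugates the vertex permutation to its inverse, so reflecting
  and walking \<open>k\<close> steps is undone by doing the same again.\<close>

lemma alpha2_vperm_pow:
  assumes m: "is_map M"
  shows "(vperm M ^^ k) (alpha2 M ((vperm M ^^ k) (alpha2 M c))) = c"
proof (induct k arbitrary: c)
  case 0 then show ?case using is_mapD(7)[OF m] by simp
next
  case (Suc k)
  note * = is_mapD[OF m]
  have "alpha2 M ((vperm M ^^ Suc k) (alpha2 M c)) = alpha2 M ((vperm M ^^ k) (alpha2 M (alpha2 M (alpha1 M c))))"
    using *(7) by (simp add: funpow_swap1 vperm_def)
  then have "(vperm M ^^ Suc k) (alpha2 M ((vperm M ^^ Suc k) (alpha2 M c))) = vperm M (alpha2 M (alpha1 M c))"
    using Suc[of "alpha2 M (alpha1 M c)"] by simp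
  also have "vperm M (alpha2 M (alpha1 M c)) = c" using *(6,7) by (simp add: vperm_def)
  finally show ?case .
qed

lemma alpha1_delete_edges:
  assumes m: "is_map M" and E: "E \<subseteq> edges M" and c: "c \<in> crosses M - \<Union>E"
  obtains k where "alpha1 (delete_edges M E) c = (vperm M ^^ k) (alpha2 M c)" "0 < k"
    "(vperm M ^^ k) (alpha2 M c) \<in> crosses M - \<Union>E" "\<And>i. 0 < i \<Longrightarrow> i < k \<Longrightarrow> (vperm M ^^ i) (alpha2 M c) \<in> \<Union>E"
proof -
  have v: "permutation (vperm M)" by (rule dartsD(2)[OF map_darts[OF m]])
  have "alpha2 M c \<notin> \<Union>E" using edges_Union_iff(2)[OF E] c by blast
  from skip_ex[OF v this] obtain k where "0 < k" "(vperm M ^^ k) (alpha2 M c) \<notin> \<Union>E"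
    "\<And>i. 0 < i \<Longrightarrow> i < k \<Longrightarrow> (vperm M ^^ i) (alpha2 M c) \<in> \<Union>E"
    "skip (vperm M) (\<Union>E) (alpha2 M c) = (vperm M ^^ k) (alpha2 M c)" by metis
  moreover have "(vperm M ^^ k) (alpha2 M c) \<in> crosses M" for k
    using vperm_iff(2)[OF m] is_mapD(4)[OF m] c by simp
  ultimately show ?thesis using that delete_edges_simps(4)[OF c] by simp
qed

text \<open>The main point is that the new \<open>alpha1\<close> is an involution: the walk over
  deleted crosses from \<open>alpha2 x\<close> to the first remaining cross \<open>y\<close> is
  reflected by \<open>alpha2\<close> into the walk from \<open>alpha2 y\<close> to \<open>x\<close>,
  which also meets only deleted crosses on its way. Fixed points are excluded by
  \<open>vperm_mirror_free\<close>.\<close>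

lemma is_map_delete_edges:
  assumes m: "is_map M" and E: "E \<subseteq> edges M"
  shows "is_map (delete_edges M E)"
proof -
  let ?N = "delete_edges M E" and ?C = "crosses M - \<Union>E"
  note * = is_mapD[OF m] and d = delete_edges_simps[where M = M and E = E] and U = edges_Union_iff[OF E]
  have a0: "alpha0 M x \<in> ?C \<longleftrightarrow> x \<in> ?C" and a2: "alpha2 M x \<in> ?C \<longleftrightarrow> x \<in> ?C" for x
    using *(2,4)[of x] U[of x] by auto
  have a1: "alpha1 ?N (alpha1 ?N x) = x \<and> alpha1 ?N x \<noteq> x" if x: "x \<in> ?C" for x
  proof -
    obtain k where k: "alpha1 ?N x = (vperm M ^^ k) (alpha2 M x)" "0 < k" "(vperm M ^^ k) (alpha2 M x) \<in> ?C"
      "\<And>i. 0 < i \<Longrightarrow> i < k \<Longrightarrow> (vperm M ^^ i) (alpha2 M x) \<in> \<Union>E" by (rule alpha1_delete_edges[OF m E x], rule that)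
    define y where "y = (vperm M ^^ k) (alpha2 M x)"
    have yx: "(vperm M ^^ k) (alpha2 M y) = x" unfolding y_def by (rule alpha2_vperm_pow[OF m])
    have "skip (vperm M) (\<Union>E) (alpha2 M y) = (vperm M ^^ k) (alpha2 M y)"
    proof (rule skip_eqI[OF k(2)])
      show "(vperm M ^^ k) (alpha2 M y) \<notin> \<Union>E" using yx x by simp
      fix i assume i: "0 < i" "i < k"
      have "y = (vperm M ^^ i) (alpha2 M (alpha2 M ((vperm M ^^ (k - i)) (alpha2 M x))))"
        using i *(7) funpow_add[of i "k - i" "vperm M"] by (simp add: y_def)
      then have "(vperm M ^^ i) (alpha2 M y) = alpha2 M ((vperm M ^^ (k - i)) (alpha2 M x))"
        using alpha2_vperm_pow[OF m, of i "alpha2 M ((vperm M ^^ (k - i)) (alpha2 M x))"] by simp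
      then show "(vperm M ^^ i) (alpha2 M y) \<in> \<Union>E" using k(4)[of "k - i"] i U(2) by simp
    qed
    then have "alpha1 ?N y = x" using d(4)[of y] k(3) yx by (simp add: y_def)
    moreover have "y \<noteq> x" unfolding y_def using vperm_mirror_free[OF m] x by blast
    ultimately show ?thesis using k(1) by (simp add: y_def)
  qed
  show ?thesis
  proof (rule is_mapI)
    show "finite (crosses ?N)" using *(1) d(1) by simp
    fix x
    show "alpha0 ?N (alpha0 ?N x) = x" using d(2,5)[of x] d(2)[of "alpha0 M x"] a0[of x] *(5) by (cases "x \<in> ?C") auto
    show "alpha2 ?N (alpha2 ?N x) = x" using d(3,7)[of x] d(3)[of "alpha2 M x"] a2[of x] *(7) by (cases "x \<in> ?C") auto
    show "alpha1 ?N (alpha1 ?N x) = x" using a1[of x] d(6)[of x] by (cases "x \<in> ?C") auto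
    show "alpha0 ?N (alpha2 ?N x) = alpha2 ?N (alpha0 ?N x)"
      using d(2,3,5,7)[of x] d(2)[of "alpha2 M x"] d(3)[of "alpha0 M x"] a0[of x] a2[of x] *(8) by (cases "x \<in> ?C") auto
    show "alpha0 ?N x = x \<and> alpha1 ?N x = x \<and> alpha2 ?N x = x" if "x \<notin> crosses ?N" using d(1,5-7) that by blast
    show "alpha0 ?N x \<noteq> x \<and> alpha1 ?N x \<noteq> x \<and> alpha2 ?N x \<noteq> x" if "x \<in> crosses ?N"
      using d(1) d(2,3)[of x] a1[of x] *(12,14)[of x] that by auto
  qed
qed

lemma orients_vperm_pow: "is_map M \<Longrightarrow> orients D M \<Longrightarrow> (vperm M ^^ k) x \<in> D \<longleftrightarrow> x \<in> D"
  by (induct k) (simp_all add: dartsD(4)[OF orients_darts])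

lemma erev_delete_edges:
  assumes m: "is_map M" and E: "E \<subseteq> edges M" and x: "x \<in> crosses M - \<Union>E"
  shows "erev (delete_edges M E) x = erev M x"
proof -
  have "alpha2 M x \<in> crosses M - \<Union>E" using is_mapD(4)[OF m] edges_Union_iff(2)[OF E] x by blast
  then show ?thesis using x by (simp add: erev_def delete_edges_simps)
qed

lemma vperm_delete_edges:
  assumes m: "is_map M" and E: "E \<subseteq> edges M" and x: "x \<in> crosses M - \<Union>E"
  shows "vperm (delete_edges M E) x = skip (vperm M) (\<Union>E) x"
proof -
  have "alpha2 M x \<in> crosses M - \<Union>E" using is_mapD(4)[OF m] edges_Union_iff(2)[OF E] x by blast
  then show ?thesis using x is_mapD(7)[OF m] by (simp add: vperm_def delete_edges_simps)
qed

lemma orients_delete_edges: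
  assumes m: "is_map M" and E: "E \<subseteq> edges M" and o: "orients D M"
  shows "orients (D - \<Union>E) (delete_edges M E)"
proof -
  let ?N = "delete_edges M E" and ?C = "crosses M - \<Union>E"
  note * = is_mapD[OF m] and d = delete_edges_simps[where M = M and E = E] and U = edges_Union_iff[OF E] and ** = orientsD[OF o]
  show ?thesis
    unfolding orients_def d(1)
  proof (intro conjI ballI)
    show "D - \<Union>E \<subseteq> ?C" using **(1) by blast
    fix c assume c: "c \<in> ?C"
    show "alpha0 ?N c \<in> D - \<Union>E \<longleftrightarrow> c \<notin> D - \<Union>E" using d(2)[OF c] **(2)[of c] U(1)[of c] c by auto
    show "alpha2 ?N c \<in> D - \<Union>E \<longleftrightarrow> c \<notin> D - \<Union>E" using d(3)[OF c] **(4)[of c] U(2)[of c] c by auto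
    show "erev ?N c \<noteq> c" using erev_delete_edges[OF m E c] **(5)[of c] c by auto
    obtain k where "alpha1 ?N c = (vperm M ^^ k) (alpha2 M c)" "(vperm M ^^ k) (alpha2 M c) \<in> ?C"
      by (rule alpha1_delete_edges[OF m E c], rule that)
    then show "alpha1 ?N c \<in> D - \<Union>E \<longleftrightarrow> c \<notin> D - \<Union>E"
      using orients_vperm_pow[OF m o, of k "alpha2 M c"] **(4)[of c] c by auto
  qed
qed

section \<open>Gluings of oriented maps\<close>

lemma swap_at_simps [simp]:
  "crosses (swap_at M a b) = crosses M" "alpha0 (swap_at M a b) = alpha0 M" "alpha2 (swap_at M a b) = alpha2 M"
  "alpha1 (swap_at M a b) = transpose a b \<circ> alpha1 M \<circ> transpose a b" "erev (swap_at M a b) = erev M"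
  by (simp_all add: swap_at_def erev_def)

lemma is_map_swap_at:
  assumes m: "is_map M" and "a \<in> crosses M" "b \<in> crosses M"
  shows "is_map (swap_at M a b)"
proof (rule is_mapI)
  note * = is_mapD[OF m]
  show "finite (crosses (swap_at M a b))" using * by simp
  fix x
  show "alpha0 (swap_at M a b) (alpha0 (swap_at M a b) x) = x" "alpha1 (swap_at M a b) (alpha1 (swap_at M a b) x) = x"
    "alpha2 (swap_at M a b) (alpha2 (swap_at M a b) x) = x"
    "alpha0 (swap_at M a b) (alpha2 (swap_at M a b) x) = alpha2 (swap_at M a b) (alpha0 (swap_at M a b) x)"
    using *(5-8) by simp_all
  have tr: "transpose a b x \<in> crosses M \<longleftrightarrow> x \<in> crosses M" using assms by (intro transpose_mem_iff) simp
  show "alpha0 (swap_at M a b) x \<noteq> x \<and> alpha1 (swap_at M a b) x \<noteq> x \<and> alpha2 (swap_at M a b) x \<noteq> x"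
    if "x \<in> crosses (swap_at M a b)"
  proof -
    have "alpha1 M (transpose a b x) \<noteq> transpose a b x" using *(13) tr that by simp
    then have "transpose a b (alpha1 M (transpose a b x)) \<noteq> x" by (metis transpose_involutory)
    then show ?thesis using *(12,14) that by simp
  qed
  show "alpha0 (swap_at M a b) x = x \<and> alpha1 (swap_at M a b) x = x \<and> alpha2 (swap_at M a b) x = x"
    if "x \<notin> crosses (swap_at M a b)" using *(15-17) tr that by simp
qed

text \<open>For \<open>x\<close> in \<open>D\<close> the cross \<open>alpha2 M x\<close> lies in the
  other class, so the inner one of the two transpositions is idle and the gluing becomes a
  composition with one transposition.\<close>

lemma vperm_swap_at:
  assumes o: "orients D M" and ab: "a \<in> D" "b \<in> D" and x: "x \<in> D"
  shows "vperm (swap_at M a b) x = (transpose a b \<circ> vperm M) x"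
proof -
  have "alpha2 M x \<notin> D" using orientsD(1,4)[OF o] x by blast
  then have "transpose a b (alpha2 M x) = alpha2 M x" using ab by (auto intro: transpose_apply_other)
  then show ?thesis by (simp add: vperm_def)
qed

lemma orients_swap_at:
  assumes o: "orients D M" and m: "is_map M" and ab: "a \<in> D" "b \<in> D"
  shows "orients D (swap_at M a b)"
proof -
  have "transpose a b x \<in> D \<longleftrightarrow> x \<in> D" "transpose a b x \<in> crosses M \<longleftrightarrow> x \<in> crosses M" for x
    using ab orientsD(1)[OF o] by (intro transpose_mem_iff; blast)+
  then show ?thesis using orientsD[OF o] unfolding orients_def by simp
qed

lemma duplicate_delete:
  assumes m: "is_map M" and o: "orients D M" and c: "c0 \<in> D" "vperm M (erev M c0) = c1" "vperm M (erev M c1) = c0"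
    "c1 \<noteq> c0" "erev M c1 \<noteq> c0"
  shows "duplicate D (D - edge_of M c1) (vperm M) (erev M) (vperm (delete_edges M {edge_of M c1}))
    (erev (delete_edges M {edge_of M c1})) c0 c1 (erev M c1)"
proof -
  let ?N = "delete_edges M {edge_of M c1}" and ?X = "edge_of M c1" let ?d = "erev M c1"
  note * = is_mapD[OF m] and ** = orientsD[OF o]
  have dD: "darts D (vperm M) (erev M)" by (rule orients_darts[OF m o])
  have c1D: "c1 \<in> D" using c(1,2) dartsD(4,5)[OF dD] by metis
  have c1C: "c1 \<in> crosses M" using c1D **(1) by blast
  have E: "{?X} \<subseteq> edges M" using c1C by (simp add: edges_def)
  have "alpha0 M c1 \<notin> D" "alpha2 M c1 \<notin> D" "?d \<in> D" using **(2,4)[OF c1C] c1D dartsD(5)[OF dD] by auto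
  then have XD: "?X \<inter> D = {c1, ?d}" unfolding edge_of_eq[OF m] using c1D by blast
  then have DX: "D - ?X = D - {c1, ?d}" by blast
  have mN: "is_map ?N" by (rule is_map_delete_edges[OF m E])
  have oN: "orients (D - ?X) ?N" using orients_delete_edges[OF m E o] by simp
  have xC: "x \<in> crosses M - \<Union>{?X}" if "x \<in> D - ?X" for x using that **(1) by auto
  have vd: "vperm M ?d = c0" using c by simp
  have cX: "c0 \<notin> ?X" using XD c(1,4,5) by (metis IntI insertE singletonD)
  have vc1: "vperm M c1 \<noteq> c1"
  proof
    assume "vperm M c1 = c1"
    then have "c1 = erev M c0" using permutation_inj[OF dartsD(2)[OF dD], of c1 "erev M c0"] c(2) by simp
    then show False using c(5) dartsD(6)[OF dD] by metis
  qed
  show ?thesis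
  proof (unfold_locales)
    show "darts D (vperm M) (erev M)" by (rule dD)
    show "darts (D - ?X) (vperm ?N) (erev ?N)" by (rule orients_darts[OF mN oN])
    show "D - ?X = D - {c1, ?d}" by (rule DX)
    show "?d \<noteq> c1" by (rule **(5)[OF c1C])
    show "erev ?N x = erev M x" if "x \<in> D - ?X" for x using erev_delete_edges[OF m E xC[OF that]] .
    fix x assume x: "x \<in> D - ?X"
    have sk: "vperm ?N x = skip (vperm M) ?X x" using vperm_delete_edges[OF m E xC[OF x]] by simp
    have inD: "vperm M y \<in> ?X \<longleftrightarrow> vperm M y = c1 \<or> vperm M y = ?d" if "y \<in> D" for y
      using XD dartsD(4)[OF dD, of y] that by blast
    have xD: "x \<in> D" "x \<noteq> c1" "x \<noteq> ?d" using x DX by auto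
    have lt2: "0 < i \<Longrightarrow> i < 2 \<Longrightarrow> i = 1" for i :: nat by simp
    have lt3: "0 < i \<Longrightarrow> i < 3 \<Longrightarrow> i = 1 \<or> i = 2" for i :: nat by auto
    \<comment> \<open>The cases follow the deleted darts between \<open>x\<close> and the next
      remaining one: none, only \<open>?d\<close>, only \<open>c1\<close>, or \<open>c1\<close>
      followed by \<open>?d\<close>.\<close>
    consider "vperm M x \<noteq> c1" "vperm M x \<noteq> ?d" | "vperm M x = ?d" | "vperm M x = c1" "vperm M c1 \<noteq> ?d"
      | "vperm M x = c1" "vperm M c1 = ?d" by blast
    then show "vperm ?N x = (if vperm M x \<noteq> c1 \<and> vperm M x \<noteq> ?d then vperm M x
        else if vperm M x = ?d \<or> vperm M c1 = ?d then c0 else vperm M c1)"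
    proof cases
      case 1
      then have "skip (vperm M) ?X x = (vperm M ^^ 1) x" using inD[OF xD(1)] by (intro skip_eqI) auto
      then show ?thesis using 1 sk by simp
    next
      case 2
      have "skip (vperm M) ?X x = (vperm M ^^ 2) x"
      proof (rule skip_eqI)
        show "(vperm M ^^ 2) x \<notin> ?X" using 2 vd cX by (simp add: numeral_2_eq_2)
        show "(vperm M ^^ i) x \<in> ?X" if "0 < i" "i < 2" for i using lt2[OF that] inD[OF xD(1)] 2 by simp
      qed simp
      then show ?thesis using 2 sk vd by (simp add: numeral_2_eq_2)
    next
      case 3
      have "skip (vperm M) ?X x = (vperm M ^^ 2) x"
      proof (rule skip_eqI)
        show "(vperm M ^^ 2) x \<notin> ?X" using 3 inD[OF c1D] vc1 by (simp add: numeral_2_eq_2)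
        show "(vperm M ^^ i) x \<in> ?X" if "0 < i" "i < 2" for i using lt2[OF that] inD[OF xD(1)] 3 by simp
      qed simp
      then show ?thesis using 3 sk **(5)[OF c1C] by (simp add: numeral_2_eq_2)
    next
      case 4
      have "skip (vperm M) ?X x = (vperm M ^^ 3) x"
      proof (rule skip_eqI)
        show "(vperm M ^^ 3) x \<notin> ?X" using 4 vd cX by (simp add: numeral_3_eq_3)
        show "(vperm M ^^ i) x \<in> ?X" if "0 < i" "i < 3" for i
          using lt3[OF that] inD[OF xD(1)] inD[OF c1D] 4 by (auto simp: numeral_2_eq_2)
      qed simp
      then show ?thesis using 4 sk vd by (simp add: numeral_3_eq_3)
    qed
  qed (use c c1D in auto)
qed

section \<open>Plane maps are orientable\<close>

text \<open>The classes of \<open>h\<close> are unions of a class of \<open>g\<close> with its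
  mirror image under \<open>r\<close>. Each \<open>K\<close> contains one or two
  \<open>g\<close>-classes, collected in \<open>Q K\<close>, and it contains two exactly when these
  are not their own mirror images.\<close>

lemma card_double_classes:
  fixes g h :: "'a \<Rightarrow> 'a set"
  assumes C: "finite C" "\<And>x. x \<in> C \<Longrightarrow> r x \<in> C" "\<And>x. x \<in> C \<Longrightarrow> r (r x) = x"
    and g: "\<And>x. x \<in> C \<Longrightarrow> x \<in> g x" "\<And>x. x \<in> C \<Longrightarrow> g x \<subseteq> C" "\<And>x y. x \<in> C \<Longrightarrow> y \<in> g x \<Longrightarrow> g y = g x"
      "\<And>x y. x \<in> C \<Longrightarrow> y \<in> g x \<Longrightarrow> g (r y) = g (r x)"
    and h: "\<And>x. x \<in> C \<Longrightarrow> h x = g x \<union> g (r x)"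
  shows "card (g ` C) \<le> 2 * card (h ` C)"
    and "(\<And>x. x \<in> C \<Longrightarrow> g x \<noteq> g (r x)) \<Longrightarrow> card (g ` C) = 2 * card (h ` C)"
    and "card (g ` C) = 2 * card (h ` C) \<Longrightarrow> x \<in> C \<Longrightarrow> g x \<noteq> g (r x)"
proof -
  have hh: "h y = h x" if x: "x \<in> C" and y: "y \<in> h x" for x y
  proof -
    have rx: "r x \<in> C" using C x by blast
    have "y \<in> g x \<or> y \<in> g (r x)" using y h[OF x] by blast
    then show ?thesis
    proof
      assume y: "y \<in> g x"
      then have "y \<in> C" using g(2)[OF x] by blast
      then show ?thesis using h[OF x] h[of y] g(3)[OF x y] g(4)[OF x y] by simp
    next
      assume y: "y \<in> g (r x)"
      then have "y \<in> C" using g(2)[OF rx] by blast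
      then show ?thesis using h[OF x] h[of y] g(3)[OF rx y] g(4)[OF rx y] C(3)[OF x] by auto
    qed
  qed
  define Q where "Q K = {A \<in> g ` C. A \<subseteq> K}" for K
  have Q: "Q (h x) = {g x, g (r x)}" if x: "x \<in> C" for x
  proof
    show "{g x, g (r x)} \<subseteq> Q (h x)" using x C(2)[OF x] h[OF x] by (auto simp: Q_def)
    show "Q (h x) \<subseteq> {g x, g (r x)}"
    proof
      fix A assume "A \<in> Q (h x)"
      then obtain y where y: "y \<in> C" "A = g y" "g y \<subseteq> h x" by (auto simp: Q_def)
      then have "y \<in> g x \<or> y \<in> g (r x)" using g(1)[OF y(1)] h[OF x] by blast
      then show "A \<in> {g x, g (r x)}" using g(3)[OF x, of y] g(3)[OF C(2)[OF x], of y] y(2) by auto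
    qed
  qed
  have Qle: "card (Q K) \<le> 2" if "K \<in> h ` C" for K
    using that Q by (auto simp: card_insert_if)
  have "g ` C = (\<Union>K\<in>h ` C. Q K)"
  proof
    show "g ` C \<subseteq> (\<Union>K\<in>h ` C. Q K)" using h by (fastforce simp: Q_def)
  qed (auto simp: Q_def)
  moreover have "card (\<Union>K\<in>h ` C. Q K) = (\<Sum>K\<in>h ` C. card (Q K))"
  proof (rule card_UN_disjoint)
    show "finite (h ` C)" using C by simp
    show "\<forall>K\<in>h ` C. finite (Q K)" using C by (simp add: Q_def)
    show "\<forall>K\<in>h ` C. \<forall>L\<in>h ` C. K \<noteq> L \<longrightarrow> Q K \<inter> Q L = {}"
    proof (intro ballI impI)
      fix K L assume K: "K \<in> h ` C" "L \<in> h ` C" "K \<noteq> L"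
      have False if A: "A \<in> Q K" "A \<in> Q L" for A
      proof -
        from A obtain y where y: "y \<in> C" "A = g y" "g y \<subseteq> K" "g y \<subseteq> L" by (auto simp: Q_def)
        then have "y \<in> K" "y \<in> L" using g(1) by blast+
        then have "h y = K" "h y = L" using hh K(1,2) by blast+
        then show False using K(3) by simp
      qed
      then show "Q K \<inter> Q L = {}" by blast
    qed
  qed
  ultimately have card: "card (g ` C) = (\<Sum>K\<in>h ` C. card (Q K))" by simp
  have two: "(\<Sum>K\<in>h ` C. 2) = 2 * card (h ` C)" by simp
  show "card (g ` C) \<le> 2 * card (h ` C)" unfolding card two[symmetric] by (rule sum_mono[OF Qle])
  show "card (g ` C) = 2 * card (h ` C)" if ne: "\<And>x. x \<in> C \<Longrightarrow> g x \<noteq> g (r x)"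
    unfolding card two[symmetric] by (rule sum.cong[OF refl]) (use Q ne in auto)
  show "g x \<noteq> g (r x)" if eq: "card (g ` C) = 2 * card (h ` C)" and x: "x \<in> C"
  proof
    assume "g x = g (r x)"
    then have "card (Q (h x)) < 2" using Q[OF x] by simp
    then have "(\<Sum>K\<in>h ` C. card (Q K)) < (\<Sum>K\<in>h ` C. 2)"
      using x C(1) Qle by (intro sum_strict_mono_ex1) auto
    then show False using eq card by simp
  qed
qed

lemma alpha2_orbit_vperm:
  assumes m: "is_map M" and y: "y \<in> orbit (vperm M) x"
  shows "alpha2 M y \<in> orbit (vperm M) (alpha2 M x)"
proof -
  have v: "permutation (vperm M)" by (rule dartsD(2)[OF map_darts[OF m]])
  obtain k where k: "y = (vperm M ^^ k) x" using y by (auto simp: orbit_altdef)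
  have "(vperm M ^^ k) (alpha2 M y) = alpha2 M x"
    using alpha2_vperm_pow[OF m, of k "alpha2 M x"] is_mapD(7)[OF m] k by simp
  then have "alpha2 M x \<in> orbit (vperm M) (alpha2 M y)"
    unfolding orbit_altdef_permutation[OF v] by (intro CollectI exI[of _ k]) simp
  then show ?thesis by (rule orbit_mem_sym[OF v])
qed

lemma vertex_of_eq:
  assumes m: "is_map M"
  shows "vertex_of M x = orbit (vperm M) x \<union> orbit (vperm M) (alpha2 M x)"
proof
  note * = is_mapD[OF m]
  have v: "permutation (vperm M)" by (rule dartsD(2)[OF map_darts[OF m]])
  let ?S = "orbit (vperm M) x \<union> orbit (vperm M) (alpha2 M x)"
  have 2: "alpha2 M u \<in> ?S" if "u \<in> ?S" for u
    using that alpha2_orbit_vperm[OF m, of u x] alpha2_orbit_vperm[OF m, of u "alpha2 M x"] *(7) by auto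
  have 1: "alpha1 M u \<in> ?S" if "u \<in> ?S" for u
  proof -
    have "vperm M (alpha2 M u) \<in> ?S" using 2[OF that] orbit_image_iff[OF v] by blast
    then show ?thesis using *(7) by (simp add: vperm_def)
  qed
  have "y \<in> ?S" if "y \<in> gorbit {alpha1 M, alpha2 M} x" for y using that
  proof (induct rule: gorbit2_induct)
    case base then show ?case using permutation_self_in_orbit[OF v] by blast
  next
    case (v u) show ?case using 1[of u] 1[of "alpha1 M u"] *(6)[of u] by metis
  next
    case (e u) show ?case using 2[of u] 2[of "alpha2 M u"] *(7)[of u] by metis
  qed
  then show "vertex_of M x \<subseteq> ?S" by (auto simp: vertex_of_def)
  have "orbit (vperm M) z \<subseteq> vertex_of M z" for z
    unfolding vertex_of_def vperm_def by (rule orbit_comp_subset_gorbit) auto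
  moreover have "vertex_of M (alpha2 M x) = vertex_of M x"
    unfolding vertex_of_def by (rule gorbit_eq) (simp add: gorbit2_iff)
  ultimately show "?S \<subseteq> vertex_of M x" by blast
qed

text \<open>The two directions of rotation at a vertex give two cycles, distinct by
  \<open>vperm_mirror_free\<close>.\<close>

lemma card_vertex_cycles:
  assumes m: "is_map M"
  shows "card (orbit (vperm M) ` crosses M) = 2 * card (vertex_of M ` crosses M)"
proof (rule card_double_classes(2)[where r = "alpha2 M"])
  note * = is_mapD[OF m]
  have v: "permutation (vperm M)" by (rule dartsD(2)[OF map_darts[OF m]])
  show "finite (crosses M)" by (rule *(1))
  fix x assume x: "x \<in> crosses M"
  show "alpha2 M x \<in> crosses M" "alpha2 M (alpha2 M x) = x" using x * by auto
  show "x \<in> orbit (vperm M) x" by (rule permutation_self_in_orbit[OF v])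
  show "orbit (vperm M) x \<subseteq> crosses M" by (rule darts_orbit_subset[OF map_darts[OF m] x])
  show "vertex_of M x = orbit (vperm M) x \<union> orbit (vperm M) (alpha2 M x)" by (rule vertex_of_eq[OF m])
  show "orbit (vperm M) x \<noteq> orbit (vperm M) (alpha2 M x)"
  proof
    assume "orbit (vperm M) x = orbit (vperm M) (alpha2 M x)"
    then have "x \<in> orbit (vperm M) (alpha2 M x)" using permutation_self_in_orbit[OF v, of x] by simp
    then obtain k where "x = (vperm M ^^ k) (alpha2 M x)" by (auto simp: orbit_altdef)
    then show False using vperm_mirror_free[OF m x, of k] by metis
  qed
  fix y assume y: "y \<in> orbit (vperm M) x"
  show "orbit (vperm M) y = orbit (vperm M) x" by (rule orbit_eq_of_mem[OF v y])
  show "orbit (vperm M) (alpha2 M y) = orbit (vperm M) (alpha2 M x)"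
    by (rule orbit_eq_of_mem[OF v alpha2_orbit_vperm[OF m y]])
qed

text \<open>Applied to the degenerate map in which \<open>alpha0\<close> and \<open>alpha2\<close> coincide.\<close>

lemma card_cycles_involutions:
  assumes C: "finite C" and a: "fpf_involution_on C a" and b: "fpf_involution_on C b"
  shows "card (orbit (a \<circ> b) ` C) = 2 * card (gorbit {a, b} ` C)"
proof -
  define M where "M = \<lparr>crosses = C, alpha0 = b, alpha1 = a, alpha2 = b, isolated = 0\<rparr>"
  have "is_map M" unfolding is_map_def M_def using assms by simp
  from card_vertex_cycles[OF this] show ?thesis
    by (simp add: M_def vperm_def vertex_of_def[abs_def])
qed

text \<open>A function on \<open>D\<close> is extended by zero; as \<open>D\<close> is closed under
  both permutations, all face sums remain zero.\<close>

lemma planar_subset: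
  assumes d: "darts C v e" and d': "darts D v e" and D: "D \<subseteq> C" and pl: "planar C v e"
  shows "planar D v e"
  unfolding planar_def
proof (intro allI impI)
  fix w :: "'a \<Rightarrow> real"
  assume w: "\<forall>x\<in>D. w (e x) = - w x" "\<forall>x\<in>D. osum (v \<circ> e) w x = 0"
  define w' where "w' x = (if x \<in> D then w x else 0)" for x
  have "w' (e x) = - w' x" for x using w(1) dartsD(5)[OF d', of x] by (simp add: w'_def)
  moreover have "osum (v \<circ> e) w' x = 0" for x
  proof (cases "x \<in> D")
    case True
    then have "osum (v \<circ> e) w' x = osum (v \<circ> e) w x"
      unfolding osum_def by (intro sum.cong) (use darts_face_subset[OF d' True] in \<open>auto simp: w'_def\<close>)
    then show ?thesis using w(2) True by simp
  next
    case False
    have "orbit (v \<circ> e) x \<subseteq> - D" by (rule orbit_closed) (use dartsD(4,5)[OF d'] False in auto)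
    then show ?thesis unfolding osum_def by (intro sum.neutral) (auto simp: w'_def)
  qed
  ultimately obtain p where p: "\<forall>x\<in>C. p (v x) = p x \<and> w' x = p (e x) - p x"
    using pl unfolding planar_def by blast
  then show "\<exists>p. \<forall>x\<in>D. p (v x) = p x \<and> w x = p (e x) - p x"
    using D by (intro exI[of _ p] ballI) (metis subsetD w'_def)
qed

lemma card_Plus_image: "finite A \<Longrightarrow> card (A <+> {..<n}) = card A + n" for n :: nat
  by (simp add: card_Plus)

lemma component_of_eq:
  assumes m: "is_map M"
  shows "component_of M x = gorbit {vperm M, erev M} x \<union> gorbit {vperm M, erev M} (alpha2 M x)"
    and "y \<in> gorbit {vperm M, erev M} x \<Longrightarrow> alpha2 M y \<in> gorbit {vperm M, erev M} (alpha2 M x)"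
proof -
  note * = is_mapD[OF m]
  let ?G = "gorbit {vperm M, erev M}"
  show 2: "alpha2 M y \<in> ?G (alpha2 M x)" if "y \<in> ?G x" for x y using that
  proof (induct rule: gorbit2_induct)
    case (v u)
    have "vperm M (alpha2 M (vperm M u)) = alpha2 M u" using * by (simp add: vperm_def)
    then show ?case using gorbit2_iff(1)[of "vperm M" "alpha2 M (vperm M u)" "erev M" "alpha2 M x"] by simp
  next
    case (e u)
    have "alpha2 M (erev M u) = erev M (alpha2 M u)" using * by (simp add: erev_def)
    then show ?case using gorbit2_iff(2)[of "erev M" "alpha2 M u" "vperm M" "alpha2 M x"] by simp
  qed simp
  let ?S = "?G x \<union> ?G (alpha2 M x)"
  have S2: "alpha2 M u \<in> ?S" if "u \<in> ?S" for u using that 2[of u x] 2[of u "alpha2 M x"] *(7) by auto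
  have S1: "alpha1 M u \<in> ?S" if "u \<in> ?S" for u
  proof -
    have "vperm M (alpha2 M u) \<in> ?S" using S2[OF that] by (simp add: gorbit2_iff)
    then show ?thesis using *(7) by (simp add: vperm_def)
  qed
  have S0: "alpha0 M u \<in> ?S" if "u \<in> ?S" for u
  proof -
    have "erev M (alpha2 M u) \<in> ?S" using S2[OF that] by (simp add: gorbit2_iff)
    then show ?thesis using *(7) by (simp add: erev_def)
  qed
  show "component_of M x = ?S"
  proof
    show "component_of M x \<subseteq> ?S"
    proof
      fix y assume "y \<in> component_of M x"
      then have "y \<in> gorbit {alpha0 M, alpha1 M, alpha2 M} x" by (simp add: component_of_def)
      then show "y \<in> ?S"
      proof (induct rule: gorbit_induct)
        case base show ?case by simp
      next
        case (step u f)
        then consider "f = alpha0 M" | "f = alpha1 M" | "f = alpha2 M" by blast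
        then show ?case
          using S0[of u] S0[of "alpha0 M u"] S1[of u] S1[of "alpha1 M u"] S2[of u] S2[of "alpha2 M u"] *(5-7)[of u]
          by cases metis+
      qed
    qed
    have "?G z \<subseteq> component_of M z" for z by (rule subsetI) (rule gorbit_subset_component_of)
    moreover have "component_of M (alpha2 M x) = component_of M x"
      unfolding component_of_def by (rule gorbit_eq) (simp add: gorbit_step)
    ultimately show "?S \<subseteq> component_of M x" by blast
  qed
qed

text \<open>All crosses together form a rotation system with 2V vertices, 2E edges, 2F faces, at
  most 4E darts and at most 2K components. Euler genus zero makes its Euler inequality an equality,
  so all these bounds are attained: every edge has four crosses, every component falls into two
  orientation classes, and the system is planar.\<close>

lemma plane_orientable:
  assumes m: "is_map M" and eg: "euler_genus M = 0"
  obtains D where "orients D M" "planar D (vperm M) (erev M)"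
proof -
  note * = is_mapD[OF m]
  let ?C = "crosses M" and ?G = "gorbit {vperm M, erev M}"
  have inv: "fpf_involution_on ?C (alpha0 M)" "fpf_involution_on ?C (alpha1 M)" "fpf_involution_on ?C (alpha2 M)"
    using m by (auto simp: is_map_def)
  have d: "darts ?C (vperm M) (erev M)" by (rule map_darts[OF m])
  define V E F K where "V = card (vertex_of M ` ?C)" and "E = card (edge_of M ` ?C)"
    and "F = card (face_of M ` ?C)" and "K = card (component_of M ` ?C)"
  have cv: "card (orbit (vperm M) ` ?C) = 2 * V" unfolding V_def by (rule card_vertex_cycles[OF m])
  have ce: "card (orbit (erev M) ` ?C) = 2 * E"
    using card_cycles_involutions[OF *(1) inv(1,3)] unfolding E_def by (simp add: erev_def edge_of_def[abs_def])
  have cf: "card (orbit (vperm M \<circ> erev M) ` ?C) = 2 * F"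
    using card_cycles_involutions[OF *(1) inv(2,1)] unfolding F_def fperm_eq[OF m]
    by (simp add: fperm_def face_of_def[abs_def] insert_commute)
  have dbl: "finite ?C" "\<And>x. x \<in> ?C \<Longrightarrow> alpha2 M x \<in> ?C" "\<And>x. x \<in> ?C \<Longrightarrow> alpha2 M (alpha2 M x) = x"
    "\<And>x. x \<in> ?C \<Longrightarrow> x \<in> ?G x" "\<And>x. x \<in> ?C \<Longrightarrow> ?G x \<subseteq> ?C" "\<And>x y. x \<in> ?C \<Longrightarrow> y \<in> ?G x \<Longrightarrow> ?G y = ?G x"
    "\<And>x y. x \<in> ?C \<Longrightarrow> y \<in> ?G x \<Longrightarrow> ?G (alpha2 M y) = ?G (alpha2 M x)"
    "\<And>x. x \<in> ?C \<Longrightarrow> component_of M x = ?G x \<union> ?G (alpha2 M x)"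
  proof -
    fix x assume x: "x \<in> ?C"
    show "alpha2 M x \<in> ?C" "alpha2 M (alpha2 M x) = x" "x \<in> ?G x" using x * by auto
    show "?G x \<subseteq> ?C" by (rule darts_gorbit_subset[OF d x])
    show "component_of M x = ?G x \<union> ?G (alpha2 M x)" by (rule component_of_eq(1)[OF m])
    fix y assume y: "y \<in> ?G x"
    show "?G y = ?G x" by (rule gorbit_eq[OF y])
    show "?G (alpha2 M y) = ?G (alpha2 M x)" by (rule gorbit_eq[OF component_of_eq(2)[OF m y]])
  qed (rule *(1))
  have k: "card (?G ` ?C) \<le> 2 * K" unfolding K_def
    by (rule card_double_classes(1)[where r = "alpha2 M"]) (fact dbl)+
  have edge4: "card (edge_of M x) \<le> 4" for x
    unfolding edge_of_eq[OF m] using card_length[of "[x, alpha0 M x, alpha2 M x, erev M x]"] by simp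
  have U: "?C \<subseteq> \<Union>(edge_of M ` ?C)" by (auto simp: edge_of_def)
  have fe: "finite (\<Union>(edge_of M ` ?C))" using *(1) by (auto simp: edge_of_eq[OF m])
  have cC: "card ?C \<le> (\<Sum>B\<in>edge_of M ` ?C. card B)"
    using card_mono[OF fe U] card_Union_le_sum_card[of "edge_of M ` ?C"] by linarith
  also have "\<dots> \<le> (\<Sum>B\<in>edge_of M ` ?C. 4)" by (rule sum_mono) (use edge4 in auto)
  finally have C4: "card ?C \<le> 4 * E" by (simp add: E_def)
  have fin: "finite (vertex_of M ` ?C)" "finite (face_of M ` ?C)" "finite (component_of M ` ?C)" using *(1) by auto
  have eg': "2 * int K = int V - int E + int F"
    using eg unfolding euler_genus_def euler_char_def vertices_def faces_def map_components_def edges_def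
      card_Plus_image[OF fin(1)] card_Plus_image[OF fin(2)] card_Plus_image[OF fin(3)] V_def E_def F_def K_def
    by simp
  have eul: "2 * V + 2 * E + 2 * F \<le> card ?C + 2 * card (?G ` ?C)"
    "2 * V + 2 * E + 2 * F = card ?C + 2 * card (?G ` ?C) \<longrightarrow> planar ?C (vperm M) (erev M)"
    using euler_planar[OF d] unfolding cv ce cf by auto
  have sum: "V + F = 2 * K + E" using eg' by linarith
  have Keq: "card (?G ` ?C) = 2 * K" and Ceq: "card ?C = 4 * E" using sum eul(1) k C4 by linarith+
  have pl: "planar ?C (vperm M) (erev M)" using eul(2) sum Keq Ceq by linarith
  have nondeg: "erev M x \<noteq> x" if x: "x \<in> ?C" for x
  proof
    assume ex: "erev M x = x"
    then have "alpha0 M x = alpha2 M x" using *(5,7) by (metis erev_def comp_apply)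
    then have "edge_of M x = {x, alpha2 M x}" using ex unfolding edge_of_eq[OF m] by auto
    then have "card (edge_of M x) < 4" by (simp add: card_insert_if)
    then have "(\<Sum>B\<in>edge_of M ` ?C. card B) < (\<Sum>B\<in>edge_of M ` ?C. 4)"
      using x *(1) edge4 by (intro sum_strict_mono_ex1) auto
    then show False using cC Ceq by (simp add: E_def)
  qed
  have ne: "?G x \<noteq> ?G (alpha2 M x)" if "x \<in> ?C" for x
    by (rule card_double_classes(3)[where r = "alpha2 M" and h = "component_of M"])
       (fact dbl Keq[unfolded K_def] that)+
  \<comment> \<open>A representative of each component selects one of its two classes.\<close>
  define r where "r K = (SOME y :: 'a. y \<in> K)" for K
  define D where "D = {x \<in> ?C. r (component_of M x) \<in> ?G x}"
  have rin: "r (component_of M x) \<in> component_of M x" for x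
    unfolding r_def by (rule someI[of _ x]) (simp add: component_of_def)
  have flip2: "alpha2 M x \<in> D \<longleftrightarrow> x \<notin> D" if x: "x \<in> ?C" for x
  proof -
    have c: "component_of M (alpha2 M x) = component_of M x"
      unfolding component_of_def by (rule gorbit_eq) (simp add: gorbit_step)
    have "r (component_of M x) \<in> ?G x \<or> r (component_of M x) \<in> ?G (alpha2 M x)"
      using rin[of x] component_of_eq(1)[OF m, of x] by blast
    moreover have "\<not> (r (component_of M x) \<in> ?G x \<and> r (component_of M x) \<in> ?G (alpha2 M x))"
      using ne[OF x] gorbit_eq by metis
    ultimately show ?thesis using x *(4) c by (auto simp: D_def)
  qed
  have D_inv: "y \<in> D \<longleftrightarrow> x \<in> D" if y: "y \<in> ?G x" for x y
  proof -
    have "component_of M y = component_of M x"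
      using gorbit_subset_component_of[OF y] unfolding component_of_def by (rule gorbit_eq)
    moreover have "y \<in> ?C \<longleftrightarrow> x \<in> ?C" using y gorbit_sym[OF y] darts_gorbit_subset[OF d] by blast
    ultimately show ?thesis using gorbit_eq[OF y] by (simp add: D_def)
  qed
  have "orients D M"
    unfolding orients_def
  proof (intro conjI ballI)
    show "D \<subseteq> ?C" by (auto simp: D_def)
    fix c assume c: "c \<in> ?C"
    show "alpha2 M c \<in> D \<longleftrightarrow> c \<notin> D" by (rule flip2[OF c])
    have "alpha1 M c \<in> ?G (alpha2 M c)" "alpha0 M c \<in> ?G (alpha2 M c)"
      using gorbit_step[of "vperm M" "{vperm M, erev M}" "alpha2 M c"] gorbit_step[of "erev M" "{vperm M, erev M}" "alpha2 M c"] *(7)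
      by (simp_all add: vperm_def erev_def)
    then show "alpha0 M c \<in> D \<longleftrightarrow> c \<notin> D" "alpha1 M c \<in> D \<longleftrightarrow> c \<notin> D" using D_inv flip2[OF c] by blast+
    show "erev M c \<noteq> c" by (rule nondeg[OF c])
  qed
  moreover from this have "planar D (vperm M) (erev M)"
    using planar_subset[OF d orients_darts[OF m] _ pl] orientsD(1) by blast
  ultimately show ?thesis by (rule that)
qed

text \<open>For a nonempty map the factors relating the two genera are nonzero: there is at least
  one orientation class, and twice their number minus 3 is odd.\<close>

lemma signed_genus_0_iff:
  assumes m: "is_map M"
  shows "signed_genus M = 0 \<longleftrightarrow> euler_genus M = 0"
proof (cases "map_components M = {}")
  case True
  then have "crosses M = {}" "isolated M = 0" by (auto simp: map_components_def lessThan_empty_iff Plus_def)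
  then have "euler_genus M = 0"
    by (simp add: euler_genus_def euler_char_def vertices_def edges_def faces_def map_components_def Plus_def)
  then show ?thesis by (simp add: signed_genus_def genus_def)
next
  case False
  note * = is_mapD[OF m]
  have fin: "finite (map_components M)" using *(1) by (simp add: map_components_def)
  have "comp_orient M K \<ge> 1" if K: "K \<in> map_components M" for K
  proof (cases K)
    case (Inl A)
    then obtain c where c: "c \<in> crosses M" "A = component_of M c"
      using K by (auto simp: map_components_def)
    have "A \<subseteq> crosses M" unfolding c(2) component_of_def
      by (rule gorbit_closed) (use * c(1) in auto)
    then have "finite A" using *(1) finite_subset by blast
    moreover have "A \<noteq> {}" unfolding c(2) component_of_def using gorbit_self by fastforce
    ultimately show ?thesis using Inl by (simp add: comp_orient_def gorbits_def Suc_leI card_gt_0_iff)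
  qed (simp add: comp_orient_def)
  then have "orient M \<ge> 1" unfolding orient_def using fin False by simp
  moreover have "2 * real (orient M) - 3 \<noteq> 0"
  proof
    assume "2 * real (orient M) - 3 = 0"
    then have "real (2 * orient M) = real 3" by simp
    then have "2 * orient M = 3" by (rule of_nat_eq_iff[THEN iffD1])
    then show False by presburger
  qed
  ultimately show ?thesis by (simp add: signed_genus_def genus_def)
qed

section \<open>Folding a map along a tension\<close>

lemma gorbit_cong:
  assumes d: "darts D v e" and d': "darts D v' e'"
    and eq: "\<And>x. x \<in> D \<Longrightarrow> v x = v' x" "\<And>x. x \<in> D \<Longrightarrow> e x = e' x" and x: "x \<in> D"
  shows "gorbit {v, e} x = gorbit {v', e'} x"
proof -
  have key: "y \<in> gorbit {w, g} x"
    if "y \<in> gorbit {w', g'} x" "darts D w' g'" "\<And>x. x \<in> D \<Longrightarrow> w x = w' x" "\<And>x. x \<in> D \<Longrightarrow> g x = g' x" for w g w' g' y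
  proof -
    from that(1) have "y \<in> D \<and> y \<in> gorbit {w, g} x"
    proof (induct rule: gorbit2_induct)
      case base then show ?case using x by simp
    next
      case (v u)
      show ?case using dartsD(4)[OF that(2), of u] that(3)[of u] gorbit2_iff(1)[of w u g x] by metis
    next
      case (e u)
      show ?case using dartsD(5)[OF that(2), of u] that(4)[of u] gorbit2_iff(2)[of g u w x] by metis
    qed
    then show ?thesis by simp
  qed
  show ?thesis
  proof (intro subset_antisym subsetI)
    show "y \<in> gorbit {v', e'} x" if "y \<in> gorbit {v, e} x" for y by (rule key[OF that d]) (use eq in auto)
    show "y \<in> gorbit {v, e} x" if "y \<in> gorbit {v', e'} x" for y by (rule key[OF that d']) (use eq in auto)
  qed
qed

lemma orbit_two: "f x = y \<Longrightarrow> f y = x \<Longrightarrow> orbit f x = {x, y}"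
proof -
  assume *: "f x = y" "f y = x"
  have "(f ^^ 2) x = x" using * by (simp add: numeral_2_eq_2)
  then have "orbit f x = {(f ^^ m) x | m. m < 2}" by (rule orbit_altdef_bounded) simp
  also have "\<dots> = {x, y}" using * by (auto simp: less_2_cases_iff intro: exI[of _ 0] exI[of _ "Suc 0"])
  finally show ?thesis .
qed

definition tension_map :: "'a premap \<Rightarrow> 'a set \<Rightarrow> int \<Rightarrow> ('a \<Rightarrow> int) \<Rightarrow> bool" where
  "tension_map M D n t \<longleftrightarrow> is_map M \<and> orients D M \<and> planar D (vperm M) (erev M) \<and> tens D (vperm M) (erev M) n t"

abbreviation connected_darts :: "'a premap \<Rightarrow> 'a set \<Rightarrow> bool" where
  "connected_darts M D \<equiv> \<forall>x\<in>D. \<forall>y\<in>D. y \<in> gorbit {vperm M, erev M} x"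

lemma swap_at_transfer:
  assumes m: "is_map M" and o: "orients D M" and ab: "a \<in> D" "b \<in> D"
  shows "is_map (swap_at M a b)" "orients D (swap_at M a b)"
    "planar D (transpose a b \<circ> vperm M) (erev M) \<Longrightarrow> planar D (vperm (swap_at M a b)) (erev (swap_at M a b))"
    "tens D (vperm (swap_at M a b)) (erev (swap_at M a b)) n t \<longleftrightarrow> tens D (transpose a b \<circ> vperm M) (erev M) n t"
    "x \<in> D \<Longrightarrow> gorbit {vperm (swap_at M a b), erev (swap_at M a b)} x = gorbit {transpose a b \<circ> vperm M, erev M} x"
proof -
  have C: "a \<in> crosses M" "b \<in> crosses M" using ab orientsD(1)[OF o] by auto
  show m': "is_map (swap_at M a b)" by (rule is_map_swap_at[OF m C])
  show o': "orients D (swap_at M a b)" by (rule orients_swap_at[OF o m ab])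
  note d1 = darts_transpose[OF orients_darts[OF m o] ab] and d2 = orients_darts[OF m' o']
  note eq = vperm_swap_at[OF o ab]
  show "planar D (transpose a b \<circ> vperm M) (erev M) \<Longrightarrow> planar D (vperm (swap_at M a b)) (erev (swap_at M a b))"
    by (rule planar_cong[OF d1 d2]) (use eq in auto)
  show "tens D (vperm (swap_at M a b)) (erev (swap_at M a b)) n t \<longleftrightarrow> tens D (transpose a b \<circ> vperm M) (erev M) n t"
    using tens_cong[OF d1 d2, of t t n] tens_cong[OF d2 d1, of t t n] eq by auto
  show "x \<in> D \<Longrightarrow> gorbit {vperm (swap_at M a b), erev (swap_at M a b)} x = gorbit {transpose a b \<circ> vperm M, erev M} x"
    by (rule gorbit_cong[OF d2 d1]) (use eq in auto)
qed

lemma gluing_face: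
  assumes m: "is_map M" and o: "orients D M" and ab: "a \<in> D" "b \<in> D" "a \<noteq> b"
    and bv: "b \<notin> orbit (vperm M) a" and bf: "b \<in> orbit (vperm M \<circ> erev M) a \<or> b \<notin> gorbit {vperm M, erev M} a"
  shows "gluing M (swap_at M a b)"
proof -
  have C: "a \<in> crosses M" "b \<in> crosses M" using ab orientsD(1)[OF o] by auto
  have "vertex_of M a \<noteq> vertex_of M b"
  proof
    assume "vertex_of M a = vertex_of M b"
    then have "b \<in> vertex_of M a" by (simp add: vertex_of_def)
    then show False using vertex_of_oriented[OF m o ab(1,2)] bv by blast
  qed
  moreover have "b \<in> orbit (fperm M) a \<or> component_of M a \<noteq> component_of M b"
    using bf
  proof
    assume "b \<notin> gorbit {vperm M, erev M} a"
    then have "b \<notin> component_of M a" using component_of_oriented[OF m o ab(1), of b] ab(2) by auto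
    then show ?thesis by (auto simp: component_of_def)
  qed (simp add: fperm_eq[OF m])
  ultimately show ?thesis using C ab(3) unfolding gluing_def by (blast intro: glue_crosses)
qed

text \<open>Opposite values of \<open>t\<close> around the face mean that its two parallel edges
  have the same direction, so one of them can be deleted without affecting the tension.\<close>

lemma remove_digon:
  assumes s: "tension_map M D n t" and cc: "c0 \<in> D" "vperm M (erev M c0) = c1" "vperm M (erev M c1) = c0"
    "c1 \<noteq> c0" "erev M c1 \<noteq> c0" and t: "t c0 \<noteq> t c1" and conn: "connected_darts M D"
  shows "\<exists>N D'. gluing M N \<and> tension_map N D' n t \<and> connected_darts N D' \<and> card D' < card D"
proof -
  have m: "is_map M" and o: "orients D M" and pl: "planar D (vperm M) (erev M)" and T: "tens D (vperm M) (erev M) n t"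
    using s by (auto simp: tension_map_def)
  let ?X = "edge_of M c1"
  let ?N = "delete_edges M {?X}" and ?D = "D - ?X"
  have d: "darts D (vperm M) (erev M)" by (rule orients_darts[OF m o])
  interpret duplicate D ?D "vperm M" "erev M" "vperm ?N" "erev ?N" c0 c1 "erev M c1"
    by (rule duplicate_delete[OF m o cc])
  have c1D: "c1 \<in> D" using cc(1,2) dartsD(4,5)[OF d] by metis
  have C: "c0 \<in> crosses M" "c1 \<in> crosses M" using cc(1) c1D orientsD(1)[OF o] by auto
  have E: "{?X} \<subseteq> edges M" using C by (simp add: edges_def)
  have "is_map ?N" by (rule is_map_delete_edges[OF m E])
  moreover have "orients ?D ?N" using orients_delete_edges[OF m E o] by simp
  moreover have "planar ?D (vperm ?N) (erev ?N)" by (rule planar_remove[OF pl])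
  moreover have "t c0 = t (erev M c1)" "t c1 = - t (erev M c1)"
    using tensD(1,2)[OF T c1D] tensD(1)[OF T cc(1)] t by auto
  then have "tens ?D (vperm ?N) (erev ?N) n t" using tens_iff[of t n] T by blast
  ultimately have st: "tension_map ?N ?D n t" by (simp add: tension_map_def)
  have "c0 \<notin> ?X" using ec0(5) by blast
  then have ne: "edge_of M c0 \<noteq> ?X" by (auto simp: edge_of_def)
  have deg: "face_degree M c0 = 2" using digon(1) cc(4) by (simp add: face_degree_def fperm_eq[OF m])
  have "c1 = alpha1 M (alpha0 M c0)" using cc(2) fperm_eq[OF m] by (metis comp_apply fperm_def)
  then have "c1 \<in> face_of M c0" by (simp add: face_of_def gorbit2_iff)
  moreover have "c0 \<in> face_of M c0" by (simp add: face_of_def)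
  moreover have "c0 \<in> edge_of M c0" "c1 \<in> ?X" by (simp_all add: edge_of_def)
  ultimately have "duplicate_edges M (edge_of M c0) ?X"
    unfolding duplicate_edges_def using C ne deg by (auto simp: edges_def intro!: bexI[of _ c0])
  then have g: "gluing M ?N" unfolding gluing_def by (blast intro: duplicate_gluing.intros)
  have "connected_darts ?N ?D"
  proof (intro ballI)
    fix x y assume xy: "x \<in> ?D" "y \<in> ?D"
    then have "\<rho> y \<in> gorbit {vperm ?N, erev ?N} (\<rho> x)" using conn by (intro gorbit_down) auto
    moreover have "\<rho> x = x" "\<rho> y = y" using xy D1 by (auto simp: \<rho>_def)
    ultimately show "y \<in> gorbit {vperm ?N, erev ?N} x" by simp
  qed
  moreover have "c1 \<in> ?X" by (simp add: edge_of_def)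
  then have "?D \<subset> D" using c1D by blast
  then have "card ?D < card D" by (rule psubset_card_mono[OF dartsD(1)[OF d]])
  ultimately show ?thesis using g st by blast
qed

lemma fold_step:
  assumes s: "tension_map M D n t" and n: "n \<ge> 2" and conn: "connected_darts M D"
    and c: "c \<in> D" "t c \<noteq> t (vperm M (erev M c))" "vperm M (erev M (vperm M (erev M c))) \<noteq> c"
  shows "\<exists>N D' t'. gluing\<^sup>*\<^sup>* M N \<and> tension_map N D' n t' \<and> connected_darts N D' \<and> card D' < card D"
proof -
  let ?v = "vperm M" and ?e = "erev M"
  have m: "is_map M" and o: "orients D M" and pl: "planar D ?v ?e" and T: "tens D ?v ?e n t"
    using s by (auto simp: tension_map_def)
  have d: "darts D ?v ?e" by (rule orients_darts[OF m o])
  obtain t x where T: "tens D ?v ?e n t" and x: "x \<in> D" "t x \<noteq> t (?v (?e x))" "?v (?e (?v (?e x))) \<noteq> x"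
    "?v (?e (?v (?e x))) \<notin> orbit ?v x"
    using fold_exists[OF d pl T n c] by blast
  define y where "y = ?v (?e x)" define z where "z = ?v (?e y)"
  have D: "y \<in> D" "z \<in> D" using x(1) dartsD(4,5)[OF d] by (simp_all add: y_def z_def)
  have f: "permutation (?v \<circ> ?e)" by (rule dartsD(7)[OF d])
  have zx: "z \<noteq> x" "z \<notin> orbit ?v x" using x by (simp_all add: y_def z_def)
  have yx: "y \<noteq> x" "t x \<noteq> t y" using x(2) by (auto simp: y_def)
  have yz: "y \<noteq> z" using permutation_inj[OF f, of x y] yx by (simp add: y_def z_def)
  have zf: "z \<in> orbit (?v \<circ> ?e) x"
    using orbit.step[OF orbit.base[of "?v \<circ> ?e" x]] by (simp add: y_def z_def)
  \<comment> \<open>Gluing at \<open>x\<close> and \<open>z\<close> cuts the two opposite darts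
    \<open>x\<close> and \<open>y\<close> off as a face of degree two and sum zero.\<close>
  let ?g = "transpose x z \<circ> (?v \<circ> ?e)"
  have g: "?g x = y" "?g y = x" using yx yz by (simp_all add: y_def[symmetric] z_def[symmetric])
  have "orbit ?g x = {x, y}" by (rule orbit_two[OF g])
  then have "osum ?g t x = t x + t y" using yx(1) by (simp add: osum_def)
  then have s0: "osum ?g t x = 0" using tensD(1)[OF T x(1)] tensD(1)[OF T D(1)] yx(2) by auto
  let ?M = "swap_at M x z"
  note tr = swap_at_transfer[OF m o x(1) D(2)]
  have gl: "gluing M ?M" by (rule gluing_face[OF m o x(1) D(2) zx(1)[symmetric] zx(2)]) (use zf in blast)
  have "planar D (vperm ?M) (erev ?M)"
    by (rule tr(3)[OF planar_glue_same_face[OF d x(1) D(2) zx(1)[symmetric] zf pl]])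
  moreover have "tens D (vperm ?M) (erev ?M) n t"
    unfolding tr(4) by (rule tens_glue_same_face[OF d x(1) D(2) zx(1)[symmetric] zf zx(2) T s0])
  ultimately have st: "tension_map ?M D n t" using tr(1,2) by (simp add: tension_map_def)
  have cn: "connected_darts ?M D" using tr(5) gorbit_glue_same_face[OF d zf zx(2)] conn by simp
  have "vperm ?M (erev ?M x) = y" "vperm ?M (erev ?M y) = x"
    using vperm_swap_at[OF o x(1) D(2), of "?e x"] vperm_swap_at[OF o x(1) D(2), of "?e y"] g x(1) D(1) dartsD(5)[OF d]
    by simp_all
  moreover have "erev ?M y \<noteq> x"
  proof
    assume "erev ?M y = x"
    then have "z = ?v x" by (simp add: z_def)
    then show False using zx(2) orbit.base by metis
  qed
  ultimately obtain N D' where "gluing ?M N" "tension_map N D' n t" "connected_darts N D'" "card D' < card D"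
    using remove_digon[OF st x(1) _ _ yx(1) _ yx(2) cn] by blast
  moreover have "gluing\<^sup>*\<^sup>* M N" using gl calculation(1) by (meson rtranclp.simps)
  ultimately show ?thesis by blast
qed

text \<open>\<open>x j\<close> is the dart from the j-th vertex to the next one. The two equations
  for \<open>vperm M\<close> say that this next vertex carries just the reverse of
  \<open>x j\<close> and the dart after \<open>x j\<close>. The number of isolated vertices is left
  open and handled separately.\<close>

definition cycle_struct :: "'a premap \<Rightarrow> 'a set \<Rightarrow> (nat \<Rightarrow> 'a) \<Rightarrow> nat \<Rightarrow> bool" where
  "cycle_struct M D x n \<longleftrightarrow> is_map M \<and> orients D M \<and> D = x ` {..<n} \<union> erev M ` x ` {..<n} \<and>
     inj_on x {..<n} \<and> (\<forall>i<n. \<forall>j<n. x i \<noteq> erev M (x j)) \<and>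
     (\<forall>j<n. vperm M (erev M (x j)) = x (Suc j mod n) \<and> vperm M (x (Suc j mod n)) = erev M (x j))"

text \<open>Without a fold \<open>t\<close> is constant around each face, so the face sums force all
  faces to have length \<open>n\<close>, and uniqueness leaves one face with \<open>t = 1\<close>
  and one with \<open>t = -1\<close>. All edges lie between these two faces, and the remaining point
  is that every vertex has degree two.\<close>

lemma unfoldable_cycle:
  assumes s: "tension_map M D (int n) t" and conn: "connected_darts M D" and n: "n > 0" and c0: "D \<noteq> {}"
    and t: "\<And>x. x \<in> D \<Longrightarrow> t (vperm M (erev M x)) = t x"
  shows "\<exists>x. cycle_struct M D x n"
proof -
  let ?v = "vperm M" and ?e = "erev M" let ?f = "?v \<circ> ?e"
  have m: "is_map M" and o: "orients D M" and pl: "planar D ?v ?e" and T: "tens D ?v ?e (int n) t"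
    using s by (auto simp: tension_map_def)
  have d: "darts D ?v ?e" by (rule orients_darts[OF m o])
  note v = dartsD(2)[OF d] and f = dartsD(7)[OF d] and eD = dartsD(5)[OF d] and vD = dartsD(4)[OF d] and ee = dartsD(6)[OF d]
  have to: "t y = t x" if "x \<in> D" "y \<in> orbit ?f x" for x y
    using that(2)
  proof induct
    case base then show ?case using t that(1) by simp
  next
    case (step y)
    then have "y \<in> D" using darts_face_subset[OF d that(1)] by blast
    then show ?case using step t by simp
  qed
  have os: "osum ?f t x = t x * int (card (orbit ?f x))" if "x \<in> D" for x
    unfolding osum_def using to[OF that] by (simp add: mult.commute)
  have cn: "card (orbit ?f x) = n" if x: "x \<in> D" for x
  proof -
    have "card (orbit ?f x) > 0"
      using finite_orbit_permutation[OF f, of x] permutation_self_in_orbit[OF f, of x] by (auto simp: card_gt_0_iff)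
    then show ?thesis using os[OF x] tensD(1,3)[OF T x] by auto
  qed
  have same: "y \<in> orbit ?f x" if "x \<in> D" "y \<in> D" "t x = t y" for x y
    by (rule tens_unique[OF T that(1,2)]) (use conn that os cn n tensD(1)[OF T that(1)] in auto)
  obtain c where c: "c \<in> D" "t c = 1"
  proof -
    obtain x where "x \<in> D" using c0 by blast
    then show ?thesis using that[of x] that[of "?e x"] tensD(1,2)[OF T, of x] eD by auto
  qed
  define x where "x j = (?f ^^ j) c" for j
  have co: "c \<in> orbit ?f c" by (rule permutation_self_in_orbit[OF f])
  note oc = orbit_conv_funpow_dist1[OF co] and inj = inj_on_funpow_dist1[OF co]
  have "card (orbit ?f c) = funpow_dist1 ?f c c" unfolding oc using card_image[OF inj] by simp
  then have fd: "funpow_dist1 ?f c c = n" using cn[OF c(1)] by simp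
  have orb: "orbit ?f c = x ` {..<n}" unfolding oc fd x_def by (simp add: lessThan_atLeast0)
  have injx: "inj_on x {..<n}" using inj unfolding fd x_def[abs_def] by (simp add: lessThan_atLeast0)
  have xn: "x n = c" using funpow_dist1_prop[OF co] unfolding fd x_def .
  have tx: "x j \<in> D" "t (x j) = 1" if "j < n" for j
  proof -
    have "x j \<in> orbit ?f c" using orb that by blast
    then show "x j \<in> D" "t (x j) = 1" using darts_face_subset[OF d c(1)] to[OF c(1)] c(2) by auto
  qed
  have DD: "D = x ` {..<n} \<union> ?e ` x ` {..<n}"
  proof
    show "x ` {..<n} \<union> ?e ` x ` {..<n} \<subseteq> D" using tx(1) eD by auto
    show "D \<subseteq> x ` {..<n} \<union> ?e ` x ` {..<n}"
    proof
      fix y assume y: "y \<in> D"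
      show "y \<in> x ` {..<n} \<union> ?e ` x ` {..<n}"
      proof (cases "t y = 1")
        case True then show ?thesis using same[OF c(1) y] c(2) orb by auto
      next
        case False
        then have "t (?e y) = 1" using tensD(1,2)[OF T y] by auto
        then have "?e y \<in> x ` {..<n}" using same[OF c(1), of "?e y"] y eD c(2) orb by auto
        then show ?thesis using ee[of y] by (metis UnI2 imageI)
      qed
    qed
  qed
  have sep: "x i \<noteq> ?e (x j)" if "i < n" "j < n" for i j
    using tx[OF that(1)] tx[OF that(2)] tensD(2)[OF T, of "x j"] by auto
  \<comment> \<open>Rotation alternates the sign of \<open>t\<close>, so \<open>y\<close> and
    \<open>?v (?v y)\<close> lie in the same face. If they differed, splitting the vertex there
    would disconnect them, although the face on the other side of their edges is untouched and
    connects them.\<close>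
  have vv: "?v (?v y) = y" if y: "y \<in> D" for y
  proof (rule ccontr)
    assume ne: "?v (?v y) \<noteq> y"
    have vt: "t (?v u) = - t u" if "u \<in> D" for u
      using t[of "?e u"] that eD ee tensD(2)[OF T that] by simp
    let ?b = "?v (?v y)"
    have bD: "?b \<in> D" and tb: "t ?b = t y" using y vD vt by auto
    have bv: "?b \<in> orbit ?v y" by (intro orbit.step orbit.base)
    have bf: "?b \<in> orbit ?f y" using same[OF y bD] tb by simp
    let ?w = "transpose y ?b \<circ> ?v" and ?g = "transpose y ?b \<circ> ?f"
    have dis: "?b \<notin> gorbit {?w, ?e} y" by (rule split_disconnects[OF d pl y bD ne[symmetric] bv bf])
    have ey: "?e y \<in> D" "?e ?b \<in> D" "t (?e y) = - t y" "t (?e ?b) = - t y"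
      using y bD eD tensD(2)[OF T y] tensD(2)[OF T bD] tb by auto
    have eb: "?e ?b \<in> orbit ?f (?e y)" using same[OF ey(1,2)] ey(3,4) by simp
    have "y \<notin> orbit ?f (?e y)" "?b \<notin> orbit ?f (?e y)"
      using to[OF ey(1), of y] to[OF ey(1), of ?b] ey(3) tb tensD(1)[OF T y] by auto
    then have "orbit ?g (?e y) = orbit ?f (?e y)" by (rule orbit_transpose_other[OF f])
    then have "?e ?b \<in> orbit (?w \<circ> ?e) (?e y)" using eb by (simp add: transpose_comp_assoc)
    then have "?e ?b \<in> gorbit {?w, ?e} y"
      using gorbit_face_subset[of "?e y" ?w ?e y] by (auto simp: gorbit2_iff(2))
    then show False using dis gorbit2_iff(2)[of ?e ?b ?w y] by simp
  qed
  have step: "?v (?e (x j)) = x (Suc j mod n)" if "j < n" for j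
  proof -
    have "?v (?e (x j)) = x (Suc j)" by (simp add: x_def)
    also have "\<dots> = x (Suc j mod n)" using that xn by (cases "Suc j = n") (auto simp: x_def)
    finally show ?thesis .
  qed
  have "?v (x (Suc j mod n)) = ?e (x j)" if "j < n" for j
    using step[OF that] vv[of "?e (x j)"] tx(1)[OF that] eD by simp
  then have "cycle_struct M D x n" unfolding cycle_struct_def using m o DD injx sep step by blast
  then show "\<exists>x. cycle_struct M D x n" by (rule exI[where x = x])
qed

text \<open>The middle alternative is a single edge whose two ends have degree one.\<close>

definition fold_result :: "'a premap \<Rightarrow> nat \<Rightarrow> bool" where
  "fold_result L n \<longleftrightarrow> is_map L \<and> (crosses L = {} \<or>
     (\<exists>D c. orients D L \<and> D = {c, erev L c} \<and> vperm L c = c \<and> vperm L (erev L c) = erev L c) \<or>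
     (\<exists>D x. cycle_struct L D x n))"

text \<open>Each fold, and each removal of a face of degree two, deletes an edge, so the number of
  darts decreases until no opposite consecutive darts are left or only one edge is.\<close>

lemma fold_connected:
  assumes "tension_map M D (int n) t" "n \<ge> 2" "connected_darts M D"
  shows "\<exists>L. gluing\<^sup>*\<^sup>* M L \<and> fold_result L n"
  using assms
proof (induction "card D" arbitrary: M D t rule: less_induct)
  case less
  let ?v = "vperm M" and ?e = "erev M"
  have m: "is_map M" and o: "orients D M" using less.prems by (auto simp: tension_map_def)
  have d: "darts D ?v ?e" by (rule orients_darts[OF m o])
  have step: ?case if "gluing\<^sup>*\<^sup>* M N" "tension_map N D' (int n) t'" "connected_darts N D'" "card D' < card D" for N D' t'
    using less.hyps[OF that(4,2) less.prems(2) that(3)] that(1) by (meson rtranclp_trans)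
  show ?case
  proof (cases "\<exists>c\<in>D. t c \<noteq> t (?v (?e c))")
    case True
    then obtain c where c: "c \<in> D" "t c \<noteq> t (?v (?e c))" by blast
    let ?c = "?v (?e c)"
    show ?thesis
    proof (cases "?v (?e ?c) = c")
      case cc: True
      show ?thesis
      proof (cases "?c = ?e c")
        \<comment> \<open>The two darts of the face belong to one edge whose ends both have degree
          one, so by connectedness this edge carries all darts.\<close>
        case True
        have vc: "?v c = c" using cc True dartsD(6)[OF d] by simp
        have "D = {c, ?e c}"
        proof
          show "{c, ?e c} \<subseteq> D" using c dartsD(5)[OF d] by simp
          show "D \<subseteq> {c, ?e c}"
          proof
            fix y assume "y \<in> D"
            then have "y \<in> gorbit {?v, ?e} c" using less.prems(3) c by blast
            then show "y \<in> {c, ?e c}"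
            proof (induct rule: gorbit2_induct)
              case (v u)
              have "?v u = c \<longleftrightarrow> u = c" "?v u = ?e c \<longleftrightarrow> u = ?e c"
                using permutation_inj[OF dartsD(2)[OF d], of u c] permutation_inj[OF dartsD(2)[OF d], of u "?e c"] vc True by auto
              then show ?case by simp
            next
              case (e u)
              have "?e u = c \<longleftrightarrow> u = ?e c" "?e u = ?e c \<longleftrightarrow> u = c" using dartsD(6)[OF d] by metis+
              then show ?case by auto
            qed simp
          qed
        qed
        then have "fold_result M n" unfolding fold_result_def using m o vc True by auto
        then show ?thesis by blast
      next
        case False
        then have "?e ?c \<noteq> c" using dartsD(6)[OF d] by metis
        moreover have "?c \<noteq> c" using c(2) by metis
        ultimately obtain N D' where "gluing M N" "tension_map N D' (int n) t" "connected_darts N D'" "card D' < card D"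
          using remove_digon[OF less.prems(1) c(1) refl cc _ _ c(2) less.prems(3)] by blast
        then show ?thesis using step by blast
      qed
    next
      case False
      have "int n \<ge> 2" using less.prems by simp
      then show ?thesis using fold_step[OF less.prems(1) _ less.prems(3) c False] step by blast
    qed
  next
    case False
    show ?thesis
    proof (cases "D = {}")
      case True
      have "crosses M = {}" using True orientsD(4)[OF o] by fastforce
      then show ?thesis using m unfolding fold_result_def by blast
    next
      case D: False
      have "\<exists>x. cycle_struct M D x n"
        by (rule unfoldable_cycle[OF less.prems(1,3) _ D]) (use less.prems(2) False in auto)
      then show ?thesis using m unfolding fold_result_def by blast
    qed
  qed
qed

section \<open>Joining the components before folding\<close>

lemma tens_nonzero_components:
  assumes d: "darts D v e" and T: "tens D v e n t" and x: "x \<in> D" "y \<in> gorbit {v, e} x" "osum (v \<circ> e) t y \<noteq> 0" and s: "s = n \<or> s = - n"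
  shows "\<exists>z\<in>gorbit {v, e} x. osum (v \<circ> e) t z = s"
proof -
  let ?K = "gorbit {v, e} x" and ?f = "v \<circ> e"
  have KD: "?K \<subseteq> D" by (rule darts_gorbit_subset[OF d x(1)])
  have "\<exists>z\<in>?K. osum ?f t z = - osum ?f t y"
  proof (rule opposite_face[OF dartsD(7)[OF d]])
    show "finite ?K" using KD dartsD(1)[OF d] finite_subset by blast
    show "orbit ?f u \<subseteq> ?K" if "u \<in> ?K" for u by (rule gorbit_face_subset[OF that])
    show "osum ?f t u \<in> {0, n, -n}" if "u \<in> ?K" for u using tensD(3)[OF T] that KD by blast
    show "sum t ?K = 0"
      by (rule antisym_sum_0[of _ e]) (use dartsD[OF d] tensD[OF T] KD in \<open>auto simp: gorbit2_iff\<close>)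
  qed (use x in auto)
  moreover have "osum ?f t y = s \<or> osum ?f t y = - s" using tensD(3)[OF T, of y] x KD s by auto
  ultimately show ?thesis using x(2) by auto
qed

text \<open>Two components are glued at a face of sum \<open>n\<close> of one and a face of sum
  \<open>- n\<close> of the other, which cancel; if one component has no winding faces, any two
  faces will do. Connectedness is what lets folding end with a single cycle.\<close>

lemma connect:
  assumes "tension_map M D n t" "n > 0"
  shows "\<exists>N. gluing\<^sup>*\<^sup>* M N \<and> tension_map N D n t \<and> connected_darts N D"
  using assms
proof (induction "card (gorbit {vperm M, erev M} ` D)" arbitrary: M rule: less_induct)
  case less
  let ?v = "vperm M" and ?e = "erev M" let ?f = "?v \<circ> ?e" and ?G = "gorbit {vperm M, erev M}"
  have m: "is_map M" and o: "orients D M" and pl: "planar D ?v ?e" and T: "tens D ?v ?e n t"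
    using less.prems by (auto simp: tension_map_def)
  have d: "darts D ?v ?e" by (rule orients_darts[OF m o])
  show ?case
  proof (cases "connected_darts M D")
    case True then show ?thesis using less.prems by blast
  next
    case False
    then obtain x y where xy: "x \<in> D" "y \<in> D" "y \<notin> ?G x" by blast
    have "\<exists>a\<in>?G x. \<exists>b\<in>?G y. osum ?f t a = - osum ?f t b \<and> osum ?f t a \<noteq> 0 \<or>
      (\<forall>x\<in>?G a. osum ?f t x = 0) \<or> (\<forall>x\<in>?G b. osum ?f t x = 0)"
    proof (cases "(\<exists>u\<in>?G x. osum ?f t u \<noteq> 0) \<and> (\<exists>u\<in>?G y. osum ?f t u \<noteq> 0)")
      case True
      then obtain a b where "a \<in> ?G x" "osum ?f t a = n" "b \<in> ?G y" "osum ?f t b = - n"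
        using tens_nonzero_components[OF d T xy(1), of _ n] tens_nonzero_components[OF d T xy(2), of _ "- n"] by blast
      then show ?thesis using less.prems(2) by (intro bexI[of _ a] bexI[of _ b]) auto
    next
      case False
      then show ?thesis by (intro bexI[of _ x] bexI[of _ y]) auto
    qed
    then obtain a b where ab: "a \<in> ?G x" "b \<in> ?G y" and c: "osum ?f t a = - osum ?f t b \<and> osum ?f t a \<noteq> 0 \<or>
      (\<forall>x\<in>?G a. osum ?f t x = 0) \<or> (\<forall>x\<in>?G b. osum ?f t x = 0)" by blast
    have D: "a \<in> D" "b \<in> D" using ab darts_gorbit_subset[OF d] xy by blast+
    have bo: "b \<notin> ?G a"
    proof
      assume "b \<in> ?G a"
      then have "y \<in> ?G x" using ab gorbit_sym gorbit_trans by metis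
      then show False using xy by simp
    qed
    have ne: "a \<noteq> b" using bo gorbit_self by metis
    have bv: "b \<notin> orbit ?v a" using bo orbit_subset_gorbit[of ?v "{?v, ?e}" a] by blast
    let ?M = "swap_at M a b"
    note tr = swap_at_transfer[OF m o D]
    have gl: "gluing M ?M" by (rule gluing_face[OF m o D ne bv]) (use bo in blast)
    have "planar D (vperm ?M) (erev ?M)" by (rule tr(3)[OF planar_glue_components[OF d D bo pl]])
    moreover have "tens D (vperm ?M) (erev ?M) n t"
      unfolding tr(4) by (rule tens_glue_components[OF d D bo T c])
    ultimately have st: "tension_map ?M D n t" using tr(1,2) by (simp add: tension_map_def)
    have "gorbit {vperm ?M, erev ?M} ` D = gorbit {transpose a b \<circ> ?v, ?e} ` D"
      by (rule image_cong[OF refl]) (rule tr(5))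
    then have "card (gorbit {vperm ?M, erev ?M} ` D) < card (?G ` D)"
      using card_gorbits_join[OF dartsD(2,1)[OF d] D dartsD(4)[OF d] dartsD(5)[OF d] bo] by simp
    from less.hyps[OF this st less.prems(2)] gl show ?thesis by (meson converse_rtranclp_into_rtranclp)
  qed
qed

lemma fold_theorem:
  assumes "tension_map M D (int n) t" "n \<ge> 2"
  shows "\<exists>L. gluing\<^sup>*\<^sup>* M L \<and> fold_result L n"
proof -
  obtain N where N: "gluing\<^sup>*\<^sup>* M N" "tension_map N D (int n) t" "connected_darts N D"
    using connect[OF assms(1)] assms(2) by auto
  then show ?thesis using fold_connected[OF N(2) assms(2) N(3)] by (meson rtranclp_trans)
qed

section \<open>Pulling a labelling back along gluings\<close>

text \<open>\<open>q\<close> is the composition with a homomorphism to the cycle, whose vertices are numbered modulo \<open>n\<close>.\<close>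

definition labelled :: "'a set \<Rightarrow> ('a \<Rightarrow> 'a) \<Rightarrow> ('a \<Rightarrow> 'a) \<Rightarrow> int \<Rightarrow> ('a \<Rightarrow> int) \<Rightarrow> ('a \<Rightarrow> int) \<Rightarrow> bool" where
  "labelled D v e n q t \<longleftrightarrow> tens D v e n t \<and> (\<forall>x\<in>D. q (v x) = q x \<and> n dvd q (e x) - q x - t x)"

lemma labelledD:
  assumes "labelled D v e n q t"
  shows "tens D v e n t" "x \<in> D \<Longrightarrow> q (v x) = q x" "x \<in> D \<Longrightarrow> n dvd q (e x) - q x - t x"
  using assms by (auto simp: labelled_def)

definition labellable :: "'a premap \<Rightarrow> int \<Rightarrow> bool" where
  "labellable M n \<longleftrightarrow> (\<forall>D. orients D M \<longrightarrow> (\<exists>q t. labelled D (vperm M) (erev M) n q t))"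

text \<open>\<open>alpha0\<close> conjugates the face permutation to its inverse, so it maps a cycle
  of a face to the one that runs around the same face in the other direction.\<close>

lemma alpha0_orbit_face:
  assumes m: "is_map M"
  shows "alpha0 M ` orbit (vperm M \<circ> erev M) x = orbit (vperm M \<circ> erev M) (alpha0 M x)"
proof -
  note * = is_mapD[OF m]
  have f: "permutation (vperm M \<circ> erev M)" by (rule dartsD(7)[OF map_darts[OF m]])
  have "(vperm M \<circ> erev M) ((alpha0 M \<circ> alpha1 M) y) = y" for y
    unfolding fperm_eq[OF m] fperm_def using *(5,6) by simp
  then have inv: "inv (vperm M \<circ> erev M) = alpha0 M \<circ> alpha1 M"
    using permutation_bijective[OF f] by (metis (no_types, opaque_lifting) bij_inv_eq_iff ext)
  have "alpha0 M ` orbit (vperm M \<circ> erev M) x = orbit (alpha0 M \<circ> alpha1 M) (alpha0 M x)"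
    by (rule orbit_inverse[OF permutation_self_in_orbit[OF f]])
       (simp add: fperm_eq[OF m] fperm_def *(5,6) flip: comp_apply[of "vperm M" "erev M"])
  also have "\<dots> = orbit (vperm M \<circ> erev M) (alpha0 M x)"
    using orbit_inv_eq[OF f, of "alpha0 M x"] unfolding inv .
  finally show ?thesis .
qed

lemma alpha0_gorbit:
  assumes m: "is_map M" and y: "y \<in> gorbit {vperm M, erev M} x"
  shows "alpha0 M y \<in> gorbit {vperm M, erev M} (alpha0 M x)"
proof -
  have *: "alpha2 M y \<in> gorbit {vperm M, erev M} (alpha2 M x)" by (rule component_of_eq(2)[OF m y])
  have "alpha0 M u \<in> gorbit {vperm M, erev M} (alpha2 M u)" "alpha2 M u \<in> gorbit {vperm M, erev M} (alpha0 M u)" for u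
    using gorbit_step[of "erev M" "{vperm M, erev M}" "alpha2 M u"] gorbit_sym erev_simps(4)[OF m, of u] by (simp, metis insertCI)
  then show ?thesis using * gorbit_trans by metis
qed

text \<open>On each component the two orientations agree or are mirror images. In the second case
  values are transferred along \<open>alpha2\<close>; as \<open>alpha2 M x\<close> is the reverse of
  \<open>alpha0 M x\<close> and \<open>alpha0\<close> carries face cycles to face cycles, the face
  sums change sign.\<close>

lemma labelled_mirror:
  assumes m: "is_map M" and o: "orients D M" and o': "orients D' M"
    and l: "labelled D' (vperm M) (erev M) n q t"
  shows "\<exists>q t. labelled D (vperm M) (erev M) n q t"
proof -
  let ?v = "vperm M" and ?e = "erev M" let ?f = "?v \<circ> ?e" and ?G = "gorbit {?v, ?e}"
  note * = is_mapD[OF m]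
  have d: "darts D ?v ?e" and d': "darts D' ?v ?e" using orients_darts[OF m] o o' by auto
  have T: "tens D' ?v ?e n t" using l by (simp add: labelled_def)
  define s where "s x = (if x \<in> D' then x else alpha2 M x)" for x
  have sD: "s x \<in> D'" if "x \<in> D" for x
    using orientsD(4)[OF o', of x] orientsD(1)[OF o] that by (auto simp: s_def)
  have s2: "alpha2 M x \<in> D'" if "x \<in> D" "x \<notin> D'" for x using sD[OF that(1)] that(2) by (simp add: s_def)
  have s0: "alpha0 M x \<in> D'" if "x \<in> D" "x \<notin> D'" for x
    using orientsD(2)[OF o', of x] orientsD(1)[OF o] that by auto
  define t' where "t' x = t (s x)" for x
  define q' where "q' x = q (s x)" for x
  have t0: "t (alpha2 M x) = - t (alpha0 M x)" if "x \<in> D" "x \<notin> D'" for x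
    using tensD(2)[OF T s0[OF that]] erev_simps(3)[OF m, of x] by simp
  have f: "permutation ?f" by (rule dartsD(7)[OF d])
  have inv: "?f x \<in> D' \<longleftrightarrow> x \<in> D'" for x using dartsD(4,5)[OF d'] by simp
  have os: "osum ?f t' x = (if x \<in> D' then osum ?f t x else - osum ?f t (alpha0 M x))" if x: "x \<in> D" for x
  proof (cases "x \<in> D'")
    case True
    then have "orbit ?f x \<subseteq> D'" by (rule darts_face_subset[OF d'])
    then have "osum ?f t' x = osum ?f t x" unfolding osum_def by (intro sum.cong) (auto simp: t'_def s_def)
    then show ?thesis using True by simp
  next
    case False
    have sub: "orbit ?f x \<subseteq> D - D'" by (rule orbit_closed) (use dartsD(4,5)[OF d] dartsD(4,5)[OF d'] x False in auto)
    have "osum ?f t (alpha0 M x) = sum t (alpha0 M ` orbit ?f x)"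
      unfolding osum_def alpha0_orbit_face[OF m] ..
    also have "\<dots> = (\<Sum>y\<in>orbit ?f x. t (alpha0 M y))"
      by (rule sum.reindex[unfolded comp_def]) (auto intro: inj_onI simp: permutation_inj[OF *(9)])
    also have "\<dots> = (\<Sum>y\<in>orbit ?f x. - t' y)"
      by (rule sum.cong[OF refl]) (use sub t0 in \<open>auto simp: t'_def s_def subset_iff\<close>)
    finally show ?thesis using False by (simp add: osum_def sum_negf)
  qed
  have GD': "y \<in> D' \<longleftrightarrow> x \<in> D'" if "y \<in> ?G x" for x y
    using darts_gorbit_subset[OF d', of x] darts_gorbit_subset[OF d', of y] that gorbit_sym[OF that] by blast
  have "tens D ?v ?e n t'"
  proof (rule tensI)
    fix x assume x: "x \<in> D"
    show "t' x = 1 \<or> t' x = -1" unfolding t'_def by (rule tensD(1)[OF T sD[OF x]])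
    show "t' (?e x) = - t' x"
    proof (cases "x \<in> D'")
      case True then show ?thesis using tensD(2)[OF T True] dartsD(5)[OF d', of x] by (simp add: t'_def s_def)
    next
      case False
      then have "?e x \<notin> D'" using dartsD(5)[OF d'] by simp
      then show ?thesis using False erev_simps(6)[OF m, of x] t0[OF x False] by (simp add: t'_def s_def)
    qed
    show "osum ?f t' x \<in> {0, n, -n}"
      using os[OF x] tensD(3)[OF T, of x] tensD(3)[OF T s0[OF x]] by auto
  next
    fix x y assume xy: "x \<in> D" "y \<in> D" "y \<in> ?G x" "osum ?f t' x = osum ?f t' y" "osum ?f t' x \<noteq> 0"
    show "y \<in> orbit ?f x"
    proof (cases "x \<in> D'")
      case True
      then have "y \<in> D'" using GD'[OF xy(3)] by simp
      then show ?thesis using tens_unique[OF T True _ xy(3)] os[OF xy(1)] os[OF xy(2)] xy(4,5) True by simp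
    next
      case False
      then have y: "y \<notin> D'" using GD'[OF xy(3)] by simp
      have "alpha0 M y \<in> orbit ?f (alpha0 M x)"
        by (rule tens_unique[OF T s0[OF xy(1) False] s0[OF xy(2) y] alpha0_gorbit[OF m xy(3)]])
           (use os[OF xy(1)] os[OF xy(2)] xy(4,5) False y in auto)
      then show ?thesis
        unfolding alpha0_orbit_face[OF m, symmetric] using *(5) by (metis imageE)
    qed
  qed
  moreover have "q' (?v x) = q' x \<and> n dvd q' (?e x) - q' x - t' x" if x: "x \<in> D" for x
  proof (cases "x \<in> D'")
    case True
    then show ?thesis using l dartsD(4,5)[OF d', of x] by (simp add: labelled_def q'_def t'_def s_def)
  next
    case False
    then have v: "?v x \<notin> D'" "?e x \<notin> D'" using dartsD(4,5)[OF d'] by auto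
    have vx: "?v x \<in> D" using dartsD(4)[OF d] x by simp
    have "?v (alpha2 M (?v x)) = alpha2 M x" using *(6,7) by (simp add: vperm_def)
    then have "q (alpha2 M x) = q (alpha2 M (?v x))" using l s2[OF vx v(1)] by (metis labelled_def)
    moreover have "alpha2 M (?e x) = ?e (alpha2 M x)" using *(7,8) by (simp add: erev_def)
    ultimately show ?thesis
      using labelledD(3)[OF l s2[OF x False]] False v unfolding q'_def t'_def s_def by simp
  qed
  ultimately show ?thesis unfolding labelled_def by blast
qed

lemma labellableI:
  assumes "is_map M" "orients D M" "labelled D (vperm M) (erev M) n q t"
  shows "labellable M n"
  unfolding labellable_def using labelled_mirror[OF assms(1) _ assms(2,3)] by blast

text \<open>An orientation containing both \<open>a\<close> and \<open>b\<close> exists, since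
  crosses of one face cycle are always in the same class and different components can be oriented
  independently. For it the tension passes by the ungluing lemmas, and the labels pass because the
  common vertex in the glued map forces \<open>q a = q b\<close>.\<close>

lemma labellable_unglue_crosses:
  assumes m: "is_map M" and C: "a \<in> crosses M" "b \<in> crosses M" and ab: "a \<noteq> b" "vertex_of M a \<noteq> vertex_of M b"
    and ff: "b \<in> orbit (fperm M) a \<or> component_of M a \<noteq> component_of M b"
    and l: "labellable (swap_at M a b) n"
  shows "labellable M n"
  unfolding labellable_def
proof (intro allI impI)
  let ?v = "vperm M" and ?e = "erev M" let ?M = "swap_at M a b"
  fix D0 assume o0: "orients D0 M"
  have "\<exists>D. orients D M \<and> a \<in> D \<and> b \<in> D \<and> (b \<in> orbit (?v \<circ> ?e) a \<or> b \<notin> gorbit {?v, ?e} a)"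
    using ff
  proof
    assume b: "b \<in> orbit (fperm M) a"
    let ?D = "{x \<in> crosses M. (x \<in> D0) = (a \<in> D0)}"
    have o: "orients ?D M" by (rule orients_flip[OF o0 m]) auto
    have a: "a \<in> ?D" using C by simp
    then have "b \<in> ?D" using darts_face_subset[OF orients_darts[OF m o] a] b unfolding fperm_eq[OF m] by blast
    then show ?thesis using o a b fperm_eq[OF m] by (intro exI[of _ ?D]) auto
  next
    assume k: "component_of M a \<noteq> component_of M b"
    have na: "a \<notin> component_of M b" using k gorbit_eq unfolding component_of_def by metis
    have nb: "b \<notin> component_of M a" using k gorbit_eq unfolding component_of_def by metis
    have bb: "b \<in> component_of M b" by (simp add: component_of_def)
    define g where "g x = (if x \<in> component_of M b then b \<in> D0 else a \<in> D0)" for x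
    let ?D = "{x \<in> crosses M. (x \<in> D0) = g x}"
    have "orients ?D M" by (rule orients_flip[OF o0 m]) (auto simp: g_def component_of_iff)
    moreover have "a \<in> ?D" "b \<in> ?D" using C na bb by (auto simp: g_def)
    moreover have "b \<notin> gorbit {?v, ?e} a" using nb gorbit_subset_component_of by metis
    ultimately show ?thesis by blast
  qed
  then obtain D where o: "orients D M" and D: "a \<in> D" "b \<in> D"
    and bf: "b \<in> orbit (?v \<circ> ?e) a \<or> b \<notin> gorbit {?v, ?e} a" by blast
  have d: "darts D ?v ?e" by (rule orients_darts[OF m o])
  note v = dartsD(2)[OF d]
  note tr = swap_at_transfer[OF m o D]
  have bv: "b \<notin> orbit ?v a"
  proof
    assume "b \<in> orbit ?v a"
    then have "b \<in> vertex_of M a" unfolding vertex_of_eq[OF m] by simp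
    then show False using ab(2) gorbit_eq unfolding vertex_of_def by metis
  qed
  obtain q t where lq: "labelled D (vperm ?M) (erev ?M) n q t" using l tr(2) unfolding labellable_def by blast
  then have T: "tens D (transpose a b \<circ> ?v) ?e n t" using tr(4) by (simp add: labelled_def)
  have "tens D ?v ?e n t"
    using bf
  proof
    assume "b \<in> orbit (?v \<circ> ?e) a"
    then show ?thesis using tens_unglue_same_face[OF d D ab(1) _ bv T] by blast
  next
    assume "b \<notin> gorbit {?v, ?e} a"
    then show ?thesis using tens_unglue_components[OF d D _ T] by blast
  qed
  moreover have qv: "q (transpose a b (?v x)) = q x" if "x \<in> D" for x
    using lq that vperm_swap_at[OF o D that] by (auto simp: labelled_def)
  have d': "darts D (transpose a b \<circ> ?v) ?e" by (rule darts_transpose[OF d D])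
  have "q y = q a" if "y \<in> orbit (transpose a b \<circ> ?v) a" for y using that
  proof induct
    case base then show ?case using qv[OF D(1)] by simp
  next
    case (step y)
    then have "y \<in> D" using darts_orbit_subset[OF d' D(1)] by blast
    then show ?case using step qv by simp
  qed
  then have qab: "q a = q b" using transpose_joins[OF v bv] by metis
  have "q (?v x) = q x" if "x \<in> D" for x
  proof -
    have "q (transpose a b (?v x)) = q (?v x)" using qab by (auto simp: transpose_def)
    then show ?thesis using qv[OF that] by simp
  qed
  moreover have "n dvd q (?e x) - q x - t x" if "x \<in> D" for x using lq that by (simp add: labelled_def)
  ultimately have "labelled D ?v ?e n q t" by (simp add: labelled_def)
  from labelled_mirror[OF m o0 o this] show "\<exists>q t. labelled D0 ?v ?e n q t" .
qed

text \<open>The restored edge takes over the labels and the direction of the parallel edge.\<close>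

lemma (in duplicate) labelled_add:
  assumes l: "labelled D1 v1 e1 n q1 t1"
  shows "\<exists>q t. labelled D v e n q t"
proof -
  define t where "t x = (if x = c1 then - t1 c0 else if x = d then t1 c0 else t1 x)" for x
  define q where "q x = q1 (\<rho> x)" for x
  have T1: "tens D1 v1 e1 n t1" using l by (simp add: labelled_def)
  have "tens D1 v1 e1 n t" by (rule tens_cong[OF darts1 darts1 _ _ _ T1]) (auto simp: t_def D1)
  moreover have "t c0 = t d" "t c1 = - t d" using c(6-8) by (auto simp: t_def)
  ultimately have "tens D v e n t" using tens_iff[of t n] by blast
  moreover have "q (v u) = q u" if u: "u \<in> D" for u
  proof -
    have step: "q1 (v1 x) = q1 x" if "x \<in> D1" for x using l that by (simp add: labelled_def)
    consider "u = c1" | "u = d" | "u \<in> D1" using u D1 by blast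
    then show ?thesis
    proof cases
      case 1
      have "v c1 \<noteq> c1" using v_inj[of c1 "e c0"] c(4) ec0(1) by metis
      then have "v1 (e c0) = \<rho> (v c1)" using v1[OF ec0(4)] c(4,8) by (simp add: \<rho>_def)
      then show ?thesis using step[OF ec0(4)] 1 by (simp add: q_def \<rho>_def)
    next
      case 2
      then show ?thesis using vd c(6-8) by (simp add: q_def \<rho>_def)
    next
      case 3
      then have ru: "\<rho> u = u" by (auto simp: \<rho>_def D1)
      show ?thesis
      proof (cases "v u = c1")
        case True
        then have "u = e c0" using v_inj[of u "e c0"] c(4) by simp
        then show ?thesis using True ru by (simp add: q_def \<rho>_def)
      next
        case False
        then have "v1 u = \<rho> (v u)" using v1[OF 3] by (simp add: \<rho>_def)
        then show ?thesis using step[OF 3] ru by (simp add: q_def)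
      qed
    qed
  qed
  moreover have "n dvd q (e u) - q u - t u" if u: "u \<in> D" for u
  proof -
    have step: "n dvd q1 (e x) - q1 x - t1 x" if "x \<in> D1" for x
      using labelledD(3)[OF l that] e1[OF that] by simp
    consider "u = c1" | "u = d" | "u \<in> D1" using u D1 by blast
    then show ?thesis
    proof cases
      case 1
      have "q (e u) - q u - t u = - (q1 (e c0) - q1 c0 - t1 c0)" using 1 c(3,8) by (simp add: q_def t_def \<rho>_def)
      then show ?thesis using step[OF ec0(5)] by (metis dvd_minus_iff)
    next
      case 2
      then show ?thesis using step[OF ec0(5)] ed c(6-8) by (simp add: q_def t_def \<rho>_def)
    next
      case 3
      then have "e u \<in> D1" using dartsD(5)[OF darts1, of u] e1 by simp
      then have "\<rho> u = u" "\<rho> (e u) = e u" "t u = t1 u" using 3 by (auto simp: \<rho>_def t_def D1)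
      then show ?thesis using step[OF 3] by (simp add: q_def)
    qed
  qed
  ultimately show ?thesis unfolding labelled_def by blast
qed

text \<open>The face of degree two may be given by a cross outside \<open>D\<close>, in which case
  \<open>alpha0\<close> leads back into \<open>D\<close>. Up to mirror images the face has just two
  crosses, so the duplicate edges are the edges of these.\<close>

lemma duplicate_edges_digon:
  assumes m: "is_map M" and o: "orients D M" and dup: "duplicate_edges M B1 B2"
  obtains c0 c1 where "c0 \<in> D" "vperm M (erev M c0) = c1" "vperm M (erev M c1) = c0" "c1 \<noteq> c0"
    "erev M c1 \<noteq> c0" "B2 = edge_of M c1"
proof -
  note * = is_mapD[OF m]
  let ?f = "vperm M \<circ> erev M"
  have f: "permutation ?f" by (rule dartsD(7)[OF map_darts[OF m]])
  from dup obtain c' where c': "c' \<in> crosses M" "card (orbit ?f c') = 2" "B1 \<inter> face_of M c' \<noteq> {}" "B2 \<inter> face_of M c' \<noteq> {}"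
    and B: "B1 \<in> edges M" "B2 \<in> edges M" "B1 \<noteq> B2"
    unfolding duplicate_edges_def face_degree_def fperm_eq[OF m] by blast
  have "\<exists>c\<in>D. card (orbit ?f c) = 2 \<and> face_of M c = face_of M c'"
  proof (cases "c' \<in> D")
    case True then show ?thesis using c'(2) by blast
  next
    case False
    have "card (orbit ?f (alpha0 M c')) = card (orbit ?f c')"
      unfolding alpha0_orbit_face[OF m, symmetric]
      by (rule card_image) (auto intro: inj_onI simp: permutation_inj[OF *(9)])
    moreover have "face_of M (alpha0 M c') = face_of M c'"
      unfolding face_of_def by (rule gorbit_eq) (simp add: gorbit2_iff)
    moreover have "alpha0 M c' \<in> D" using orientsD(2)[OF o c'(1)] False by simp
    ultimately show ?thesis using c'(2) by (intro bexI[of _ "alpha0 M c'"]) auto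
  qed
  then obtain c where c: "c \<in> D" "card (orbit ?f c) = 2" "face_of M c = face_of M c'" by blast
  define y where "y = ?f c"
  have yo: "y \<in> orbit ?f c" "c \<in> orbit ?f c" unfolding y_def by (rule orbit.base, rule permutation_self_in_orbit[OF f])
  have yc: "y \<noteq> c"
  proof
    assume "y = c"
    then have "orbit ?f c = {c}" using orbit_eq_singleton_iff[of ?f c] by (simp add: y_def)
    then show False using c(2) by simp
  qed
  have "orbit ?f c = {c, y}"
    by (rule card_subset_eq[symmetric]) (use finite_orbit_permutation[OF f] yo yc c(2) in auto)
  moreover have "?f y \<in> orbit ?f c" by (rule orbit.step[OF yo(1)])
  moreover have "?f y \<noteq> y" using permutation_inj[OF f, of c y] yc unfolding y_def by metis
  ultimately have fy: "?f y = c" by blast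
  have a: "alpha1 M (alpha0 M c) = y" "alpha1 M (alpha0 M y) = c"
    using y_def fy unfolding fperm_eq[OF m] fperm_def by auto
  let ?S = "{c, y, alpha0 M c, alpha0 M y}"
  have "z \<in> ?S" if "z \<in> gorbit {alpha0 M, alpha1 M} c" for z using that
  proof (induct rule: gorbit2_induct)
    case (v u)
    show ?case using *(5) by (metis insert_iff singletonD)
  next
    case (e u)
    have "alpha1 M c = alpha0 M y" "alpha1 M y = alpha0 M c" using a *(6) by metis+
    then show ?case using a *(6) by (metis insert_iff singletonD)
  qed simp
  then have F: "face_of M c \<subseteq> ?S" by (auto simp: face_of_def)
  have ed: "B = edge_of M c \<or> B = edge_of M y" if "B \<in> edges M" "B \<inter> face_of M c' \<noteq> {}" for B
  proof -
    from that F c(3) obtain z where z: "z \<in> B" "z \<in> ?S" by blast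
    from that(1) obtain w where w: "B = edge_of M w" by (auto simp: edges_def)
    then have "edge_of M z = edge_of M w" using z(1) unfolding edge_of_def by (intro gorbit_eq) simp
    then have "B = edge_of M z" using w by simp
    moreover have "edge_of M (alpha0 M u) = edge_of M u" for u
      unfolding edge_of_def by (rule gorbit_eq) (simp add: gorbit2_iff)
    ultimately show ?thesis using z(2) by auto
  qed
  have yD: "y \<in> D" using c(1) dartsD(4,5)[OF orients_darts[OF m o]] by (simp add: y_def)
  have ee: "edge_of M (erev M u) = edge_of M u" for u
    unfolding edge_of_def erev_def by (rule gorbit_eq) (simp add: gorbit2_iff)
  have ne: "edge_of M c \<noteq> edge_of M y" using ed[OF B(1) c'(3)] ed[OF B(2) c'(4)] B(3) by auto
  have y1: "vperm M (erev M c) = y" and y2: "vperm M (erev M y) = c" using y_def fy by auto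
  from ed[OF B(2) c'(4)] show ?thesis
  proof
    assume "B2 = edge_of M c"
    moreover have "erev M c \<noteq> y" using ne ee by metis
    ultimately show ?thesis using that[of y c] yD y1 y2 yc by metis
  next
    assume "B2 = edge_of M y"
    moreover have "erev M y \<noteq> c" using ne ee by metis
    ultimately show ?thesis using that[of c y] c(1) y1 y2 yc by metis
  qed
qed

lemma is_map_gluing:
  assumes "gluing M N" "is_map M"
  shows "is_map N"
proof -
  have "is_map N" if "vertex_gluing M N"
    using that assms(2)
  proof cases
    case (glue_crosses a b) then show ?thesis using is_map_swap_at[OF assms(2)] by blast
  next
    case glue_isolated then show ?thesis using assms(2) by (simp add: remove_isolated_def is_map_def)
  qed
  moreover have "is_map N" if "duplicate_gluing M N"
    using that
  proof cases
    case (1 e f)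
    then show ?thesis using is_map_delete_edges[OF assms(2), of "{f}"] by (simp add: duplicate_edges_def)
  qed
  ultimately show ?thesis using assms(1) unfolding gluing_def by blast
qed

lemma labellable_unglue:
  assumes g: "gluing M N" and m: "is_map M" and l: "labellable N n"
  shows "labellable M n"
proof -
  have "labellable M n" if "vertex_gluing M N"
    using that
  proof cases
    case (glue_crosses a b)
    then show ?thesis using labellable_unglue_crosses[OF m] l by blast
  next
    case glue_isolated
    have "orients D N \<longleftrightarrow> orients D M" "vperm N = vperm M" "erev N = erev M" for D
      unfolding glue_isolated by (simp_all add: remove_isolated_def orients_def vperm_def erev_def)
    then show ?thesis using l by (simp add: labellable_def)
  qed
  moreover have "labellable M n" if "duplicate_gluing M N"
    using that
  proof cases
    case (1 B1 B2)
    show ?thesis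
      unfolding labellable_def
    proof (intro allI impI)
      fix D assume o: "orients D M"
      obtain c0 c1 where c: "c0 \<in> D" "vperm M (erev M c0) = c1" "vperm M (erev M c1) = c0" "c1 \<noteq> c0"
        "erev M c1 \<noteq> c0" and B2: "B2 = edge_of M c1" by (rule duplicate_edges_digon[OF m o 1(2)])
      interpret duplicate D "D - edge_of M c1" "vperm M" "erev M" "vperm N" "erev N" c0 c1 "erev M c1"
        using duplicate_delete[OF m o c] unfolding 1(1) B2 .
      have "{B2} \<subseteq> edges M" using 1(2) by (simp add: duplicate_edges_def)
      then have "orients (D - edge_of M c1) N" using orients_delete_edges[OF m _ o, of "{B2}"] 1(1) B2 by simp
      then obtain q t where "labelled (D - edge_of M c1) (vperm N) (erev N) n q t" using l unfolding labellable_def by blast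
      then show "\<exists>q t. labelled D (vperm M) (erev M) n q t" by (rule labelled_add)
    qed
  qed
  ultimately show ?thesis using g unfolding gluing_def by blast
qed

lemma labellable_unglue_star:
  assumes "gluing\<^sup>*\<^sup>* M L" "is_map M" "labellable L n"
  shows "labellable M n"
  using assms
proof (induct rule: converse_rtranclp_induct)
  case base then show ?case by simp
next
  case (step M N)
  then show ?case using labellable_unglue[OF step(1)] is_map_gluing[OF step(1)] by blast
qed

lemma is_map_gluing_star: "gluing\<^sup>*\<^sup>* M L \<Longrightarrow> is_map M \<Longrightarrow> is_map L"
  by (induct rule: rtranclp_induct) (auto intro: is_map_gluing)

section \<open>Cycles and isomorphisms\<close>

text \<open>An isomorphism of the rotation systems extends to the mirror crosses by
  \<open>alpha2\<close>; commuting with rotation and reversal then gives commuting with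
  \<open>alpha1\<close> and \<open>alpha0\<close>.\<close>

lemma map_iso_oriented:
  assumes m: "is_map M" "is_map N" and o: "orients D M" "orients D' N" and i: "isolated M = isolated N"
    and k: "bij_betw k D D'" "\<And>x. x \<in> D \<Longrightarrow> k (vperm M x) = vperm N (k x)" "\<And>x. x \<in> D \<Longrightarrow> k (erev M x) = erev N (k x)"
  shows "map_iso M N"
proof -
  note M = is_mapD[OF m(1)] and N = is_mapD[OF m(2)] and oM = orientsD[OF o(1)] and oN = orientsD[OF o(2)]
  note eM = erev_simps[OF m(1)] and eN = erev_simps[OF m(2)]
  have kD: "k c \<in> D'" if "c \<in> D" for c using k(1) that by (auto simp: bij_betw_def)
  have kinj: "k c = k c' \<longleftrightarrow> c = c'" if "c \<in> D" "c' \<in> D" for c c'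
    using k(1) that by (auto simp: bij_betw_def inj_on_def)
  define h where "h c = (if c \<in> D then k c else alpha2 N (k (alpha2 M c)))" for c
  have a2: "alpha2 M c \<in> D" if "c \<in> crosses M" "c \<notin> D" for c using oM(4) that by simp
  have out: "alpha2 N (k c) \<in> crosses N - D'" if "c \<in> D" for c
    using kD[OF that] oN(1) oN(4)[of "k c"] N(4) by auto
  have "bij_betw h (crosses M) (crosses N)"
    unfolding bij_betw_def
  proof
    show "inj_on h (crosses M)"
    proof (rule inj_onI)
      fix c c' assume c: "c \<in> crosses M" "c' \<in> crosses M" "h c = h c'"
      consider "c \<in> D" "c' \<in> D" | "c \<notin> D" "c' \<notin> D" | "c \<in> D" "c' \<notin> D" | "c \<notin> D" "c' \<in> D" by blast
      then show "c = c'"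
      proof cases
        case 1 then show ?thesis using c(3) kinj by (simp add: h_def)
      next
        case 2
        then have "k (alpha2 M c) = k (alpha2 M c')" using c(3) permutation_inj[OF N(11)] by (simp add: h_def)
        then have "alpha2 M c = alpha2 M c'" using kinj a2 2 c by blast
        then show ?thesis using permutation_inj[OF M(11)] by blast
      next
        case 3
        then show ?thesis using c out[OF a2[OF c(2)]] kD[of c] by (auto simp: h_def)
      next
        case 4
        then show ?thesis using c out[OF a2[OF c(1)]] kD[of c'] by (auto simp: h_def)
      qed
    qed
    show "h ` crosses M = crosses N"
    proof
      show "h ` crosses M \<subseteq> crosses N" using kD oN(1) out a2 by (auto simp: h_def)
      show "crosses N \<subseteq> h ` crosses M"
      proof
        fix y assume y: "y \<in> crosses N"
        show "y \<in> h ` crosses M"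
        proof (cases "y \<in> D'")
          case True
          then obtain c where "c \<in> D" "y = k c" using k(1) by (auto simp: bij_betw_def)
          then show ?thesis using oM(1) by (intro image_eqI[of _ _ c]) (auto simp: h_def)
        next
          case False
          then have "alpha2 N y \<in> D'" using oN(4)[OF y] by simp
          then obtain c where c: "c \<in> D" "alpha2 N y = k c" using k(1) by (auto simp: bij_betw_def)
          have cC: "c \<in> crosses M" using c(1) oM(1) by blast
          then have "alpha2 M c \<notin> D" using oM(4) c(1) by simp
          then have "h (alpha2 M c) = y" using c(2) M(7) N(7) by (metis h_def)
          then show ?thesis using cC M(4) by (intro image_eqI[of _ _ "alpha2 M c"]) auto
        qed
      qed
    qed
  qed
  moreover have "h (alpha0 M c) = alpha0 N (h c) \<and> h (alpha1 M c) = alpha1 N (h c) \<and> h (alpha2 M c) = alpha2 N (h c)"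
    if c: "c \<in> crosses M" for c
  proof (cases "c \<in> D")
    case True
    then have n: "alpha0 M c \<notin> D" "alpha1 M c \<notin> D" "alpha2 M c \<notin> D" using oM(2-4)[OF c] by auto
    have "h (alpha0 M c) = alpha2 N (k (erev M c))" using n(1) M(8) by (simp add: h_def erev_def)
    then have "h (alpha0 M c) = alpha0 N (h c)" using k(3)[OF True] eN(6) True by (simp add: h_def)
    moreover have "h (alpha1 M c) = alpha1 N (h c)"
    proof -
      let ?z = "alpha2 M (alpha1 M c)"
      have z: "?z \<in> D" using a2[of "alpha1 M c"] n(2) c M(3) by simp
      have "vperm M ?z = c" using M(6,7) by (simp add: vperm_def)
      then have "k c = alpha1 N (alpha2 N (k ?z))" using k(2)[OF z] by (simp add: vperm_def)
      then show ?thesis using n(2) True N(6) by (simp add: h_def)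
    qed
    moreover have "h (alpha2 M c) = alpha2 N (h c)" using n(3) True M(7) by (simp add: h_def)
    ultimately show ?thesis by blast
  next
    case False
    then have n: "alpha0 M c \<in> D" "alpha1 M c \<in> D" "alpha2 M c \<in> D" using oM(2-4)[OF c] by auto
    have "alpha0 M c = erev M (alpha2 M c)" "alpha1 M c = vperm M (alpha2 M c)"
      using M(7) by (simp_all add: erev_def vperm_def)
    then have "h (alpha0 M c) = erev N (k (alpha2 M c))" "h (alpha1 M c) = vperm N (k (alpha2 M c))"
      using n k(2,3)[OF n(3)] by (simp_all add: h_def)
    then show ?thesis using False n N(7) by (simp add: h_def erev_def vperm_def)
  qed
  ultimately show ?thesis unfolding map_iso_def using i by blast
qed

lemma cycle_structD:
  assumes "cycle_struct M D x n"
  shows "is_map M" "orients D M" "D = x ` {..<n} \<union> erev M ` x ` {..<n}"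
    "inj_on x {..<n}" "i < n \<Longrightarrow> j < n \<Longrightarrow> x i \<noteq> erev M (x j)" "j < n \<Longrightarrow> vperm M (erev M (x j)) = x (Suc j mod n)"
    "j < n \<Longrightarrow> vperm M (x (Suc j mod n)) = erev M (x j)" "darts D (vperm M) (erev M)"
    "j < n \<Longrightarrow> x j \<in> D" "j < n \<Longrightarrow> erev M (x j) \<in> D"
  using assms orients_darts[of M D] by (auto simp: cycle_struct_def)

lemma cycle_struct_cases:
  assumes "cycle_struct M D x n" "y \<in> D"
  obtains j where "j < n" "y = x j" | j where "j < n" "y = erev M (x j)"
  using assms by (auto simp: cycle_struct_def)

lemma Suc_mod_surj: "i < n \<Longrightarrow> \<exists>j<n. i = Suc j mod n" for n :: nat
  using pred_mod[of i n] by (intro exI[of _ "(i + n - 1) mod n"]) auto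

lemma Suc_mod_inj: "i < n \<Longrightarrow> j < n \<Longrightarrow> Suc i mod n = Suc j mod n \<Longrightarrow> i = j" for n :: nat
  using Suc_pred_mod[of i n] Suc_pred_mod[of j n] by metis

text \<open>For functions on the darts of a cycle: \<open>u\<close> gives the values on the forward
  darts and \<open>w\<close> those on their reverses.\<close>

definition cycle_fun :: "(nat \<Rightarrow> 'a) \<Rightarrow> nat \<Rightarrow> ('a \<Rightarrow> 'a) \<Rightarrow> (nat \<Rightarrow> 'b) \<Rightarrow> (nat \<Rightarrow> 'b) \<Rightarrow> 'a \<Rightarrow> 'b" where
  "cycle_fun x n e u w y = (if y \<in> x ` {..<n} then u (inv_into {..<n} x y) else w (inv_into {..<n} x (e y)))"

lemma cycle_fun_simps:
  assumes c: "cycle_struct M D x n" and j: "j < n"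
  shows "cycle_fun x n (erev M) u w (x j) = u j" "cycle_fun x n (erev M) u w (erev M (x j)) = w j"
proof -
  have i: "inv_into {..<n} x (x j) = j" using cycle_structD(4)[OF c] j by simp
  show "cycle_fun x n (erev M) u w (x j) = u j" using i j by (simp add: cycle_fun_def)
  have "erev M (x j) \<notin> x ` {..<n}" using cycle_structD(5)[OF c _ j] by fastforce
  then show "cycle_fun x n (erev M) u w (erev M (x j)) = w j"
    using i erev_simps(1)[OF cycle_structD(1)[OF c]] by (simp add: cycle_fun_def)
qed

lemma cycle_struct_iso:
  assumes c: "cycle_struct M D x n" and c': "cycle_struct N D' x' n" and i: "isolated M = isolated N"
  shows "map_iso M N"
proof -
  define k where "k = cycle_fun x n (erev M) x' (\<lambda>j. erev N (x' j))"
  note ks = cycle_fun_simps[OF c, of _ x' "\<lambda>j. erev N (x' j)", folded k_def]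
  have eM: "erev M (erev M y) = y" for y by (rule erev_simps(1)[OF cycle_structD(1)[OF c]])
  have eN: "erev N (erev N y) = y" for y by (rule erev_simps(1)[OF cycle_structD(1)[OF c']])
  have xinj: "x i = x j \<longleftrightarrow> i = j" if "i < n" "j < n" for i j
    using cycle_structD(4)[OF c] that by (auto simp: inj_on_def)
  have x'inj: "x' i = x' j \<longleftrightarrow> i = j" if "i < n" "j < n" for i j
    using cycle_structD(4)[OF c'] that by (auto simp: inj_on_def)
  have einj: "erev N y = erev N z \<longleftrightarrow> y = z" for y z using eN by metis
  have "bij_betw k D D'"
    unfolding bij_betw_def
  proof
    show "inj_on k D"
    proof (rule inj_onI)
      fix y z assume y: "y \<in> D" and z: "z \<in> D" and eq: "k y = k z"
      show "y = z"
        by (rule cycle_struct_cases[OF c y]; rule cycle_struct_cases[OF c z])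
           (use eq ks x'inj einj cycle_structD(5)[OF c'] in \<open>force, metis, metis, force\<close>)
    qed
    have "k ` D = k ` x ` {..<n} \<union> k ` erev M ` x ` {..<n}" unfolding cycle_structD(3)[OF c] by blast
    also have "k ` x ` {..<n} = x' ` {..<n}" unfolding image_image by (rule image_cong) (auto simp: ks)
    also have "k ` erev M ` x ` {..<n} = erev N ` x' ` {..<n}" unfolding image_image by (rule image_cong) (auto simp: ks)
    finally show "k ` D = D'" using cycle_structD(3)[OF c'] by simp
  qed
  moreover have "k (vperm M y) = vperm N (k y)" "k (erev M y) = erev N (k y)" if y: "y \<in> D" for y
  proof -
    show "k (erev M y) = erev N (k y)"
      by (rule cycle_struct_cases[OF c y]) (simp_all add: ks eM eN)
    show "k (vperm M y) = vperm N (k y)"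
    proof (rule cycle_struct_cases[OF c y])
      fix j assume j: "j < n" "y = x j"
      obtain i where i: "i < n" "j = Suc i mod n" using Suc_mod_surj[OF j(1)] by blast
      then show ?thesis using cycle_structD(7)[OF c i(1)] cycle_structD(7)[OF c' i(1)] ks j by simp
    next
      fix j assume j: "j < n" "y = erev M (x j)"
      have "Suc j mod n < n" using j by simp
      then show ?thesis using cycle_structD(6)[OF c j(1)] cycle_structD(6)[OF c' j(1)] ks j by simp
    qed
  qed
  ultimately show ?thesis
    using map_iso_oriented[OF cycle_structD(1)[OF c] cycle_structD(1)[OF c'] cycle_structD(2)[OF c] cycle_structD(2)[OF c'] i] by blast
qed

text \<open>A dart of the chosen orientation is determined by its edge and its starting vertex.
  Taking in each edge the dart that starts at the first end, only two darts are left at each vertex,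
  and the rotation has to exchange them. Isolated vertices cannot occur since every vertex is
  incident with an edge.\<close>

lemma plane_cycle_struct:
  assumes X: "plane_cycle n M" and n: "n \<ge> 3"
  shows "isolated M = 0" "\<exists>D x. cycle_struct M D x n \<and> planar D (vperm M) (erev M)"
proof -
  have m: "is_map M" and eg: "euler_genus M = 0" using X by (auto simp: plane_cycle_def plane_def)
  note * = is_mapD[OF m]
  from X obtain vv ee where vv: "bij_betw vv {..<n} (vertices M)" and ee: "bij_betw ee {..<n} (edges M)"
    and inc: "\<And>j. j < n \<Longrightarrow> {y \<in> vertices M. incident y (ee j)} = {vv j, vv (Suc j mod n)}"
    unfolding plane_cycle_def cycle_graph_def by blast
  have "\<exists>W. vv j = Inl W" if "j < n" for j
  proof -
    have "vv j \<in> {y \<in> vertices M. incident y (ee j)}" using inc[OF that] by simp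
    then show ?thesis by (auto simp: incident_def)
  qed
  then obtain V where V: "\<And>j. j < n \<Longrightarrow> vv j = Inl (V j)" by metis
  have verts: "vertices M = vv ` {..<n}" using vv by (simp add: bij_betw_def)
  show "isolated M = 0"
  proof (rule ccontr)
    assume "isolated M \<noteq> 0"
    then have "Inr 0 \<in> vertices M" by (simp add: vertices_def InrI)
    then show False using verts V by auto
  qed
  have Vv: "V j \<in> vertex_of M ` crosses M" if "j < n" for j
  proof -
    have "Inl (V j) \<in> vertices M" using verts V[OF that] that by force
    then show ?thesis by (auto simp: vertices_def)
  qed
  have Vinj: "i = j" if "i < n" "j < n" "V i = V j" for i j
    using vv that V unfolding bij_betw_def inj_on_def by (metis lessThan_iff)
  have meet: "W = V j \<or> W = V (Suc j mod n)" if "j < n" "W \<in> vertex_of M ` crosses M" "W \<inter> ee j \<noteq> {}" for W j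
  proof -
    have "Inl W \<in> {y \<in> vertices M. incident y (ee j)}" using that by (auto simp: vertices_def incident_def)
    moreover have "Suc j mod n < n" using that by simp
    ultimately show ?thesis using inc[OF that(1)] V that(1) by auto
  qed
  have meetV: "V j \<inter> ee j \<noteq> {}" "V (Suc j mod n) \<inter> ee j \<noteq> {}" if "j < n" for j
  proof -
    have S: "Suc j mod n < n" using that by simp
    have "vv j \<in> {y \<in> vertices M. incident y (ee j)}" "vv (Suc j mod n) \<in> {y \<in> vertices M. incident y (ee j)}"
      using inc[OF that] by auto
    then show "V j \<inter> ee j \<noteq> {}" "V (Suc j mod n) \<inter> ee j \<noteq> {}"
      using V[OF that] V[OF S] by (auto simp: incident_def)
  qed
  have eeE: "ee j \<in> edges M" if "j < n" for j using ee that by (auto simp: bij_betw_def)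
  have eeinj: "i = j" if "i < n" "j < n" "ee i = ee j" for i j
    using ee that unfolding bij_betw_def inj_on_def by (metis lessThan_iff)
  have ee_eq: "ee j = edge_of M c" if j: "j < n" and c: "c \<in> ee j" for c j
  proof -
    obtain w where w: "ee j = edge_of M w" using eeE[OF j] by (auto simp: edges_def)
    then have "edge_of M c = edge_of M w" using c unfolding edge_of_def by (intro gorbit_eq) simp
    then show ?thesis using w by simp
  qed
  have V_eq: "vertex_of M c = V j" if j: "j < n" and c: "c \<in> V j" for c j
  proof -
    obtain w where w: "V j = vertex_of M w" using Vv[OF j] by auto
    then have "vertex_of M c = vertex_of M w" using c unfolding vertex_of_def by (intro gorbit_eq) simp
    then show ?thesis using w by simp
  qed
  have eC: "ee j \<subseteq> crosses M" if j: "j < n" for j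
  proof -
    obtain c where c: "ee j = edge_of M c" "c \<in> crosses M" using eeE[OF j] by (auto simp: edges_def)
    then show ?thesis using * by (auto simp: edge_of_eq[OF m] erev_def)
  qed
  obtain D where o: "orients D M" and pl: "planar D (vperm M) (erev M)" by (rule plane_orientable[OF m eg])
  note o' = orientsD[OF o]
  have d: "darts D (vperm M) (erev M)" by (rule orients_darts[OF m o])
  have "\<exists>c. c \<in> ee j \<and> c \<in> V j \<and> c \<in> D" if j: "j < n" for j
  proof -
    obtain c where c: "c \<in> V j" "c \<in> ee j" using meetV(1)[OF j] by blast
    have cC: "c \<in> crosses M" using c(2) eC[OF j] by blast
    \<comment> \<open>\<open>alpha2\<close> keeps edge and vertex but changes the orientation class,
      so \<open>c\<close> or its mirror image is suitable.\<close>
    have "alpha2 M c \<in> edge_of M c" "alpha2 M c \<in> vertex_of M c"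
      by (simp_all add: edge_of_def vertex_of_def gorbit2_iff)
    then have "alpha2 M c \<in> ee j" "alpha2 M c \<in> V j" using ee_eq[OF j c(2)] V_eq[OF j c(1)] by auto
    then show ?thesis using c o'(4)[OF cC] by (cases "c \<in> D") auto
  qed
  then obtain x where x: "\<And>j. j < n \<Longrightarrow> x j \<in> ee j \<and> x j \<in> V j \<and> x j \<in> D" by metis
  have xe: "ee j = edge_of M (x j)" and xv: "vertex_of M (x j) = V j" and xD: "x j \<in> D" and exD: "erev M (x j) \<in> D" if "j < n" for j
    using x[OF that] ee_eq[OF that] V_eq[OF that] dartsD(5)[OF d] by auto
  have Sne: "Suc j mod n \<noteq> j" if "j < n" for j using that n by (cases "Suc j = n") auto
  have ex: "vertex_of M (erev M (x j)) = V (Suc j mod n)" if j: "j < n" for j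
  proof -
    have S: "Suc j mod n < n" using j by simp
    obtain c where c: "c \<in> V (Suc j mod n)" "c \<in> ee j" using meetV(2)[OF j] by blast
    have vc: "vertex_of M c = V (Suc j mod n)" by (rule V_eq[OF S c(1)])
    have ne: "vertex_of M c \<noteq> V j" using vc Vinj[OF S j] Sne[OF j] by auto
    have v2: "vertex_of M (alpha2 M u) = vertex_of M u" for u
      unfolding vertex_of_def by (rule gorbit_eq) (simp add: gorbit2_iff)
    have "c \<in> {x j, alpha0 M (x j), alpha2 M (x j), erev M (x j)}" using c(2) xe[OF j] edge_of_eq[OF m] by simp
    then have "c = alpha0 M (x j) \<or> c = erev M (x j)" using ne xv[OF j] v2 by auto
    then show ?thesis using vc v2[of "erev M (x j)"] erev_simps(6)[OF m, of "x j"] by auto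
  qed
  have DD: "D = x ` {..<n} \<union> erev M ` x ` {..<n}"
  proof
    show "x ` {..<n} \<union> erev M ` x ` {..<n} \<subseteq> D" using xD exD by auto
    show "D \<subseteq> x ` {..<n} \<union> erev M ` x ` {..<n}"
    proof
      fix y assume y: "y \<in> D"
      then have "edge_of M y \<in> edges M" using o'(1) by (auto simp: edges_def)
      then obtain j where j: "j < n" "edge_of M y = ee j" using ee by (auto simp: bij_betw_def)
      then have "y \<in> edge_of M (x j)" using xe[OF j(1)] by (auto simp: edge_of_def)
      then have "y \<in> {x j, alpha0 M (x j), alpha2 M (x j), erev M (x j)}" using edge_of_eq[OF m] by simp
      moreover have "alpha0 M (x j) \<notin> D" "alpha2 M (x j) \<notin> D" using o'(1,2,4) xD[OF j(1)] by blast+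
      ultimately have "y = x j \<or> y = erev M (x j)" using y by blast
      then show "y \<in> x ` {..<n} \<union> erev M ` x ` {..<n}" using j(1) by blast
    qed
  qed
  have ee2: "edge_of M (erev M u) = edge_of M u" for u
    unfolding edge_of_def erev_def by (rule gorbit_eq) (simp add: gorbit2_iff)
  have sep: "x i \<noteq> erev M (x j)" if "i < n" "j < n" for i j
  proof
    assume eq: "x i = erev M (x j)"
    then have "ee i = ee j" using xe that ee2 by metis
    then have "i = j" using eeinj that by blast
    then show False using eq o'(1,5) xD[OF that(2)] by (metis subsetD)
  qed
  have xinj: "inj_on x {..<n}" using xe eeinj by (auto intro!: inj_onI)
  have vinj: "vperm M a = vperm M b \<longleftrightarrow> a = b" for a b by (rule permutation_inj[OF dartsD(2)[OF d]])
  have vv1: "vertex_of M (vperm M u) = vertex_of M u" for u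
    unfolding vertex_of_def vperm_def by (rule gorbit_eq) (simp add: gorbit2_iff)
  have cases: "(\<exists>i<n. y = x i \<and> V i = vertex_of M y) \<or> (\<exists>i<n. y = erev M (x i) \<and> V (Suc i mod n) = vertex_of M y)" if "y \<in> D" for y
    using that xv ex unfolding DD by auto
  have s1: "vperm M (erev M (x j)) = x (Suc j mod n)" if j: "j < n" for j
  proof -
    let ?y = "vperm M (erev M (x j))"
    have S: "Suc j mod n < n" using j by simp
    have y: "?y \<in> D" "vertex_of M ?y = V (Suc j mod n)" using dartsD(4)[OF d] exD[OF j] vv1 ex[OF j] by auto
    from cases[OF y(1)] show ?thesis
    proof
      assume "\<exists>i<n. ?y = x i \<and> V i = vertex_of M ?y"
      then obtain i where "i < n" "?y = x i" "V i = V (Suc j mod n)" using y(2) by auto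
      then show ?thesis using Vinj[OF _ S] by blast
    next
      assume "\<exists>i<n. ?y = erev M (x i) \<and> V (Suc i mod n) = vertex_of M ?y"
      then obtain i where i: "i < n" "?y = erev M (x i)" "V (Suc i mod n) = V (Suc j mod n)" using y(2) by auto
      have "Suc i mod n = Suc j mod n" by (rule Vinj) (use i S in auto)
      then have "i = j" using Suc_mod_inj i(1) j by blast
      \<comment> \<open>A dart fixed by the rotation would be alone at its vertex, but
        \<open>x (Suc j mod n)\<close> lies there as well.\<close>
      then have "orbit (vperm M) (erev M (x j)) = {erev M (x j)}" using i(2) orbit_eq_singleton_iff by metis
      moreover have "x (Suc j mod n) \<in> vertex_of M (erev M (x j))" using ex[OF j] x[OF S] by simp
      ultimately have "x (Suc j mod n) = erev M (x j)"
        using vertex_of_oriented[OF m o exD[OF j] xD[OF S]] by simp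
      then show ?thesis using sep[OF S j] by simp
    qed
  qed
  have s2: "vperm M (x (Suc j mod n)) = erev M (x j)" if j: "j < n" for j
  proof -
    let ?y = "vperm M (x (Suc j mod n))"
    have S: "Suc j mod n < n" using j by simp
    have y: "?y \<in> D" "vertex_of M ?y = V (Suc j mod n)" using dartsD(4)[OF d] xD[OF S] vv1 xv[OF S] by auto
    from cases[OF y(1)] show ?thesis
    proof
      assume "\<exists>i<n. ?y = x i \<and> V i = vertex_of M ?y"
      then obtain i where i: "i < n" "?y = x i" "V i = V (Suc j mod n)" using y(2) by auto
      then have "i = Suc j mod n" using Vinj[OF _ S] by blast
      then have "?y = vperm M (erev M (x j))" using s1[OF j] i by simp
      then have "x (Suc j mod n) = erev M (x j)" using vinj by blast
      then show ?thesis using sep[OF S j] by simp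
    next
      assume "\<exists>i<n. ?y = erev M (x i) \<and> V (Suc i mod n) = vertex_of M ?y"
      then obtain i where i: "i < n" "?y = erev M (x i)" "V (Suc i mod n) = V (Suc j mod n)" using y(2) by auto
      have "Suc i mod n = Suc j mod n" by (rule Vinj) (use i S in auto)
      then have "i = j" using Suc_mod_inj i(1) j by blast
      then show ?thesis using i by simp
    qed
  qed
  have "cycle_struct M D x n" unfolding cycle_struct_def using m o DD xinj sep s1 s2 by blast
  then show "\<exists>D x. cycle_struct M D x n \<and> planar D (vperm M) (erev M)" using pl by blast
qed

section \<open>Faces, tensions and labels of a cycle\<close>

lemma cycle_struct_orbits:
  assumes c: "cycle_struct M D x n" and j: "j < n"
  shows "orbit (vperm M \<circ> erev M) (x j) = x ` {..<n}"
    and "orbit (vperm M \<circ> erev M) (erev M (x j)) = erev M ` x ` {..<n}"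
proof -
  let ?f = "vperm M \<circ> erev M"
  have f: "permutation ?f" by (rule dartsD(7)[OF cycle_structD(8)[OF c]])
  have ee: "erev M (erev M y) = y" for y by (rule erev_simps(1)[OF cycle_structD(1)[OF c]])
  have f1: "?f (x i) = x (Suc i mod n)" if "i < n" for i using cycle_structD(6)[OF c that] by simp
  have f2: "?f (erev M (x (Suc i mod n))) = erev M (x i)" if "i < n" for i using cycle_structD(7)[OF c that] ee by simp
  have n0: "0 < n" using j by simp
  have in0: "x i \<in> orbit ?f (x 0)" if "i < n" for i using that
  proof (induct i)
    case 0 show ?case by (rule permutation_self_in_orbit[OF f])
  next
    case (Suc i)
    then have "?f (x i) \<in> orbit ?f (x 0)" by (intro orbit.step) simp
    moreover have "?f (x i) = x (Suc i)" using f1[of i] Suc.prems by simp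
    ultimately show ?case by metis
  qed
  have "y \<in> x ` {..<n}" if "y \<in> orbit ?f (x 0)" for y using that
  proof induct
    case base then show ?case using f1[OF n0] n0 by simp
  next
    case (step y)
    then obtain i where "i < n" "y = x i" by blast
    then show ?case using f1[of i] by simp
  qed
  then have o0: "orbit ?f (x 0) = x ` {..<n}" using in0 by blast
  then show "orbit ?f (x j) = x ` {..<n}" using orbit_eq_of_mem[OF f in0[OF j]] by simp
  have in1: "erev M (x i) \<in> orbit ?f (erev M (x 0))" if "i < n" for i using that
  proof (induct i)
    case 0 show ?case by (rule permutation_self_in_orbit[OF f])
  next
    case (Suc i)
    have "erev M (x i) \<in> orbit ?f (erev M (x 0))" by (rule Suc.hyps) (use Suc.prems in simp)
    moreover have "?f (erev M (x (Suc i))) = erev M (x i)" using f2[of i] Suc.prems by simp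
    ultimately have "?f (erev M (x (Suc i))) \<in> orbit ?f (erev M (x 0))" by metis
    then show ?case using orbit_image_iff[OF f] by blast
  qed
  have "y \<in> erev M ` x ` {..<n}" if "y \<in> orbit ?f (erev M (x 0))" for y using that
  proof induct
    case base
    obtain i where "i < n" "0 = Suc i mod n" using Suc_mod_surj[OF n0] by blast
    then show ?case using f2[of i] by auto
  next
    case (step y)
    then obtain k where k: "k < n" "y = erev M (x k)" by blast
    obtain i where "i < n" "k = Suc i mod n" using Suc_mod_surj[OF k(1)] by blast
    then show ?case using f2[of i] k by auto
  qed
  then have "orbit ?f (erev M (x 0)) = erev M ` x ` {..<n}" using in1 by blast
  then show "orbit ?f (erev M (x j)) = erev M ` x ` {..<n}" using orbit_eq_of_mem[OF f in1[OF j]] by simp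
qed

text \<open>The two faces of a cycle run through the forward and the reversed darts, so any choice
  of directions with sum \<open>n\<close> is a tension for \<open>n\<close>, also when the cycle is
  longer than \<open>n\<close>.\<close>

lemma cycle_tens:
  fixes u :: "nat \<Rightarrow> int"
  assumes c: "cycle_struct M D x m" and u: "\<And>j. j < m \<Longrightarrow> u j = 1 \<or> u j = -1" and n: "(\<Sum>j<m. u j) = n" "n > 0"
  shows "tens D (vperm M) (erev M) n (cycle_fun x m (erev M) u (\<lambda>j. - u j))"
proof -
  let ?f = "vperm M \<circ> erev M" and ?t = "cycle_fun x m (erev M) u (\<lambda>j. - u j)"
  note ts = cycle_fun_simps[OF c, of _ u "\<lambda>j. - u j"] and orb = cycle_struct_orbits[OF c]
  have ee: "erev M (erev M y) = y" for y by (rule erev_simps(1)[OF cycle_structD(1)[OF c]])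
  have s1: "osum ?f ?t (x j) = n" if "j < m" for j
  proof -
    have "osum ?f ?t (x j) = (\<Sum>i<m. ?t (x i))"
      unfolding osum_def orb(1)[OF that] by (rule sum.reindex[unfolded comp_def, OF cycle_structD(4)[OF c]])
    also have "\<dots> = (\<Sum>i<m. u i)" by (rule sum.cong) (auto simp: ts)
    finally show ?thesis using n by simp
  qed
  have s2: "osum ?f ?t (erev M (x j)) = - n" if "j < m" for j
  proof -
    have inj: "inj_on (\<lambda>i. erev M (x i)) {..<m}"
      using cycle_structD(4)[OF c] ee by (metis (no_types, lifting) inj_on_def)
    have "osum ?f ?t (erev M (x j)) = (\<Sum>i<m. ?t (erev M (x i)))"
      unfolding osum_def orb(2)[OF that] image_image by (rule sum.reindex[unfolded comp_def, OF inj])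
    also have "\<dots> = (\<Sum>i<m. - u i)" by (rule sum.cong) (auto simp: ts)
    finally show ?thesis using n by (simp add: sum_negf)
  qed
  show ?thesis
  proof (rule tensI)
    fix y assume y: "y \<in> D"
    show "?t y = 1 \<or> ?t y = -1" using u by (rule_tac cycle_struct_cases[OF c y]) (auto simp: ts)
    show "?t (erev M y) = - ?t y" by (rule cycle_struct_cases[OF c y]) (auto simp: ts ee)
    show "osum ?f ?t y \<in> {0, n, -n}" by (rule cycle_struct_cases[OF c y]) (auto simp: s1 s2)
  next
    fix y z assume y: "y \<in> D" and z: "z \<in> D" and eq: "osum ?f ?t y = osum ?f ?t z"
    show "z \<in> orbit ?f y"
      by (rule cycle_struct_cases[OF c y]; rule cycle_struct_cases[OF c z])
         (use eq s1 s2 n orb in \<open>auto simp: image_image\<close>)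
  qed
qed

text \<open>A dart is labelled by the index of the vertex from which it starts.\<close>

lemma labelled_cycle:
  assumes c: "cycle_struct M D x n" and n: "n > 0"
  shows "\<exists>q t. labelled D (vperm M) (erev M) (int n) q t"
proof -
  let ?t = "cycle_fun x n (erev M) (\<lambda>_. 1) (\<lambda>_. - 1) :: 'a \<Rightarrow> int"
  let ?q = "cycle_fun x n (erev M) int (\<lambda>j. int (Suc j mod n))"
  note ts = cycle_fun_simps[OF c, of _ "\<lambda>_. 1 :: int" "\<lambda>_. - 1"] and qs = cycle_fun_simps[OF c, of _ int "\<lambda>j. int (Suc j mod n)"]
  have ee: "erev M (erev M y) = y" for y by (rule erev_simps(1)[OF cycle_structD(1)[OF c]])
  have "tens D (vperm M) (erev M) (int n) ?t" using cycle_tens[OF c, of "\<lambda>_. 1" "int n"] n by simp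
  moreover have "?q (vperm M y) = ?q y \<and> int n dvd ?q (erev M y) - ?q y - ?t y" if y: "y \<in> D" for y
  proof -
    have dv: "int n dvd int (Suc j mod n) - int j - 1" for j
      by (simp add: zmod_int mod_eq_dvd_iff[symmetric] algebra_simps)
    show ?thesis
    proof (rule cycle_struct_cases[OF c y])
      fix j assume j: "j < n" "y = x j"
      obtain i where i: "i < n" "j = Suc i mod n" using Suc_mod_surj[OF j(1)] by blast
      then show ?thesis using cycle_structD(7)[OF c i(1)] qs ts j dv[of j] by simp
    next
      fix j assume j: "j < n" "y = erev M (x j)"
      have "Suc j mod n < n" using j by simp
      moreover have "int n dvd - (int (Suc j mod n) - int j - 1)" using dv by (simp only: dvd_minus_iff)
      ultimately show ?thesis using cycle_structD(6)[OF c j(1)] qs ts j ee by (simp add: algebra_simps)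
    qed
  qed
  ultimately show ?thesis unfolding labelled_def by blast
qed

lemma labellable_iso:
  assumes i: "map_iso L S" and m: "is_map L" "is_map S" and l: "labellable S n"
  shows "labellable L n"
  unfolding labellable_def
proof (intro allI impI)
  fix D assume o: "orients D L"
  from i obtain h where h: "bij_betw h (crosses L) (crosses S)"
    and hc: "\<And>c. c \<in> crosses L \<Longrightarrow> h (alpha0 L c) = alpha0 S (h c) \<and> h (alpha1 L c) = alpha1 S (h c) \<and> h (alpha2 L c) = alpha2 S (h c)"
    unfolding map_iso_def by blast
  note L = is_mapD[OF m(1)] and oL = orientsD[OF o]
  have hinj: "h a = h b \<longleftrightarrow> a = b" if "a \<in> crosses L" "b \<in> crosses L" for a b
    using h that by (auto simp: bij_betw_def inj_on_def)
  have hv: "h (vperm L c) = vperm S (h c)" and he: "h (erev L c) = erev S (h c)" if "c \<in> crosses L" for c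
    using hc[OF that] hc[of "alpha2 L c"] L(4) that by (auto simp: vperm_def erev_def)
  have hmem: "h c \<in> h ` D \<longleftrightarrow> c \<in> D" if "c \<in> crosses L" for c using hinj that oL(1) by blast
  have oS: "orients (h ` D) S"
    unfolding orients_def
  proof (intro conjI ballI)
    show "h ` D \<subseteq> crosses S" using h oL(1) by (auto simp: bij_betw_def)
    fix y assume "y \<in> crosses S"
    then obtain c where c: "c \<in> crosses L" "y = h c" using h by (auto simp: bij_betw_def)
    show "alpha0 S y \<in> h ` D \<longleftrightarrow> y \<notin> h ` D" "alpha1 S y \<in> h ` D \<longleftrightarrow> y \<notin> h ` D" "alpha2 S y \<in> h ` D \<longleftrightarrow> y \<notin> h ` D"
      using hc[OF c(1)] hmem[of "alpha0 L c"] hmem[of "alpha1 L c"] hmem[of "alpha2 L c"] hmem[OF c(1)] oL(2-4)[OF c(1)] L(2-4) c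
      by metis+
    show "erev S y \<noteq> y" using he[OF c(1)] oL(5)[OF c(1)] hinj[of "erev L c" c] erev_simps(2)[OF m(1)] c by metis
  qed
  obtain q t where lq: "labelled (h ` D) (vperm S) (erev S) n q t" using l oS unfolding labellable_def by blast
  note T = labelledD(1)[OF lq]
  let ?f = "vperm L \<circ> erev L" and ?g = "vperm S \<circ> erev S"
  have dL: "darts D (vperm L) (erev L)" by (rule orients_darts[OF m(1) o])
  have f: "permutation ?f" by (rule dartsD(7)[OF dL])
  have DC: "c \<in> crosses L" if "c \<in> D" for c using that oL(1) by blast
  have orb: "h ` orbit ?f c = orbit ?g (h c)" if "c \<in> D" for c
  proof (rule orbit_inverse[OF permutation_self_in_orbit[OF f]])
    fix y assume "y \<in> orbit ?f c"
    then have y: "y \<in> crosses L" using darts_face_subset[OF dL that] DC by blast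
    then have "erev L y \<in> crosses L" using erev_simps(2)[OF m(1)] by simp
    then show "?g (h y) = h (?f y)" using hv he[OF y] by simp
  qed
  have os: "osum ?f (t \<circ> h) c = osum ?g t (h c)" if "c \<in> D" for c
  proof -
    have "inj_on h (orbit ?f c)" using darts_face_subset[OF dL that] hinj DC by (auto intro!: inj_onI) blast
    then show ?thesis unfolding osum_def orb[OF that, symmetric] by (simp add: sum.reindex)
  qed
  have "tens D (vperm L) (erev L) n (t \<circ> h)"
  proof (rule tensI)
    fix c assume c: "c \<in> D"
    show "(t \<circ> h) c = 1 \<or> (t \<circ> h) c = -1" "(t \<circ> h) (erev L c) = - (t \<circ> h) c" "osum ?f (t \<circ> h) c \<in> {0, n, -n}"
      using tensD[OF T imageI[OF c]] he[OF DC[OF c]] os[OF c] by auto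
  next
    fix c y assume cy: "c \<in> D" "y \<in> D" "y \<in> gorbit {vperm L, erev L} c" "osum ?f (t \<circ> h) c = osum ?f (t \<circ> h) y" "osum ?f (t \<circ> h) c \<noteq> 0"
    from cy(3) have "y \<in> crosses L \<and> h y \<in> gorbit {vperm S, erev S} (h c)"
    proof (induct rule: gorbit2_induct)
      case base then show ?case using DC[OF cy(1)] by simp
    next
      case (v u)
      show ?case using hv[of u] dartsD(4)[OF map_darts[OF m(1)], of u] gorbit2_iff(1)[of "vperm S" "h u"] by metis
    next
      case (e u)
      show ?case using he[of u] dartsD(5)[OF map_darts[OF m(1)], of u] gorbit2_iff(2)[of "erev S" "h u"] by metis
    qed
    then have "h y \<in> orbit ?g (h c)"
      using tens_unique[OF T imageI[OF cy(1)] imageI[OF cy(2)]] os cy by simp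
    then obtain z where z: "z \<in> orbit ?f c" "h y = h z" using orb[OF cy(1)] by blast
    moreover have "z \<in> crosses L" using z(1) darts_face_subset[OF dL cy(1)] DC by blast
    ultimately show "y \<in> orbit ?f c" using hinj DC[OF cy(2)] by metis
  qed
  moreover have "(q \<circ> h) (vperm L c) = (q \<circ> h) c \<and> n dvd (q \<circ> h) (erev L c) - (q \<circ> h) c - (t \<circ> h) c" if "c \<in> D" for c
    using labelledD(2,3)[OF lq imageI[OF that]] hv[OF DC[OF that]] he[OF DC[OF that]] by simp
  ultimately show "\<exists>q t. labelled D (vperm L) (erev L) n q t" unfolding labelled_def by blast
qed

section \<open>Submaps\<close>

text \<open>Invariant of repeated deletions: the rotation may skip crosses but stays in the old
  vertex cycle. The last condition is there because the cycle alone does not determine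
  \<open>alpha1\<close> when no cross is missing.\<close>

definition sub_of :: "'a premap \<Rightarrow> 'a premap \<Rightarrow> bool" where
  "sub_of S M \<longleftrightarrow> is_map S \<and> crosses S \<subseteq> crosses M \<and>
     (\<forall>c\<in>crosses S. alpha0 S c = alpha0 M c \<and> alpha2 S c = alpha2 M c \<and> alpha1 S c \<in> orbit (vperm M) (alpha2 M c)) \<and>
     (crosses S = crosses M \<longrightarrow> (\<forall>c\<in>crosses S. alpha1 S c = alpha1 M c))"

lemma sub_of_vperm:
  assumes "sub_of S M" "is_map M" "y \<in> crosses S"
  shows "vperm S y \<in> orbit (vperm M) y" "erev S y = erev M y"
proof -
  have "is_map S" using assms(1) by (simp add: sub_of_def)
  then have "alpha2 S y \<in> crosses S" using is_mapD(4)[of S y] assms(3) by blast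
  then show "vperm S y \<in> orbit (vperm M) y" "erev S y = erev M y"
    using assms is_mapD(7)[OF assms(2)] unfolding sub_of_def vperm_def erev_def by (metis comp_apply)+
qed

lemma sub_of_trans:
  assumes TS: "sub_of T S" and SM: "sub_of S M" and m: "is_map M"
  shows "sub_of T M"
proof -
  have mS: "is_map S" using SM by (simp add: sub_of_def)
  have v: "permutation (vperm M)" by (rule dartsD(2)[OF map_darts[OF m]])
  have sub: "z \<in> orbit (vperm M) y" if y: "y \<in> crosses S" and z: "z \<in> orbit (vperm S) y" for y z
    using z
  proof induct
    case base then show ?case by (rule sub_of_vperm(1)[OF SM m y])
  next
    case (step u)
    have "u \<in> crosses S" using darts_orbit_subset[OF map_darts[OF mS] y] step(1) by blast
    then show ?case using sub_of_vperm(1)[OF SM m] step(2) orbit_trans by metis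
  qed
  have C: "crosses T \<subseteq> crosses S" "crosses S \<subseteq> crosses M" using TS SM by (auto simp: sub_of_def)
  have "alpha1 T c \<in> orbit (vperm M) (alpha2 M c)" if c: "c \<in> crosses T" for c
  proof -
    have cS: "c \<in> crosses S" using c C by blast
    have "alpha2 S c \<in> crosses S" using is_mapD(4)[OF mS] cS by simp
    moreover have "alpha1 T c \<in> orbit (vperm S) (alpha2 S c)" using TS c by (simp add: sub_of_def)
    ultimately show ?thesis using sub[of "alpha2 S c"] SM cS by (simp add: sub_of_def)
  qed
  then show ?thesis using TS SM C unfolding sub_of_def by (auto simp: subset_iff)
qed

lemma edges_subset_crosses: "is_map M \<Longrightarrow> B \<in> edges M \<Longrightarrow> B \<subseteq> crosses M"
  using is_mapD[of M] by (auto simp: edges_def edge_of_eq erev_def)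

lemma sub_of_delete_edges:
  assumes m: "is_map M" and E: "E \<subseteq> edges M"
  shows "sub_of (delete_edges M E) M"
proof -
  have v: "permutation (vperm M)" by (rule dartsD(2)[OF map_darts[OF m]])
  have "alpha1 (delete_edges M E) c \<in> orbit (vperm M) (alpha2 M c)" if c: "c \<in> crosses M - \<Union>E" for c
  proof -
    obtain k where "alpha1 (delete_edges M E) c = (vperm M ^^ k) (alpha2 M c)" "0 < k"
      by (rule alpha1_delete_edges[OF m E c], rule that)
    then show ?thesis by (auto simp: orbit_altdef)
  qed
  moreover have "alpha1 (delete_edges M E) c = alpha1 M c" if eq: "crosses M - \<Union>E = crosses M" and c: "c \<in> crosses M" for c
  proof -
    have "\<Union>E \<subseteq> crosses M" using E edges_subset_crosses[OF m] by blast
    then have U: "\<Union>E = {}" using eq by blast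
    have "skip (vperm M) {} (alpha2 M c) = (vperm M ^^ 1) (alpha2 M c)" by (rule skip_eqI) auto
    then have "skip (vperm M) {} (alpha2 M c) = alpha1 M c" using is_mapD(7)[OF m] by (simp add: vperm_def)
    then show ?thesis using delete_edges_simps(4)[of c M E] c unfolding U by simp
  qed
  ultimately show ?thesis
    using is_map_delete_edges[OF m E] unfolding sub_of_def by (auto simp: delete_edges_simps)
qed

lemma sub_of_isolated: "sub_of (S\<lparr>isolated := i\<rparr>) M \<longleftrightarrow> sub_of S M"
  by (simp add: sub_of_def is_map_def)

lemma submap_sub_of:
  assumes "submap S M" "is_map M"
  shows "sub_of S M"
proof -
  from assms(1) obtain E where E: "E \<subseteq> edges M" "delete_vertex\<^sup>*\<^sup>* (delete_edges M E) S" unfolding submap_def by blast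
  from E(2) show ?thesis
  proof (induct rule: rtranclp_induct)
    case base then show ?case by (rule sub_of_delete_edges[OF assms(2) E(1)])
  next
    case (step T U)
    have T: "is_map T" using step(3) by (simp add: sub_of_def)
    from step(2) show ?case
    proof cases
      case isolated_vertex
      then show ?thesis using step(3) by (simp add: remove_isolated_def sub_of_isolated)
    next
      case (cross_vertex v)
      have "sub_of (delete_edges T {e \<in> edges T. e \<inter> v \<noteq> {}}) T" by (rule sub_of_delete_edges[OF T]) blast
      then have "sub_of U T" unfolding cross_vertex by (simp add: remove_isolated_def sub_of_isolated)
      then show ?thesis using step(3) assms(2) by (rule sub_of_trans)
    qed
  qed
qed

lemma orients_sub_of:
  assumes s: "sub_of S M" and m: "is_map M" and o: "orients D M"
  shows "orients (D \<inter> crosses S) S"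
  unfolding orients_def
proof (intro conjI ballI)
  show "D \<inter> crosses S \<subseteq> crosses S" by blast
  have mS: "is_map S" using s by (simp add: sub_of_def)
  fix c assume c: "c \<in> crosses S"
  then have cM: "c \<in> crosses M" using s by (auto simp: sub_of_def)
  have a: "alpha0 S c = alpha0 M c" "alpha2 S c = alpha2 M c" "alpha1 S c \<in> orbit (vperm M) (alpha2 M c)"
    using s c by (auto simp: sub_of_def)
  note S = is_mapD(2-4)[OF mS, of c] and oM = orientsD[OF o]
  have d: "darts D (vperm M) (erev M)" by (rule orients_darts[OF m o])
  have "alpha1 S c \<in> D \<longleftrightarrow> alpha2 M c \<in> D"
    using a(3) darts_orbit_subset[OF d, of "alpha2 M c"] darts_orbit_subset[OF d, of "alpha1 S c"] orbit_mem_sym[OF dartsD(2)[OF d] a(3)] by blast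
  then show "alpha1 S c \<in> D \<inter> crosses S \<longleftrightarrow> c \<notin> D \<inter> crosses S" using oM(4)[OF cM] S c by blast
  show "alpha0 S c \<in> D \<inter> crosses S \<longleftrightarrow> c \<notin> D \<inter> crosses S" "alpha2 S c \<in> D \<inter> crosses S \<longleftrightarrow> c \<notin> D \<inter> crosses S"
    using a oM(2,4)[OF cM] S c by auto
  show "erev S c \<noteq> c" using sub_of_vperm(2)[OF s m c] oM(5)[OF cM] by simp
qed

lemma cycle_struct_vertex:
  assumes c: "cycle_struct M D x n" and j: "j < n"
  shows "orbit (vperm M) (erev M (x j)) = {erev M (x j), x (Suc j mod n)}"
    "orbit (vperm M) (x (Suc j mod n)) = {x (Suc j mod n), erev M (x j)}"
  using orbit_two[of "vperm M"] cycle_structD(6,7)[OF c j] by blast+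

text \<open>If no cross is missing, the labelling of the whole cycle is taken over. Otherwise some
  edge is missing and the cycle is cut open there, so \<open>t\<close> is the gradient of an
  integer-valued labelling and all face sums vanish.\<close>

lemma labellable_sub_cycle:
  assumes s: "sub_of S M" and c: "cycle_struct M D x n" and n: "n > 0"
  shows "labellable S (int n)"
proof -
  have m: "is_map M" and o: "orients D M" and mS: "is_map S" using cycle_structD[OF c] s by (auto simp: sub_of_def)
  have oS: "orients (D \<inter> crosses S) S" by (rule orients_sub_of[OF s m o])
  have d: "darts D (vperm M) (erev M)" by (rule orients_darts[OF m o])
  have dS: "darts (D \<inter> crosses S) (vperm S) (erev S)" by (rule orients_darts[OF mS oS])
  have DC: "D \<subseteq> crosses M" by (rule orientsD(1)[OF o])
  show ?thesis
  proof (cases "crosses S = crosses M")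
    case True
    have DS: "D \<inter> crosses S = D" using DC True by blast
    obtain q t where l: "labelled D (vperm M) (erev M) (int n) q t" using labelled_cycle[OF c n] by blast
    have eq: "vperm M y = vperm S y" "erev M y = erev S y" if "y \<in> D" for y
    proof -
      have y: "y \<in> crosses S" "alpha2 S y \<in> crosses S" using that DC True is_mapD(4)[OF mS] by auto
      then have "alpha1 S (alpha2 S y) = alpha1 M (alpha2 M y)" "alpha0 S (alpha2 S y) = alpha0 M (alpha2 M y)"
        using s True unfolding sub_of_def by auto
      then show "vperm M y = vperm S y" "erev M y = erev S y" by (simp_all add: vperm_def erev_def)
    qed
    have dS': "darts D (vperm S) (erev S)" using dS unfolding DS .
    have "tens D (vperm S) (erev S) (int n) t" by (rule tens_cong[OF d dS' _ _ _ labelledD(1)[OF l]]) (use eq in auto)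
    then have "labelled D (vperm S) (erev S) (int n) q t" using labelledD(2,3)[OF l] eq by (simp add: labelled_def)
    then show ?thesis using labellableI[OF mS] oS unfolding DS by blast
  next
    case False
    then obtain z where z: "z \<in> crosses M" "z \<notin> crosses S" using s by (auto simp: sub_of_def)
    have cl: "alpha0 M y \<in> crosses S \<longleftrightarrow> y \<in> crosses S" "alpha2 M y \<in> crosses S \<longleftrightarrow> y \<in> crosses S" for y
    proof -
      have "alpha0 M y \<in> crosses S \<and> alpha2 M y \<in> crosses S" if "y \<in> crosses S" for y
        using s that is_mapD(2,4)[OF mS, of y] by (auto simp: sub_of_def)
      then show "alpha0 M y \<in> crosses S \<longleftrightarrow> y \<in> crosses S" "alpha2 M y \<in> crosses S \<longleftrightarrow> y \<in> crosses S"
        using is_mapD(5,7)[OF m] by metis+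
    qed
    have ecl: "erev M y \<in> crosses S \<longleftrightarrow> y \<in> crosses S" for y using cl by (simp add: erev_def)
    obtain z' where z': "z' \<in> D" "z' \<notin> crosses S" using z cl(2)[of z] orientsD(4)[OF o z(1)] by metis
    obtain k where k: "k < n" "x k \<notin> crosses S"
      by (rule cycle_struct_cases[OF c z'(1)]) (use z' ecl that in auto)
    \<comment> \<open>Position counted from the vertex after the missing edge \<open>x k\<close>;
      the jump from \<open>n - 1\<close> to 0 happens exactly across that edge.\<close>
    define r where "r j = (j + n - k - 1) mod n" for j
    have rS: "r (Suc j mod n) = r j + 1" if j: "j < n" "j \<noteq> k" for j
    proof -
      have rj: "r j \<noteq> n - 1"
      proof
        assume *: "r j = n - 1"
        have "r j = (if j > k then j - k - 1 else j + n - k - 1)"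
          using j k(1) unfolding r_def by (auto simp: mod_if)
        then show False using * j k(1) by (auto split: if_splits)
      qed
      have "r j < n" using n by (simp add: r_def)
      then have lt: "r j + 1 < n" using rj by simp
      have "r (Suc j mod n) = (Suc j mod n + (n - k - 1)) mod n" unfolding r_def using k(1) by (simp add: algebra_simps)
      also have "\<dots> = (Suc j + (n - k - 1)) mod n" by (simp add: mod_add_left_eq)
      also have "\<dots> = Suc (j + n - k - 1) mod n" using k(1) by simp
      also have "\<dots> = Suc (r j) mod n" unfolding r_def by (simp add: mod_Suc_eq)
      also have "\<dots> = r j + 1" using lt by simp
      finally show ?thesis .
    qed
    let ?D = "D \<inter> crosses S"
    let ?t = "cycle_fun x n (erev M) (\<lambda>_. 1) (\<lambda>_. - 1) :: 'a \<Rightarrow> int"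
    let ?q = "cycle_fun x n (erev M) (\<lambda>j. int (r j)) (\<lambda>j. int (r j) + 1)"
    note ts = cycle_fun_simps[OF c, of _ "\<lambda>_. 1 :: int" "\<lambda>_. - 1"]
      and qs = cycle_fun_simps[OF c, of _ "\<lambda>j. int (r j)" "\<lambda>j. int (r j) + 1"]
    have ee: "erev M (erev M y) = y" for y by (rule erev_simps(1)[OF m])
    have eS: "erev S y = erev M y" if "y \<in> ?D" for y using sub_of_vperm(2)[OF s m] that by blast
    have te: "(?t y = 1 \<or> ?t y = -1) \<and> ?t (erev M y) = - ?t y \<and> ?q (erev M y) - ?q y = ?t y" if y: "y \<in> D" for y
      by (rule cycle_struct_cases[OF c y]) (auto simp: ts qs ee)
    have qv: "?q (vperm S y) = ?q y" if y: "y \<in> ?D" for y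
    proof -
      have vy: "vperm S y \<in> ?D" using dartsD(4)[OF dS] y by simp
      have vo: "vperm S y \<in> orbit (vperm M) y" using sub_of_vperm(1)[OF s m] y by blast
      have yD: "y \<in> D" using y by blast
      obtain j where j: "j < n" "y \<in> {erev M (x j), x (Suc j mod n)}"
      proof (rule cycle_struct_cases[OF c yD])
        fix i assume "i < n" "y = x i"
        then show ?thesis using Suc_mod_surj[of i n] that by blast
      qed (use that in blast)
      then have "vperm S y \<in> {erev M (x j), x (Suc j mod n)}"
        using vo cycle_struct_vertex[OF c j(1)] by auto
      moreover have "?q (erev M (x j)) = ?q (x (Suc j mod n))" if "erev M (x j) \<in> crosses S"
      proof -
        have "j \<noteq> k" using that ecl k(2) by auto
        moreover have "Suc j mod n < n" using j by simp
        ultimately show ?thesis using rS[OF j(1)] qs j(1) by simp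
      qed
      ultimately show ?thesis using j(2) y vy by auto
    qed
    let ?f = "vperm S \<circ> erev S"
    have os: "osum ?f ?t y = 0" if y: "y \<in> ?D" for y
    proof (rule telescope_orbit[OF dartsD(7)[OF dS], of _ _ ?q])
      fix u assume "u \<in> orbit ?f y"
      then have u: "u \<in> ?D" using darts_face_subset[OF dS y] by blast
      then have "erev S u \<in> ?D" using dartsD(5)[OF dS] by simp
      then have "?q (?f u) = ?q (erev M u)" using qv eS[OF u] by simp
      moreover have "?q (erev M u) - ?q u = ?t u" using te u by blast
      ultimately show "?t u = ?q (?f u) - ?q u" by simp
    qed
    have "tens ?D (vperm S) (erev S) (int n) ?t"
      by (rule tensI) (use te eS os in auto)
    moreover have "int n dvd ?q (erev S y) - ?q y - ?t y" if "y \<in> ?D" for y using te eS[OF that] that by simp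
    ultimately have "labelled ?D (vperm S) (erev S) (int n) ?q ?t" using qv unfolding labelled_def by blast
    then show ?thesis by (rule labellableI[OF mS oS])
  qed
qed

section \<open>The cycle bounding a cut\<close>

text \<open>All edges outside the cut are deleted. Going round a vertex from the end of a cut dart,
  the deleted darts that are passed stay in \<open>R\<close>, so the next remaining dart is again a
  cut dart. Each such step raises \<open>q\<close> by one modulo \<open>n\<close>; hence
  \<open>n\<close> successive darts are different, and they are the whole cut.\<close>

lemma cut_cycle:
  assumes m: "is_map M" and o: "orients D M" and l: "labelled D (vperm M) (erev M) (int n) q t" and n: "n > 0"
    and R: "R \<subseteq> D" "\<And>x. x \<in> R \<Longrightarrow> vperm M (erev M x) \<in> R" "card {x \<in> R. erev M x \<notin> R} = n"
      "\<And>x. x \<in> R \<Longrightarrow> erev M x \<notin> R \<Longrightarrow> t x = 1"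
  shows "\<exists>E\<subseteq>edges M. \<exists>D0 y. cycle_struct (delete_edges M E) D0 y n"
proof -
  let ?v = "vperm M" and ?e = "erev M"
  note * = is_mapD[OF m] and oM = orientsD[OF o]
  have d: "darts D ?v ?e" by (rule orients_darts[OF m o])
  have ee: "?e (?e x) = x" for x by (rule dartsD(6)[OF d])
  define P where "P = {x \<in> R. ?e x \<notin> R}"
  have PD: "x \<in> D" "x \<in> R" "?e x \<notin> R" "t x = 1" if "x \<in> P" for x using that R(1,4) by (auto simp: P_def)
  define E where "E = edges M - edge_of M ` P"
  have E: "E \<subseteq> edges M" by (auto simp: E_def)
  let ?N = "delete_edges M E"
  have mN: "is_map ?N" by (rule is_map_delete_edges[OF m E])
  have oN: "orients (D - \<Union>E) ?N" by (rule orients_delete_edges[OF m E o])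
  have dN: "darts (D - \<Union>E) (vperm ?N) (erev ?N)" by (rule orients_darts[OF mN oN])
  have edge_D: "edge_of M x \<inter> D = {x, ?e x}" if "x \<in> D" for x
  proof -
    have "alpha0 M x \<notin> D" "alpha2 M x \<notin> D" "?e x \<in> D" using oM(1,2,4) that dartsD(5)[OF d] by blast+
    then show ?thesis unfolding edge_of_eq[OF m] using that by blast
  qed
  have edge_eq: "edge_of M y = edge_of M x" if "y \<in> edge_of M x" for x y
    using that unfolding edge_of_def by (rule gorbit_eq)
  have memE: "x \<in> \<Union>E \<longleftrightarrow> x \<notin> P \<and> ?e x \<notin> P" if x: "x \<in> D" for x
  proof
    assume "x \<in> \<Union>E"
    then obtain w where w: "edge_of M w \<in> edges M" "edge_of M w \<notin> edge_of M ` P" "x \<in> edge_of M w"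
      by (auto simp: E_def edges_def)
    then have "edge_of M x \<notin> edge_of M ` P" using edge_eq by metis
    moreover have "edge_of M (?e x) = edge_of M x" by (rule edge_eq) (simp add: edge_of_eq[OF m])
    ultimately show "x \<notin> P \<and> ?e x \<notin> P" by (metis imageI)
  next
    assume nP: "x \<notin> P \<and> ?e x \<notin> P"
    have "edge_of M x \<notin> edge_of M ` P"
    proof
      assume "edge_of M x \<in> edge_of M ` P"
      then obtain y where y: "y \<in> P" "edge_of M x = edge_of M y" by blast
      then have "x \<in> edge_of M y \<inter> D" using x by (metis IntI edge_of_def gorbit_self)
      then have "x = y \<or> x = ?e y" using edge_D[OF PD(1)[OF y(1)]] by blast
      then show False using nP y(1) ee by metis
    qed
    moreover have "edge_of M x \<in> edges M" using x oM(1) by (auto simp: edges_def)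
    moreover have "x \<in> edge_of M x" by (simp add: edge_of_def)
    ultimately show "x \<in> \<Union>E" unfolding E_def by blast
  qed
  have D0: "D - \<Union>E = P \<union> ?e ` P"
  proof
    show "D - \<Union>E \<subseteq> P \<union> ?e ` P"
    proof
      fix x assume "x \<in> D - \<Union>E"
      then have "x \<in> P \<or> ?e x \<in> P" using memE by blast
      then show "x \<in> P \<union> ?e ` P" using ee by (metis UnCI imageI)
    qed
    have "x \<in> D - \<Union>E" "?e x \<in> D - \<Union>E" if x: "x \<in> P" for x
      using memE[of x] memE[of "?e x"] PD(1)[OF x] dartsD(5)[OF d, of x] ee[of x] x by simp_all
    then show "P \<union> ?e ` P \<subseteq> D - \<Union>E" by blast
  qed
  have xC: "x \<in> crosses M - \<Union>E" if "x \<in> P \<union> ?e ` P" for x using that oM(1) unfolding D0[symmetric] by blast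
  have eN: "erev ?N x = ?e x" if "x \<in> P \<union> ?e ` P" for x using erev_delete_edges[OF m E xC[OF that]] .
  have qpow: "q ((?v ^^ k) x) = q x" if "x \<in> D" for k x
    using labelledD(2)[OF l] orients_vperm_pow[OF m o] that by (induct k) auto
  have vN: "\<exists>k>0. vperm ?N x = (?v ^^ k) x \<and> (\<forall>i. 0 < i \<longrightarrow> i < k \<longrightarrow> (?v ^^ i) x \<in> \<Union>E)" if x: "x \<in> P \<union> ?e ` P" for x
  proof -
    have "x \<notin> \<Union>E" using xC[OF x] by blast
    from skip_ex[OF dartsD(2)[OF d] this] obtain k where "0 < k" "\<And>i. 0 < i \<Longrightarrow> i < k \<Longrightarrow> (?v ^^ i) x \<in> \<Union>E" "skip ?v (\<Union>E) x = (?v ^^ k) x"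
      by metis
    then show ?thesis using vperm_delete_edges[OF m E xC[OF x]] by metis
  qed
  have vND: "vperm ?N x \<in> P \<union> ?e ` P" if "x \<in> P \<union> ?e ` P" for x using dartsD(4)[OF dN, of x] that unfolding D0 by blast
  have qN: "q (vperm ?N x) = q x" if x: "x \<in> P \<union> ?e ` P" for x
  proof -
    have "x \<in> D" using x unfolding D0[symmetric] by blast
    then show ?thesis using vN[OF x] qpow by metis
  qed
  define \<psi> where "\<psi> x = vperm ?N (?e x)" for x
  have \<psi>P: "\<psi> x \<in> P" if x: "x \<in> P" for x
  proof -
    have ex: "?e x \<in> P \<union> ?e ` P" using x by blast
    obtain k where k: "k > 0" "vperm ?N (?e x) = (?v ^^ k) (?e x)" "\<forall>i. 0 < i \<longrightarrow> i < k \<longrightarrow> (?v ^^ i) (?e x) \<in> \<Union>E"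
      using vN[OF ex] by blast
    \<comment> \<open>A deleted dart of \<open>R\<close> has its reverse in \<open>R\<close>, and
      \<open>R\<close> is closed under the face permutation, so the next dart at the vertex is in
      \<open>R\<close> too.\<close>
    have "(?v ^^ i) (?e x) \<in> R" if "0 < i" "i \<le> k" for i
      using that
    proof (induct i)
      case (Suc i)
      show ?case
      proof (cases "i = 0")
        case True then show ?thesis using R(2)[OF PD(2)[OF x]] by simp
      next
        case False
        let ?y = "(?v ^^ i) (?e x)"
        have y: "?y \<in> R" "?y \<in> \<Union>E" using Suc False k(3) by auto
        then have "?y \<notin> P" using memE[of ?y] R(1) by blast
        then have "?e ?y \<in> R" using y(1) by (simp add: P_def)
        then have "?v (?e (?e ?y)) \<in> R" by (rule R(2))
        then show ?thesis using ee by simp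
      qed
    qed simp
    then have "\<psi> x \<in> R" using k by (simp add: \<psi>_def)
    moreover have "\<psi> x \<in> P \<union> ?e ` P" unfolding \<psi>_def by (rule vND[OF ex])
    ultimately show ?thesis using PD(3) by (metis Un_iff imageE)
  qed
  have qe: "int n dvd q (?e x) - q x - 1" if "x \<in> P" for x
    using labelledD(3)[OF l PD(1)[OF that]] PD(4)[OF that] by simp
  have q\<psi>: "int n dvd q (\<psi> x) - q x - 1" if x: "x \<in> P" for x
  proof -
    have "q (\<psi> x) = q (?e x)" unfolding \<psi>_def by (rule qN) (use x in blast)
    then show ?thesis using qe[OF x] by simp
  qed
  have cardP: "card P = n" using R(3) by (simp add: P_def)
  then obtain x0 where x0: "x0 \<in> P" using n by (metis card.empty all_not_in_conv less_irrefl)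
  define y where "y j = (\<psi> ^^ j) x0" for j
  have yP: "y j \<in> P" for j unfolding y_def by (induct j) (use x0 \<psi>P in auto)
  have qy: "int n dvd q (y j) - q x0 - int j" for j
  proof (induct j)
    case (Suc j)
    have "q (y (Suc j)) - q x0 - int (Suc j) = (q (\<psi> (y j)) - q (y j) - 1) + (q (y j) - q x0 - int j)"
      by (simp add: y_def)
    then show ?case using dvd_add[OF q\<psi>[OF yP[of j]] Suc] by (simp only:)
  qed (simp add: y_def)
  have small: "i = j" if "i < n" "j < n" "int n dvd int i - int j" for i j
  proof -
    have "int i mod int n = int j mod int n" using that(3) by (simp add: mod_eq_dvd_iff)
    then show ?thesis using that(1,2) by simp
  qed
  have idx: "i = j" if "i < n" "j < n" "int n dvd q (y i) - q (y j)" for i j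
  proof (rule small[OF that(1,2)])
    have "int i - int j = (q (y i) - q (y j)) - (q (y i) - q x0 - int i) + (q (y j) - q x0 - int j)" by simp
    then show "int n dvd int i - int j" using that(3) qy[of i] qy[of j] by (metis dvd_add dvd_diff)
  qed
  have inj: "inj_on y {..<n}" by (rule inj_onI) (use idx in auto)
  have Py: "P = y ` {..<n}"
  proof (rule card_subset_eq[symmetric])
    show "finite P" using cardP n card_gt_0_iff by metis
    show "y ` {..<n} \<subseteq> P" using yP by blast
    show "card (y ` {..<n}) = card P" using card_image[OF inj] cardP by simp
  qed
  have s1: "vperm ?N (?e (y j)) = y (Suc j mod n)" if j: "j < n" for j
  proof (cases "Suc j < n")
    case True then show ?thesis by (simp add: y_def \<psi>_def)
  next
    case False
    then have Sj: "Suc j = n" using j by simp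
    obtain i where i: "i < n" "y n = y i" using yP[of n] Py by blast
    \<comment> \<open>After \<open>n\<close> steps the label is back at its initial value modulo
      \<open>n\<close>, which among the first \<open>n\<close> darts only \<open>y 0\<close>
      has.\<close>
    have "i = 0"
    proof (rule small[OF i(1) n])
      have "int i - int 0 = (q (y n) - q x0 - int n) - (q (y i) - q x0 - int i) + int n" using i(2) by simp
      then show "int n dvd int i - int 0" using qy[of n] qy[of i] by (metis dvd_add dvd_diff dvd_refl)
    qed
    then have "y (Suc j) = y 0" using i Sj by simp
    moreover have "vperm ?N (?e (y j)) = y (Suc j)" by (simp add: y_def \<psi>_def)
    ultimately show ?thesis using Sj by simp
  qed
  have sep: "y i \<noteq> ?e (y j)" for i j using PD(2,3) yP by metis
  \<comment> \<open>The labels leave only two candidates: \<open>y (Suc j mod n)\<close> itself,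
    excluded by injectivity of the rotation, and \<open>?e (y j)\<close>.\<close>
  have s2: "vperm ?N (y (Suc j mod n)) = ?e (y j)" if j: "j < n" for j
  proof -
    let ?z = "vperm ?N (y (Suc j mod n))"
    have S: "Suc j mod n < n" using j by simp
    have yS: "y (Suc j mod n) \<in> P \<union> ?e ` P" using yP by blast
    have "?z \<in> P \<union> ?e ` P" by (rule vND[OF yS])
    then consider i where "i < n" "?z = y i" | i where "i < n" "?z = ?e (y i)" unfolding Py by blast
    then show ?thesis
    proof cases
      case (1 i)
      have "q (y i) = q (y (Suc j mod n))" using qN[OF yS] 1 by simp
      then have "i = Suc j mod n" using idx[OF 1(1) S] by simp
      then have "?z = vperm ?N (?e (y j))" using s1[OF j] 1 by simp
      then have "y (Suc j mod n) = ?e (y j)" using permutation_inj[OF dartsD(2)[OF dN]] by blast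
      then show ?thesis using sep by blast
    next
      case (2 i)
      have 1: "q (?e (y i)) = q (y (Suc j mod n))" using qN[OF yS] 2 by simp
      have 3: "q (?e (y j)) = q (y (Suc j mod n))" using qN[of "?e (y j)"] s1[OF j] yP by simp
      have "q (y i) - q (y j) = (q (?e (y j)) - q (y j) - 1) - (q (?e (y i)) - q (y i) - 1)" using 1 3 by simp
      then have "int n dvd q (y i) - q (y j)" using qe[OF yP[of i]] qe[OF yP[of j]] by (metis dvd_diff)
      then show ?thesis using idx[OF 2(1) j] 2 by simp
    qed
  qed
  have en: "erev ?N (y j) = ?e (y j)" for j using eN yP by blast
  have "cycle_struct ?N (D - \<Union>E) y n"
    unfolding cycle_struct_def
  proof (intro conjI allI impI)
    show "D - \<Union>E = y ` {..<n} \<union> erev ?N ` y ` {..<n}" unfolding D0 Py image_image en ..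
    fix j assume j: "j < n"
    show "y i \<noteq> erev ?N (y j)" for i unfolding en by (rule sep)
    show "vperm ?N (erev ?N (y j)) = y (Suc j mod n)" "vperm ?N (y (Suc j mod n)) = erev ?N (y j)"
      unfolding en using s1[OF j] s2[OF j] by auto
  qed (use mN oN inj sep en in auto)
  then show ?thesis using E by blast
qed

section \<open>Homomorphisms to cycles\<close>

lemma delete_isolated: "delete_vertex\<^sup>*\<^sup>* (M\<lparr>isolated := i + k\<rparr>) (M\<lparr>isolated := i\<rparr>)"
proof (induct k)
  case (Suc k)
  have "delete_vertex (M\<lparr>isolated := i + Suc k\<rparr>) (remove_isolated (M\<lparr>isolated := i + Suc k\<rparr>))"
    by (rule delete_vertex.isolated_vertex) simp
  then have "delete_vertex (M\<lparr>isolated := i + Suc k\<rparr>) (M\<lparr>isolated := i + k\<rparr>)" by (simp add: remove_isolated_def)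
  then show ?case using Suc by (rule converse_rtranclp_into_rtranclp)
qed simp

lemma submap_delete_edges:
  assumes "E \<subseteq> edges M" "i \<le> isolated (delete_edges M E)"
  shows "submap ((delete_edges M E)\<lparr>isolated := i\<rparr>) M"
proof -
  have "delete_vertex\<^sup>*\<^sup>* (delete_edges M E) ((delete_edges M E)\<lparr>isolated := i\<rparr>)"
    using delete_isolated[where M = "delete_edges M E" and i = i and k = "isolated (delete_edges M E) - i"] assms(2) by simp
  then show ?thesis unfolding submap_def using assms(1) by blast
qed

text \<open>At least one vertex has to remain for the others to be glued to, hence the condition on
  \<open>i\<close> for maps without crosses.\<close>

lemma glue_isolated_vertices:
  assumes f: "finite (crosses M)" and i: "crosses M = {} \<Longrightarrow> i > 0"
  shows "gluing\<^sup>*\<^sup>* (M\<lparr>isolated := i + k\<rparr>) (M\<lparr>isolated := i\<rparr>)"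
proof (induct k)
  case (Suc k)
  let ?M = "M\<lparr>isolated := i + Suc k\<rparr>"
  have v: "vertex_of ?M = vertex_of M" by (simp add: vertex_of_def)
  have "card (vertices ?M) = card (vertex_of M ` crosses M) + (i + Suc k)"
    unfolding vertices_def v using card_Plus_image[of "vertex_of M ` crosses M" "i + Suc k"] f by simp
  moreover have "card (vertex_of M ` crosses M) > 0 \<or> i > 0" using i f by (auto simp: card_gt_0_iff)
  ultimately have "2 \<le> card (vertices ?M)" by linarith
  then have "vertex_gluing ?M (remove_isolated ?M)" by (intro vertex_gluing.glue_isolated) auto
  then have "gluing ?M (M\<lparr>isolated := i + k\<rparr>)" by (simp add: gluing_def remove_isolated_def)
  then show ?case using Suc by (rule converse_rtranclp_into_rtranclp)
qed simp

lemma glue_isolated_vertices':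
  assumes "finite (crosses M)" "crosses M = {} \<Longrightarrow> i > 0" "i \<le> isolated M"
  shows "gluing\<^sup>*\<^sup>* M (M\<lparr>isolated := i\<rparr>)"
  using glue_isolated_vertices[OF assms(1,2), where k = "isolated M - i"] assms(3) by simp

lemma is_map_isolated: "is_map (M\<lparr>isolated := i\<rparr>) \<longleftrightarrow> is_map M"
  by (simp add: is_map_def)

lemma isolated_update_simps:
  "orients D (M\<lparr>isolated := i\<rparr>) \<longleftrightarrow> orients D M" "vperm (M\<lparr>isolated := i\<rparr>) = vperm M" "erev (M\<lparr>isolated := i\<rparr>) = erev M"
  by (simp_all add: orients_def vperm_def erev_def)

lemma cycle_struct_isolated: "cycle_struct (M\<lparr>isolated := i\<rparr>) D x n \<longleftrightarrow> cycle_struct M D x n"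
  by (simp add: cycle_struct_def is_map_isolated isolated_update_simps)

lemma fold_result_submap:
  assumes L: "fold_result L n" and c: "cycle_struct X D x n" and i: "isolated X = 0" and n: "n \<ge> 2"
  shows "\<exists>L' S. gluing\<^sup>*\<^sup>* L L' \<and> submap S X \<and> map_iso L' S"
proof -
  have m: "is_map X" and o: "orients D X" using cycle_structD[OF c] by auto
  have mL: "is_map L" using L by (simp add: fold_result_def)
  note fin = is_mapD(1)[OF mL]
  have xC: "x j \<in> crosses X" if "j < n" for j using cycle_structD(9)[OF c that] orientsD(1)[OF o] by blast
  have UX: "\<Union>(edges X) = crosses X"
  proof
    show "\<Union>(edges X) \<subseteq> crosses X" using edges_subset_crosses[OF m] by blast
    show "crosses X \<subseteq> \<Union>(edges X)" by (auto simp: edges_def edge_of_def)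
  qed
  from L consider "crosses L = {}" | D' c' where "orients D' L" "D' = {c', erev L c'}" "vperm L c' = c'" "vperm L (erev L c') = erev L c'"
    | D' x' where "cycle_struct L D' x' n" unfolding fold_result_def by blast
  then show ?thesis
  proof cases
    case 1
    \<comment> \<open>If \<open>L\<close> is the empty map, it corresponds to the submap with
      everything deleted; otherwise its vertices are glued to a single one.\<close>
    define k where "k = min (isolated L) 1"
    have gl: "gluing\<^sup>*\<^sup>* L (L\<lparr>isolated := k\<rparr>)"
    proof (cases "isolated L = 0")
      case True
      then have "L\<lparr>isolated := k\<rparr> = L" by (simp add: k_def)
      then show ?thesis by simp
    next
      case False
      then show ?thesis by (intro glue_isolated_vertices'[OF fin]) (auto simp: k_def)
    qed
    let ?S = "delete_edges X (edges X)"
    have "vertex_of X (x 0) \<in> {v \<in> vertex_of X ` crosses X. v \<subseteq> \<Union>(edges X)}"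
    proof -
      have "vertex_of X (x 0) \<subseteq> crosses X" unfolding vertex_of_def
        by (rule gorbit_closed) (use is_mapD[OF m] xC[of 0] n in auto)
      then show ?thesis using xC[of 0] n UX by auto
    qed
    then have "card {v \<in> vertex_of X ` crosses X. v \<subseteq> \<Union>(edges X)} > 0"
      using is_mapD(1)[OF m] by (auto simp: card_gt_0_iff)
    then have "isolated ?S \<ge> 1" by (simp add: delete_edges_def Let_def)
    then have "submap (?S\<lparr>isolated := k\<rparr>) X" by (intro submap_delete_edges) (auto simp: k_def)
    moreover have "crosses ?S = {}" using UX by (simp add: delete_edges_simps)
    then have "map_iso (L\<lparr>isolated := k\<rparr>) (?S\<lparr>isolated := k\<rparr>)" using 1 by (simp add: map_iso_def bij_betw_def)
    ultimately show ?thesis using gl by blast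
  next
    case (2 D' c')
    have "c' \<in> crosses L" using 2 orientsD(1)[OF 2(1)] by auto
    then have gl: "gluing\<^sup>*\<^sup>* L (L\<lparr>isolated := 0\<rparr>)" by (intro glue_isolated_vertices'[OF fin]) auto
    define E where "E = edges X - {edge_of X (x 0)}"
    have E: "E \<subseteq> edges X" by (auto simp: E_def)
    let ?S = "delete_edges X E"
    have sm: "submap (?S\<lparr>isolated := 0\<rparr>) X" by (rule submap_delete_edges[OF E]) simp
    have mS: "is_map ?S" by (rule is_map_delete_edges[OF m E])
    have sub: "sub_of ?S X" by (rule sub_of_delete_edges[OF m E])
    have oS: "orients (D \<inter> crosses ?S) ?S" by (rule orients_sub_of[OF sub m o])
    have n0: "0 < n" using n by simp
    have CS: "crosses ?S = edge_of X (x 0)"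
    proof -
      have dis: "y \<notin> \<Union>E" if "y \<in> edge_of X (x 0)" for y
      proof
        assume "y \<in> \<Union>E"
        then obtain w where w: "edge_of X w \<noteq> edge_of X (x 0)" "y \<in> edge_of X w" by (auto simp: E_def edges_def)
        have "edge_of X y = edge_of X w" "edge_of X y = edge_of X (x 0)" using w(2) that unfolding edge_of_def by (blast dest: gorbit_eq)+
        then show False using w(1) by simp
      qed
      have e0: "edge_of X (x 0) \<in> edges X" using xC[OF n0] by (simp add: edges_def)
      have "\<Union>(edges X) - \<Union>E = edge_of X (x 0)" using dis e0 unfolding E_def by blast
      then show ?thesis using UX by (simp add: delete_edges_simps)
    qed
    let ?c = "x 0"
    have cD: "?c \<in> D" "erev X ?c \<in> D" using cycle_structD(9,10)[OF c n0] .
    have DS: "D \<inter> crosses ?S = {?c, erev X ?c}"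
    proof -
      have "alpha0 X ?c \<notin> D" "alpha2 X ?c \<notin> D" using orientsD(2,4)[OF o xC[OF n0]] cD by auto
      then show ?thesis unfolding CS edge_of_eq[OF m] using cD by blast
    qed
    have cS: "?c \<in> crosses ?S" "erev X ?c \<in> crosses ?S" using DS by blast+
    have eS: "erev ?S y = erev X y" if "y \<in> crosses ?S" for y by (rule sub_of_vperm(2)[OF sub m that])
    have dS: "darts (D \<inter> crosses ?S) (vperm ?S) (erev ?S)" by (rule orients_darts[OF mS oS])
    have vD: "vperm ?S y \<in> {?c, erev X ?c}" if "y \<in> {?c, erev X ?c}" for y
      using dartsD(4)[OF dS, of y] that unfolding DS by blast
    have xinj: "x i = x j \<longleftrightarrow> i = j" if "i < n" "j < n" for i j using cycle_structD(4)[OF c] that by (auto simp: inj_on_def)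
    have einj: "erev X y = erev X z \<longleftrightarrow> y = z" for y z by (metis erev_simps(1)[OF m])
    \<comment> \<open>At the far end the old cycle only offers the darts \<open>erev X (x 0)\<close>
      and \<open>x 1\<close>, and \<open>x 1\<close> has been deleted.\<close>
    have v1: "vperm ?S (erev X ?c) = erev X ?c"
    proof -
      have "vperm ?S (erev X ?c) \<in> {erev X ?c, x 1}"
        using sub_of_vperm(1)[OF sub m cS(2)] cycle_struct_vertex(1)[OF c n0] n by simp
      moreover have "x 1 \<noteq> ?c" using xinj[of 1 0] n by simp
      moreover have "x 1 \<noteq> erev X ?c" using cycle_structD(5)[OF c, of 1 0] n by simp
      ultimately show ?thesis using vD[of "erev X ?c"] by auto
    qed
    have v0: "vperm ?S ?c = ?c"
    proof -
      have S: "Suc (n - 1) mod n = 0" "n - 1 < n" using n by auto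
      have "vperm ?S ?c \<in> {?c, erev X (x (n - 1))}"
        using sub_of_vperm(1)[OF sub m cS(1)] cycle_struct_vertex(2)[OF c S(2)] unfolding S(1) by simp
      moreover have "erev X (x (n - 1)) \<noteq> erev X ?c" using xinj[of "n - 1" 0] n einj by simp
      moreover have "erev X (x (n - 1)) \<noteq> ?c" using cycle_structD(5)[OF c n0 S(2)] by simp
      ultimately show ?thesis using vD[of ?c] by auto
    qed
    define k where "k y = (if y = c' then ?c else erev X ?c)" for y
    have ne': "erev L c' \<noteq> c'" using orientsD(5)[OF 2(1) \<open>c' \<in> crosses L\<close>] .
    have ne: "erev X ?c \<noteq> ?c" using orientsD(5)[OF o xC[OF n0]] .
    have ee: "erev L (erev L c') = c'" "erev X (erev X ?c) = ?c" using erev_simps(1)[OF mL] erev_simps(1)[OF m] by auto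
    have "bij_betw k D' (D \<inter> crosses ?S)" unfolding bij_betw_def DS 2(2) using ne ne' by (auto simp: k_def)
    moreover have "k (vperm L y) = vperm ?S (k y)" "k (erev L y) = erev ?S (k y)" if "y \<in> D'" for y
      using that 2 v0 v1 ne' ee eS[OF cS(1)] eS[OF cS(2)] by (auto simp: k_def)
    ultimately have "map_iso (L\<lparr>isolated := 0\<rparr>) (?S\<lparr>isolated := 0\<rparr>)"
      using 2(1) oS mL mS by (intro map_iso_oriented[where D = D' and D' = "D \<inter> crosses ?S" and k = k])
        (simp_all add: is_map_isolated isolated_update_simps)
    then show ?thesis using sm gl by blast
  next
    case (3 D' x')
    have "x' 0 \<in> crosses L" using cycle_structD(9)[OF 3, of 0] orientsD(1)[OF cycle_structD(2)[OF 3]] n by auto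
    then have "gluing\<^sup>*\<^sup>* L (L\<lparr>isolated := 0\<rparr>)" by (intro glue_isolated_vertices'[OF fin]) auto
    moreover have "map_iso (L\<lparr>isolated := 0\<rparr>) ((delete_edges X {})\<lparr>isolated := 0\<rparr>)"
    proof -
      have d0: "delete_edges X {} = X"
      proof -
        have s: "skip (vperm X) {} (alpha2 X y) = alpha1 X y" for y
        proof -
          have "skip (vperm X) {} (alpha2 X y) = (vperm X ^^ 1) (alpha2 X y)" by (rule skip_eqI) auto
          then show ?thesis using is_mapD(7)[OF m] by (simp add: vperm_def)
        qed
        have "vertex_of X c \<noteq> {}" for c unfolding vertex_of_def using gorbit_self by (metis empty_iff)
        then have "{v \<in> vertex_of X ` crosses X. v \<subseteq> {}} = {}" by auto
        then have "isolated (delete_edges X {}) = isolated X" by (simp add: delete_edges_def Let_def)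
        then show ?thesis
          using is_mapD(15-17)[OF m] by (intro premap.equality) (auto simp: delete_edges_def Let_def s fun_eq_iff)
      qed
      show ?thesis unfolding d0
        by (rule cycle_struct_iso[of _ D' x' n _ D x]) (use 3 c in \<open>simp_all add: cycle_struct_isolated\<close>)
    qed
    moreover have "submap ((delete_edges X {})\<lparr>isolated := 0\<rparr>) X" by (rule submap_delete_edges) auto
    ultimately show ?thesis by blast
  qed
qed

lemma tension_hom:
  assumes t: "tension_map M D (int n) t" and X: "plane_cycle n X" and n: "n \<ge> 3" and g: "signed_genus M = 0"
  shows "hom_exists M X"
proof -
  obtain DX x where c: "cycle_struct X DX x n" using plane_cycle_struct(2)[OF X n] by blast
  obtain L where L: "gluing\<^sup>*\<^sup>* M L" "fold_result L n" using fold_theorem[OF t] n by auto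
  obtain L' S where S: "gluing\<^sup>*\<^sup>* L L'" "submap S X" "map_iso L' S"
    using fold_result_submap[OF L(2) c plane_cycle_struct(1)[OF X n]] n by auto
  have "signed_genus X = 0" using X signed_genus_0_iff[of X] by (auto simp: plane_cycle_def plane_def)
  then show ?thesis unfolding hom_exists_def using g S L(1) by (metis rtranclp_trans)
qed

lemma plane_gap:
  fixes N :: "'c premap" and A :: "'a premap" and B :: "'b premap"
  assumes k: "n \<ge> 3" and A: "plane_cycle (n + 2) A" and B: "plane_cycle n B"
    and N: "is_map N" "signed_genus N = 0" "hom_exists N B"
  shows "hom_exists B N \<or> hom_exists N A"
proof -
  have mB: "is_map B" and sB: "signed_genus B = 0"
    using B signed_genus_0_iff[of B] by (auto simp: plane_cycle_def plane_def)
  obtain DB xB where cB: "cycle_struct B DB xB n" using plane_cycle_struct(2)[OF B k] by blast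
  obtain L S where L: "gluing\<^sup>*\<^sup>* N L" "submap S B" "map_iso L S" using N(3) unfolding hom_exists_def by blast
  have S: "sub_of S B" by (rule submap_sub_of[OF L(2) mB])
  then have "labellable S (int n)" using labellable_sub_cycle[OF _ cB] k by simp
  moreover have "is_map S" using S by (simp add: sub_of_def)
  ultimately have "labellable L (int n)" using labellable_iso[OF L(3)] is_map_gluing_star[OF L(1) N(1)] by blast
  then have lN: "labellable N (int n)" by (rule labellable_unglue_star[OF L(1) N(1)])
  have "euler_genus N = 0" using N(2) signed_genus_0_iff[OF N(1)] by simp
  then obtain D where o: "orients D N" and pl: "planar D (vperm N) (erev N)" using plane_orientable[OF N(1)] by blast
  obtain q t where l: "labelled D (vperm N) (erev N) (int n) q t" using lN o unfolding labellable_def by blast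
  have d: "darts D (vperm N) (erev N)" by (rule orients_darts[OF N(1) o])
  from augment[OF d labelledD(1)[OF l]] k consider t' where "tens D (vperm N) (erev N) (int n + 2) t'"
    | R where "R \<subseteq> D" "\<forall>x\<in>R. vperm N (erev N x) \<in> R" "int (card {x \<in> R. erev N x \<notin> R}) = int n" "\<forall>x\<in>R. erev N x \<notin> R \<longrightarrow> t x = 1"
    by auto
  then show ?thesis
  proof cases
    case (1 t')
    then have "tension_map N D (int (n + 2)) t'" using N(1) o pl by (simp add: tension_map_def add.commute)
    then have "hom_exists N A" using tension_hom[OF _ A _ N(2)] k by simp
    then show ?thesis ..
  next
    case (2 R)
    have "\<exists>E\<subseteq>edges N. \<exists>D0 y. cycle_struct (delete_edges N E) D0 y n"
      by (rule cut_cycle[OF N(1) o l _ 2(1)]) (use 2 k in auto)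
    then obtain E D0 y where E: "E \<subseteq> edges N" and c: "cycle_struct (delete_edges N E) D0 y n" by blast
    let ?S = "(delete_edges N E)\<lparr>isolated := 0\<rparr>"
    have "submap ?S N" by (rule submap_delete_edges[OF E]) simp
    moreover have "map_iso B ?S"
      by (rule cycle_struct_iso[OF cB]) (use c plane_cycle_struct(1)[OF B k] in \<open>simp_all add: cycle_struct_isolated\<close>)
    ultimately have "hom_exists B N" unfolding hom_exists_def using sB N(2) by auto
    then show ?thesis ..
  qed
qed

lemma cycle_hom:
  assumes n: "n \<ge> 3" and A: "plane_cycle (n + 2) A" and B: "plane_cycle n B"
  shows "hom_exists A B"
proof -
  obtain D x where c: "cycle_struct A D x (n + 2)" and pl: "planar D (vperm A) (erev A)"
    using plane_cycle_struct(2)[OF A] n by (metis trans_le_add1)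
  \<comment> \<open>One backward dart among \<open>n + 2\<close> gives the sum
    \<open>n + 1 - 1 = n\<close>; it is folded onto a neighbouring edge.\<close>
  define u :: "nat \<Rightarrow> int" where "u j = (if j = 0 then -1 else 1)" for j
  have "(\<Sum>j<n + 2. u j) = (\<Sum>j<Suc (Suc n). u j)" by simp
  also have "\<dots> = u 0 + (\<Sum>j<Suc n. u (Suc j))" by (rule sum.lessThan_Suc_shift)
  also have "\<dots> = int n" by (simp add: u_def)
  finally have su: "(\<Sum>j<n + 2. u j) = int n" .
  have "tens D (vperm A) (erev A) (int n) (cycle_fun x (n + 2) (erev A) u (\<lambda>j. - u j))"
    by (rule cycle_tens[OF c _ su]) (use n in \<open>auto simp: u_def\<close>)
  then have "tension_map A D (int n) (cycle_fun x (n + 2) (erev A) u (\<lambda>j. - u j))"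
    using cycle_structD(1,2)[OF c] pl by (simp add: tension_map_def)
  moreover have "signed_genus A = 0" using A signed_genus_0_iff[of A] by (auto simp: plane_cycle_def plane_def)
  ultimately show ?thesis using tension_hom[OF _ B n] by blast
qed

theorem theorem4p23:
  fixes k :: nat and A :: "'a premap" and B :: "'b premap"
  assumes "k \<ge> 1" and "plane_cycle (2 * k + 3) A" and "plane_cycle (2 * k + 1) B"
  shows "hom_exists A B \<and>
    \<not> (\<exists>N :: 'c premap. is_core N \<and> signed_genus N = 0 \<and> hom_less A N \<and> hom_less N B)"
proof -
  have n: "2 * k + 1 \<ge> 3" and A: "plane_cycle (2 * k + 1 + 2) A" using assms(1,2) by (simp_all add: numeral_3_eq_3)
  have "hom_exists A B" by (rule cycle_hom[OF n A assms(3)])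
  moreover have False if "is_core N" "signed_genus N = 0" "hom_less A N" "hom_less N B" for N :: "'c premap"
    using plane_gap[OF n A assms(3), of N] that by (auto simp: is_core_def hom_less_def)
  ultimately show ?thesis by blast
qed

end
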